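(* Let $L_M\ge1$ and $L^{\mathrm I}:=L_1^{\mathrm I}+\dots+L_{M-1}^{\mathrm I}+L_M$. The trigonometric $\mathfrak{gl}_{M+1}$ partition function $\psi=\psi(\bm u^{(1)},\dots,\bm u^{(M)}|\{\bm v_{\mathrm I}^{(1)},\bm v_{\mathrm{II}}^{(1)}\},\dots,\{\bm v_{\mathrm I}^{(M-1)},\bm v_{\mathrm{II}}^{(M-1)}\},\bm v^{(M)}|\bm I)$ satisfies: 1. (Case A) If $i^{(M)}_{L^{\mathrm I}}\ne M+1$, then $\psi$ is a polynomial in $v^{(M)}_{L_M}$ of degree at most $k_M-1$. 2. $\psi$ is symmetric with respect to $u^{(M)}_1,\dots,u^{(M)}_{k_M}$. 3. (Case A, $M\ge2$) If $i^{(M)}_{L^{\mathrm I}}\ne M+1$, then $$\psi\big|_{v^{(M)}_{L_M}=q^{-1}u^{(M)}_{k_M}}=(1-q)u^{(M)}_{k_M}\prod_{j=1}^{L_M-1}\big(u^{(M)}_{k_M}-v^{(M)}_j\big)\prod_{j=1}^{k_M-1}\big(q u^{(M)}_j-u^{(M)}_{k_M}\big)$$ $$\times\ \psi\big(\bm u^{(1)},\dots,\bm u^{(M-1)},\bm u^{(M)}\setminus\{u^{(M)}_{k_M}\}\,\big|\,\{\bm v_{\mathrm I}^{(1)},\bm v_{\mathrm{II}}^{(1)}\},\dots,\{\bm v_{\mathrm I}^{(M-1)},\{u^{(M)}_{k_M}\}\cup\bm v_{\mathrm{II}}^{(M-1)}\},\bm v^{(M)}\setminus\{v^{(M)}_{L_M}\}\,\big|\,\bm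 J\big),$$ where the right-hand partition function has sizes $k_M-1$, $L_{M-1}^{\mathrm{II}}+1$, $L_M-1$ in place of $k_M,L_{M-1}^{\mathrm{II}},L_M$ (others unchanged), and $\bm J^{(i)}=\bm I^{(i)}$ for $1\le i\le M-1$, $\bm J^{(M)}=\bm I^{(M)}\setminus\{L^{\mathrm I}\}$, $\widetilde{\bm J}^{(i)}=\widetilde{\bm I}^{(i)}$ for $1\le i\le M-1$. 4. (Case B) If $i^{(M)}_{L^{\mathrm I}}=M+1$, then $$\psi=\prod_{j=1}^{k_M}\big(u^{(M)}_j-q v^{(M)}_{L_M}\big)\ \psi\big(\bm u^{(1)},\dots,\bm u^{(M)}\,\big|\,\{\bm v_{\mathrm I}^{(1)},\bm v_{\mathrm{II}}^{(1)}\},\dots,\{\bm v_{\mathrm I}^{(M-1)},\bm v_{\mathrm{II}}^{(M-1)}\},\bm v^{(M)}\setminus\{v^{(M)}_{L_M}\}\,\big|\,\bm J\big),$$ where $L_M$ is replaced by $L_M-1$ (other sizes unchanged), and $\bm J^{(i)}=\{j\in\bm I^{(i)}:j\le L^{\mathrm I}\}\cup\{j-1:j\in\bm I^{(i)},\,j>L^{\mathrm I}\}$ for $1\le i\le M-1$, $\bm J^{(M)}=\bm I^{(M)}$, $\widetilde{\bm J}^{(i)}=\widetilde{\bm I}^{(i)}$ for $1\le i\le M-1$. 5. (Initial condition, $M\ge2$) If $k_M=1$ and $i^{(M)}_{L^{\mathrm I}}\ne M+1$, then $$\psi=(1-q)u^{(M)}_1\prod_{j=1}^{L_M-1}\big(u^{(M)}_1-v^{(M)}_j\big)\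 \psi\big(\bm u^{(1)},\dots,\bm u^{(M-1)}\,\big|\,\{\bm v_{\mathrm I}^{(1)},\bm v_{\mathrm{II}}^{(1)}\},\dots,\{\bm v_{\mathrm I}^{(M-2)},\bm v_{\mathrm{II}}^{(M-2)}\},\bm v_{\mathrm I}^{(M-1)}\cup\{u^{(M)}_1\}\cup\bm v_{\mathrm{II}}^{(M-1)}\,\big|\,\bm J\big),$$ where the right-hand side is a $\mathfrak{gl}_M$ partition function ($M-1$ layers) with sizes $k_1,\dots,k_{M-1}$, $L_p^{\mathrm I},L_p^{\mathrm{II}}$ ($p\le M-2$) and top-layer size $L_{M-1}^{\mathrm I}+L_{M-1}^{\mathrm{II}}+1$, and $\bm J^{(i)}=\{j\in\bm I^{(i)}:j<L^{\mathrm I}\}\cup\{j-L_M+1:j\in\bm I^{(i)},\,j\ge L^{\mathrm I}\}$ for $1\le i\le M-1$. Moreover $\widetilde{\bm J}^{(i)}=\widetilde{\bm I}^{(i)}$ for $1\le i\le M-1$, where for $i=M-1$ (the top layer of the $\mathfrak{gl}_M$ function) $\widetilde{\bm J}^{(M-1)}$ denotes $\bm J^{(M-1)}$ shifted down by $L_1^{\mathrm I}+\dots+L_{M-2}^{\mathrm I}$. Here unions and set differences of lists of variables denote concatenation and deletion of ordered lists.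
   Context: **Sizes, variables, coordinates.** Fix $M\ge1$ and nonnegative integers $k_1,\dots,k_M$, $L_p^{\mathrm I},L_p^{\mathrm{II}}$ ($1\le p\le M-1$), $L_M$; $q$ is a nonzero parameter. There are ordered lists of variables $\bm u^{(p)}=(u^{(p)}_1,\dots,u^{(p)}_{k_p})$ ($1\le p\le M$), $\bm v^{(p)}_{\mathrm I}=(v^{(p)}_{\mathrm I,1},\dots,v^{(p)}_{\mathrm I,L^{\mathrm I}_p})$, $\bm v^{(p)}_{\mathrm{II}}=(v^{(p)}_{\mathrm{II},1},\dots,v^{(p)}_{\mathrm{II},L^{\mathrm{II}}_p})$ ($1\le p\le M-1$), $\bm v^{(M)}=(v^{(M)}_1,\dots,v^{(M)}_{L_M})$. The sizes are the lengths of the lists and are omitted from the notation of functions. Order the $v$-variables as $\bm v_{\mathrm I}^{(1)},\dots,\bm v_{\mathrm I}^{(M-1)},\bm v^{(M)},\bm v_{\mathrm{II}}^{(M-1)},\dots,\bm v_{\mathrm{II}}^{(1)}$; the $c$-th variable in this list defines the coordinate $c\in\{1,2,\dots\}$. A coordinate is in layer $p<M$ if its variable belongs to $\bm v_{\mathrm I}^{(p)}$ or $\bm v_{\mathrm{II}}^{(p)}$, and in layer $M$ if it belongs to $\bm v^{(M)}$. (Thus $L^{\mathrm I}$ is the coordinate of $v^{(M)}_{L_M}$.) **Colourings.** A colouring assigns to each coordinate $c$ of layer $p$ a colour $i_c^{(p)}\in\{1,\dots,p+1\}$. For $1\le j\le M$, let $\widehat{\bm I}^{(j)}$ be the set of coordinates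 in layers $j,\dots,M$ and $\bm I^{(j)}=\bm I^{(j)}_{k_j}\subset\widehat{\bm I}^{(j)}$ the subset of those with colour in $\{1,\dots,j\}$. Colourings are always assumed admissible, i.e. $|\bm I^{(j)}|=k_j$ for all $j$. The tuple $\bm I=(\bm I^{(1)},\dots,\bm I^{(M)})$ determines the colouring. For $1\le j\le M-1$, the elements of $\widehat{\bm I}^{(j)}$ with colour in $\{1,\dots,j+1\}$ number $k_{j+1}+L_j^{\mathrm I}+L_j^{\mathrm{II}}$; relabel them in increasing order by $1,2,\dots,k_{j+1}+L_j^{\mathrm I}+L_j^{\mathrm{II}}$, and let $\widetilde{\bm I}^{(j)}$ be the image of $\bm I^{(j)}$. For another colouring given by a tuple $\bm J$, the sets $\widetilde{\bm J}^{(j)}$ are defined in the same way. **Partition function.** Put $N_p=L_p^{\mathrm I}+k_{p+1}+L_p^{\mathrm{II}}$ for $p<M$, $N_M=L_M$. Layer $p$ is a grid with rows $r=1,\dots,k_p$ (top to bottom; row $r$ carries $u^{(p)}_r$) and columns $s=1,\dots,N_p$ (left to right; column $s$ carries the $s$-th entry of the concatenated list $(\bm v^{(p)}_{\mathrm I},\bm u^{(p+1)},\bm v^{(p)}_{\mathrm{II}})$ if $p<M$, and $v^{(M)}_s$ if $p=M$). Edges carry colours in $\{1,\dots,M+1\}$: horizontal $h^{(p)}_{r,s}$ ($0\le s\le N_p$) and vertical edges with colours $t^{(p)}_{r,s}$ ($0\le r\le k_p$); vertex $(r,s)$ has left, right, bottom, top edges $h^{(p)}_{r,s-1},h^{(p)}_{r,s},t^{(p)}_{r,s},t^{(p)}_{r-1,s}$.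 Boundary conditions: $h^{(p)}_{r,N_p}=p+1$ for all $r$; $t^{(p)}_{k_p,s}=p+1$ for all $s$ as bottom boundary colours; $h^{(1)}_{r,0}=1$; $h^{(p+1)}_{r,0}=t^{(p)}_{0,L_p^{\mathrm I}+r}$ for $1\le r\le k_{p+1}$, $p<M$; and the top edge $t^{(p)}_{0,s}$ of a column carrying a $v$-variable has the colour of the corresponding coordinate. A vertex with left, bottom, right, top colours $(a,b,c,d)$, row variable $u$ and column variable $v$ has weight equal to the coefficient of $e_c\otimes e_d$ in $R(u,v)(e_a\otimes e_b)$, where $$R(u,v)=\sum_i(u-qv)E_{ii}\otimes E_{ii}+\sum_{i>j}q(u-v)E_{ii}\otimes E_{jj}+\sum_{i<j}(u-v)E_{ii}\otimes E_{jj}+\sum_{i>j}(1-q)u\,E_{ij}\otimes E_{ji}+\sum_{i<j}(1-q)v\,E_{ij}\otimes E_{ji},$$ with $1\le i,j\le M+1$ and $E_{ij}e_k=\delta_{jk}e_i$. Then $\psi$ is the sum over all edge colourings satisfying the boundary conditions of the product of the weights of all vertices in all layers. *)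

theory Defs
  imports "HOL-Computational_Algebra.Polynomial" "HOL-Combinatorics.Permutations"
    "HOL-Library.FuncSet"
begin

text \<open>
  The layers are numbered from 1 to the field \<open>nlayers\<close> (the rank \<open>M\<close>). Only \<open>uvars X p\<close> with
  \<open>1 \<le> p \<le> M\<close> and \<open>vIvars X p\<close>, \<open>vIIvars X p\<close> with \<open>1 \<le> p < M\<close> are ever used. All sizes are
  the lengths of these lists. List entries are numbered from 0, everything else (rows, columns,
  coordinates, colours) from 1.
\<close>

record 'a vars =
  nlayers :: nat
  uvars :: "nat \<Rightarrow> 'a list"
  vIvars :: "nat \<Rightarrow> 'a list"
  vIIvars :: "nat \<Rightarrow> 'a list"
  vMvars :: "'a list"

text \<open>
  The coordinates of the \<open>s\<close>-th entries of \<open>v_I^(p)\<close>, \<open>v^(M)\<close> and \<open>v_II^(p)\<close>: their positions in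
  the list \<open>v_I^(1), \<dots>, v_I^(M-1), v^(M), v_II^(M-1), \<dots>, v_II^(1)\<close>.
\<close>

definition coordI :: "'a vars \<Rightarrow> nat \<Rightarrow> nat \<Rightarrow> nat" where
  "coordI X p s = (\<Sum>j=1..<p. length (vIvars X j)) + s"

definition coordM :: "'a vars \<Rightarrow> nat \<Rightarrow> nat" where
  "coordM X s = (\<Sum>j=1..<nlayers X. length (vIvars X j)) + s"

definition coordII :: "'a vars \<Rightarrow> nat \<Rightarrow> nat \<Rightarrow> nat" where
  "coordII X p s = (\<Sum>j=1..<nlayers X. length (vIvars X j)) + length (vMvars X)
     + (\<Sum>j=Suc p..<nlayers X. length (vIIvars X j)) + s"

text \<open>The number \<open>L^I\<close>, which is also the coordinate of the last entry of \<open>v^(M)\<close>.\<close>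

definition LItotal :: "'a vars \<Rightarrow> nat" where
  "LItotal X = (\<Sum>j=1..<nlayers X. length (vIvars X j)) + length (vMvars X)"

definition layer_coords :: "'a vars \<Rightarrow> nat \<Rightarrow> nat set" where
  "layer_coords X p =
     (if p = nlayers X then coordM X ` {1..length (vMvars X)}
      else coordI X p ` {1..length (vIvars X p)} \<union> coordII X p ` {1..length (vIIvars X p)})"

text \<open>The set of coordinates in the layers \<open>j, \<dots>, M\<close>, written as \<open>I^(j)\<close> with a hat.\<close>

definition upper_coords :: "'a vars \<Rightarrow> nat \<Rightarrow> nat set" where
  "upper_coords X j = (\<Union>p\<in>{j..nlayers X}. layer_coords X p)"

definition is_colouring :: "'a vars \<Rightarrow> (nat \<Rightarrow> nat) \<Rightarrow> bool" where
  "is_colouring X i \<longleftrightarrow> (\<forall>p\<in>{1..nlayers X}. \<forall>c\<in>layer_coords X p. i c \<in> {1..p + 1})"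

text \<open>The set \<open>I^(j)\<close> of the colouring \<open>i\<close>.\<close>

definition colour_set :: "'a vars \<Rightarrow> (nat \<Rightarrow> nat) \<Rightarrow> nat \<Rightarrow> nat set" where
  "colour_set X i j = {c \<in> upper_coords X j. i c \<in> {1..j}}"

text \<open>
  A tuple of sets \<open>I j\<close>, \<open>1 \<le> j \<le> M\<close> (other indices are irrelevant), is admissible if it comes
  from an admissible colouring.
\<close>

definition admissible :: "'a vars \<Rightarrow> (nat \<Rightarrow> nat set) \<Rightarrow> bool" where
  "admissible X I \<longleftrightarrow>
     (\<exists>i. is_colouring X i \<and>
        (\<forall>j\<in>{1..nlayers X}. I j = colour_set X i j \<and> card (I j) = length (uvars X j)))"

text \<open>
  The colour of a coordinate, recovered from an admissible tuple \<open>I\<close>: a coordinate of layer \<open>p\<close> and colour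
  \<open>a\<close> lies in \<open>I j\<close> iff \<open>a \<le> j \<le> p\<close>, hence in no \<open>I j\<close> iff \<open>a = p + 1\<close>; see \<open>colour_eq\<close> below.
\<close>

definition colour :: "'a vars \<Rightarrow> (nat \<Rightarrow> nat set) \<Rightarrow> nat \<Rightarrow> nat" where
  "colour X I c = (LEAST a. (a \<in> {1..nlayers X} \<and> c \<in> I a) \<or>
                           (\<exists>p\<in>{1..nlayers X}. c \<in> layer_coords X p \<and> a = p + 1))"

lemma layer_coords_unique:
  assumes "c \<in> layer_coords X p" "c \<in> layer_coords X p'"
    "p \<in> {1..nlayers X}" "p' \<in> {1..nlayers X}"
  shows "p = p'"
  using assms
proof (induction p p' rule: linorder_wlog)
  case (le p p')
  show ?case
  proof (rule ccontr)
    assume "p \<noteq> p'"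
    with le have lt: "p < p'" "p < nlayers X" by auto
    define f where "f = (\<lambda>j. length (vIvars X j))"
    define g where "g = (\<lambda>j. length (vIIvars X j))"
    let ?M = "nlayers X"
    have f1: "sum f {1..<p} + f p \<le> sum f {1..<p'}"
    proof -
      have "sum f {1..<p} + f p = sum f {1..<Suc p}" using le by simp
      also have "\<dots> \<le> sum f {1..<p'}" by (rule sum_mono2) (use lt in auto)
      finally show ?thesis .
    qed
    have f2: "sum f {1..<p'} + (if p' = ?M then 0 else f p') \<le> sum f {1..<?M}"
    proof (cases "p' = ?M")
      case False
      have "sum f {1..<p'} + f p' = sum f {1..<Suc p'}" using le by simp
      also have "\<dots> \<le> sum f {1..<?M}" by (rule sum_mono2) (use False le in auto)
      finally show ?thesis using False by simp
    qed auto
    have g: "sum g {Suc p'..<?M} + g p' \<le> sum g {Suc p..<?M}" if "p' \<noteq> ?M"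
    proof -
      have "sum g {Suc p'..<?M} + g p' = sum g {p'..<?M}"
        using that le by (simp add: sum.atLeast_Suc_lessThan)
      also have "\<dots> \<le> sum g {Suc p..<?M}" by (rule sum_mono2) (use lt in auto)
      finally show ?thesis .
    qed
    show False
      using le f1 f2 g lt unfolding layer_coords_def coordI_def coordII_def coordM_def
        f_def[symmetric] g_def[symmetric]
      by (auto split: if_splits simp: f_def[THEN fun_cong, symmetric] g_def[THEN fun_cong, symmetric])
  qed
qed auto

lemma colour_eq:
  assumes i: "is_colouring X i" and I: "\<And>j. j \<in> {1..nlayers X} \<Longrightarrow> I j = colour_set X i j"
    and p: "p \<in> {1..nlayers X}" and c: "c \<in> layer_coords X p"
  shows "colour X I c = i c"
proof -
  have ic: "i c \<in> {1..p + 1}" using i p c unfolding is_colouring_def by blast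
  have lay: "p' = p" if "c \<in> layer_coords X p'" "p' \<in> {1..nlayers X}" for p'
    using layer_coords_unique[OF that(1) c that(2) p] .
  have mem: "c \<in> I a \<longleftrightarrow> i c \<le> a \<and> a \<le> p" if a: "a \<in> {1..nlayers X}" for a
  proof
    assume "c \<in> I a"
    then obtain p' where "p' \<in> {a..nlayers X}" "c \<in> layer_coords X p'" "i c \<le> a"
      using I[OF a] by (auto simp: colour_set_def upper_coords_def)
    then show "i c \<le> a \<and> a \<le> p" using lay[of p'] a by auto
  next
    assume "i c \<le> a \<and> a \<le> p"
    then show "c \<in> I a" using I[OF a] ic c p by (auto simp: colour_set_def upper_coords_def)
  qed
  show ?thesis unfolding colour_def
  proof (rule Least_equality)
    show "i c \<in> {1..nlayers X} \<and> c \<in> I (i c) \<or>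
          (\<exists>p\<in>{1..nlayers X}. c \<in> layer_coords X p \<and> i c = p + 1)"
    proof (cases "i c = p + 1")
      case False
      then show ?thesis using mem[of "i c"] ic p by auto
    qed (use p c in blast)
  next
    fix a assume "a \<in> {1..nlayers X} \<and> c \<in> I a \<or>
          (\<exists>p\<in>{1..nlayers X}. c \<in> layer_coords X p \<and> a = p + 1)"
    then show "i c \<le> a" using mem lay ic by auto
  qed
qed

text \<open>The set \<open>I^(j)\<close> with a tilde, for \<open>1 \<le> j < M\<close>; the relabelling is the rank map.\<close>

definition tilde :: "'a vars \<Rightarrow> (nat \<Rightarrow> nat set) \<Rightarrow> nat \<Rightarrow> nat set" where
  "tilde X I j =
     (\<lambda>c. card {c' \<in> upper_coords X j. colour X I c' \<in> {1..j + 1} \<and> c' \<le> c}) ` I j"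

text \<open>The entry in row \<open>a\<close> and column \<open>b\<close> of the matrix unit \<open>E_ij\<close>.\<close>

definition matunit :: "nat \<Rightarrow> nat \<Rightarrow> nat \<Rightarrow> nat \<Rightarrow> 'a::zero_neq_one" where
  "matunit i j a b = (if a = i \<and> b = j then 1 else 0)"

text \<open>
  \<open>R_coeff n q u v a b c d\<close> is the coefficient of \<open>e_c \<otimes> e_d\<close> in \<open>R(u,v) (e_a \<otimes> e_b)\<close>, where
  \<open>R(u,v)\<close> acts on the tensor square of an \<open>n\<close>-dimensional space.
\<close>

definition R_coeff :: "nat \<Rightarrow> 'a::field \<Rightarrow> 'a \<Rightarrow> 'a \<Rightarrow> nat \<Rightarrow> nat \<Rightarrow> nat \<Rightarrow> nat \<Rightarrow> 'a" where
  "R_coeff n q u v a b c d =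
     (\<Sum>i\<in>{1..n}. (u - q * v) * (matunit i i c a * matunit i i d b))
   + (\<Sum>(i, j)\<in>{(i, j) \<in> {1..n} \<times> {1..n}. i > j}. q * (u - v) * (matunit i i c a * matunit j j d b))
   + (\<Sum>(i, j)\<in>{(i, j) \<in> {1..n} \<times> {1..n}. i < j}. (u - v) * (matunit i i c a * matunit j j d b))
   + (\<Sum>(i, j)\<in>{(i, j) \<in> {1..n} \<times> {1..n}. i > j}. (1 - q) * u * (matunit i j c a * matunit j i d b))
   + (\<Sum>(i, j)\<in>{(i, j) \<in> {1..n} \<times> {1..n}. i < j}. (1 - q) * v * (matunit i j c a * matunit j i d b))"

definition col_vars :: "'a vars \<Rightarrow> nat \<Rightarrow> 'a list" where
  "col_vars X p =
     (if p < nlayers X then vIvars X p @ uvars X (p + 1) @ vIIvars X p else vMvars X)"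

definition nrows :: "'a vars \<Rightarrow> nat \<Rightarrow> nat" where
  "nrows X p = length (uvars X p)"

definition ncols :: "'a vars \<Rightarrow> nat \<Rightarrow> nat" where
  "ncols X p = length (col_vars X p)"

text \<open>Triples \<open>(p, r, s)\<close> consist of a layer, a row index and a column index.\<close>

definition vertices :: "'a vars \<Rightarrow> (nat \<times> nat \<times> nat) set" where
  "vertices X = (SIGMA p:{1..nlayers X}. {1..nrows X p} \<times> {1..ncols X p})"

definition hedges :: "'a vars \<Rightarrow> (nat \<times> nat \<times> nat) set" where
  "hedges X = (SIGMA p:{1..nlayers X}. {1..nrows X p} \<times> {0..ncols X p})"

definition tedges :: "'a vars \<Rightarrow> (nat \<times> nat \<times> nat) set" where
  "tedges X = (SIGMA p:{1..nlayers X}. {0..nrows X p} \<times> {1..ncols X p})"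

definition boundary_conditions ::
  "'a vars \<Rightarrow> (nat \<Rightarrow> nat set) \<Rightarrow> (nat \<times> nat \<times> nat \<Rightarrow> nat) \<Rightarrow> (nat \<times> nat \<times> nat \<Rightarrow> nat) \<Rightarrow> bool"
  where
  "boundary_conditions X I h t \<longleftrightarrow>
     (\<forall>p\<in>{1..nlayers X}. \<forall>r\<in>{1..nrows X p}. h (p, r, ncols X p) = p + 1) \<and>
     (\<forall>p\<in>{1..nlayers X}. \<forall>s\<in>{1..ncols X p}. t (p, nrows X p, s) = p + 1) \<and>
     (\<forall>r\<in>{1..nrows X 1}. h (1, r, 0) = 1) \<and>
     (\<forall>p\<in>{1..<nlayers X}. \<forall>r\<in>{1..nrows X (p + 1)}.
        h (p + 1, r, 0) = t (p, 0, length (vIvars X p) + r)) \<and>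
     (\<forall>p\<in>{1..<nlayers X}. \<forall>s\<in>{1..length (vIvars X p)}.
        t (p, 0, s) = colour X I (coordI X p s)) \<and>
     (\<forall>p\<in>{1..<nlayers X}. \<forall>s\<in>{1..length (vIIvars X p)}.
        t (p, 0, length (vIvars X p) + nrows X (p + 1) + s) = colour X I (coordII X p s)) \<and>
     (\<forall>s\<in>{1..length (vMvars X)}. t (nlayers X, 0, s) = colour X I (coordM X s))"

text \<open>Edge colourings are extensional functions, so that this set is finite.\<close>

definition configurations ::
  "'a vars \<Rightarrow> (nat \<Rightarrow> nat set) \<Rightarrow> ((nat \<times> nat \<times> nat \<Rightarrow> nat) \<times> (nat \<times> nat \<times> nat \<Rightarrow> nat)) set"
  where
  "configurations X I =
     {(h, t). h \<in> hedges X \<rightarrow>\<^sub>E {1..nlayers X + 1} \<and> t \<in> tedges X \<rightarrow>\<^sub>E {1..nlayers X + 1} \<and>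
        boundary_conditions X I h t}"

definition psi :: "'a::field \<Rightarrow> 'a vars \<Rightarrow> (nat \<Rightarrow> nat set) \<Rightarrow> 'a" where
  "psi q X I =
     (\<Sum>(h, t)\<in>configurations X I. \<Prod>(p, r, s)\<in>vertices X.
        R_coeff (nlayers X + 1) q (uvars X p ! (r - 1)) (col_vars X p ! (s - 1))
          (h (p, r, s - 1)) (t (p, r, s)) (h (p, r, s)) (t (p, r - 1, s)))"

end

(*
  Since the horizontal edges of different rows are independent once the vertical edges are fixed,
  and layer p meets layer p + 1 only in the top edges of its u-columns, psi is obtained by stacking
  transfer matrices: a row is a sum over its inner horizontal edges, a layer a product of rows, and
  a layer is attached to the next one by summing over the words of colours between them.

  Symmetry: an R-matrix attached to two neighbouring rows of layer M passes through the rows on the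
  right and through the corresponding columns of layer M - 1 on the left. At both ends all colours
  agree, so it acts as the scalar u - q u', which is cancelled because psi is a polynomial in u.

  The remaining properties come from the last column of layer M, whose right and bottom colours are
  M + 1. If its top colour is M + 1, it is frozen. Otherwise its top colour a enters from the left in
  exactly one row r, with weight (1 - q) u_r, so the factors depending on the column variable v are
  those of the other k_M - 1 rows. At v = u_k / q the factor u_k - q v kills all r other than the
  last row k = k_M, and then this row is frozen as well, carries the colour a, and acts on layer
  M - 1 as a column with a v-variable of colour a.
*)

theory Submission
  imports Defs
begin

section \<open>The vertex weights and the Yang--Baxter equation\<close>

text \<open>The number \<open>n\<close> of colours is a parameter of rows and grids and is not tied
  to the layer, because the initial condition compares a function with M + 1 colours to one with M.
  That the extra colour never occurs below the top layer is a consequence of colour conservation.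
  The identities are proved for \<open>total\<close>, which knows nothing of coordinates and takes
  bare words of colours. The tuples of sets enter only through the words that a colouring writes on
  the top edges, so the index shifts in the statement are a separate matter from the weights. The
  three reductions treat the last coordinate of layer M differently: in case A it keeps its number
  and changes its layer, in case B it disappears, and for k_M = 1 it survives as the coordinate of
  \<open>u\<close> while the other coordinates of layer M disappear. In the last situation a layer
  with one row is frozen for every value of the last variable, which is why no specialisation occurs
  there.\<close>

definition straight :: "'a::field \<Rightarrow> 'a \<Rightarrow> 'a \<Rightarrow> nat \<Rightarrow> nat \<Rightarrow> 'a" where
  "straight q u v a b = (if a < b then u - v else if b < a then q * (u - v) else u - q * v)"

text \<open>For \<open>a = b\<close> going straight and turning are the same outcome. The value 0
  leaves the whole weight to \<open>straight\<close>, so that \<open>weight\<close> can add both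
  terms without counting this case twice.\<close>

definition turn :: "'a::field \<Rightarrow> 'a \<Rightarrow> 'a \<Rightarrow> nat \<Rightarrow> nat \<Rightarrow> 'a" where
  "turn q u v a b = (if a < b then (1 - q) * u else if b < a then (1 - q) * v else 0)"

definition weight :: "'a::field \<Rightarrow> 'a \<Rightarrow> 'a \<Rightarrow> nat \<Rightarrow> nat \<Rightarrow> nat \<Rightarrow> nat \<Rightarrow> 'a" where
  "weight q u v a b c d =
     of_bool (c = a \<and> d = b) * straight q u v a b + of_bool (c = b \<and> d = a) * turn q u v a b"

text \<open>Given the two incoming colours, each of the five sums contributes through at most one
  choice of matrix units; \<open>S\<close>, \<open>T\<close> and \<open>D\<close> isolate it, and
  the range assumption puts it into the index set.\<close>

lemma R_coeff_eq_weight: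
  assumes "a \<in> {1..n}" "b \<in> {1..n}"
  shows "R_coeff n q u v a b c d = weight q u v a b c d"
proof -
  define Q where "Q P = {(i, j) \<in> {1..n} \<times> {1..n}. P i j}" for P :: "nat \<Rightarrow> nat \<Rightarrow> bool"
  have fin: "finite (Q P)" for P
    unfolding Q_def by (rule finite_subset[of _ "{1..n} \<times> {1..n}"]) auto
  have Q: "(a, b) \<in> Q P \<longleftrightarrow> P a b" "(b, a) \<in> Q P \<longleftrightarrow> P b a" for P
    using assms by (auto simp: Q_def)
  have S: "(\<Sum>(i, j)\<in>Q P. K * (matunit i i c a * matunit j j d b)) = of_bool (c = a \<and> d = b \<and> P a b) * K"
    for P and K :: 'a
  proof -
    have "(\<Sum>(i, j)\<in>Q P. K * (matunit i i c a * matunit j j d b))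
        = (\<Sum>p\<in>Q P. if p = (a, b) then of_bool (c = a \<and> d = b) * K else 0)"
      by (rule sum.cong) (auto simp: matunit_def split: if_splits)
    then show ?thesis using fin Q by (simp add: sum.delta)
  qed
  have T: "(\<Sum>(i, j)\<in>Q P. K * (matunit i j c a * matunit j i d b)) = of_bool (c = b \<and> d = a \<and> P b a) * K"
    for P and K :: 'a
  proof -
    have "(\<Sum>(i, j)\<in>Q P. K * (matunit i j c a * matunit j i d b))
        = (\<Sum>p\<in>Q P. if p = (b, a) then of_bool (c = b \<and> d = a) * K else 0)"
      by (rule sum.cong) (auto simp: matunit_def split: if_splits)
    then show ?thesis using fin Q by (simp add: sum.delta)
  qed
  have D: "(\<Sum>i\<in>{1..n}. K * (matunit i i c a * matunit i i d b)) = of_bool (c = a \<and> d = b \<and> a = b) * K"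
    for K :: 'a
  proof -
    have "(\<Sum>i\<in>{1..n}. K * (matunit i i c a * matunit i i d b))
        = (\<Sum>i\<in>{1..n}. if i = a then of_bool (c = a \<and> d = b \<and> a = b) * K else 0)"
      by (rule sum.cong) (auto simp: matunit_def split: if_splits)
    then show ?thesis using assms by (simp add: sum.delta)
  qed
  have "R_coeff n q u v a b c d =
      of_bool (c = a \<and> d = b \<and> a = b) * (u - q * v)
    + of_bool (c = a \<and> d = b \<and> a > b) * (q * (u - v))
    + of_bool (c = a \<and> d = b \<and> a < b) * (u - v)
    + of_bool (c = b \<and> d = a \<and> b > a) * ((1 - q) * u)
    + of_bool (c = b \<and> d = a \<and> b < a) * ((1 - q) * v)"
    unfolding R_coeff_def Q_def[symmetric] D S T ..
  also have "\<dots> = weight q u v a b c d"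
    unfolding weight_def straight_def turn_def
    by (cases a b rule: linorder_cases) simp_all
  finally show ?thesis .
qed

lemma weight_eq_0:
  assumes "(c, d) \<noteq> (a, b)" "(c, d) \<noteq> (b, a)"
  shows "weight q u v a b c d = 0"
proof -
  have "\<not> (c = a \<and> d = b)" "\<not> (c = b \<and> d = a)"
    using assms by blast+
  then show ?thesis
    by (simp only: weight_def of_bool_eq mult_zero_left add_0)
qed

lemma sum_sum_delta:
  assumes "a \<in> {1..n}" "b \<in> {1..n::nat}"
  shows "(\<Sum>c\<in>{1..n}. \<Sum>d\<in>{1..n}. of_bool (c = a \<and> d = b) * f c d) = (f a b :: 'a::semiring_1)"
proof -
  have "(\<Sum>c\<in>{1..n}. \<Sum>d\<in>{1..n}. of_bool (c = a \<and> d = b) * f c d)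
      = (\<Sum>p\<in>{1..n} \<times> {1..n}. if p = (a, b) then f a b else 0)"
    unfolding sum.cartesian_product by (rule sum.cong) (auto simp: of_bool_def split: if_splits)
  also have "\<dots> = f a b"
    using assms by (subst sum.delta) auto
  finally show ?thesis .
qed

lemma sum_weight:
  assumes "a \<in> {1..n}" "b \<in> {1..n}"
  shows "(\<Sum>c\<in>{1..n}. \<Sum>d\<in>{1..n}. weight q u v a b c d * F c d)
    = straight q u v a b * F a b + turn q u v a b * F b a"
proof -
  have "weight q u v a b c d * F c d = of_bool (c = a \<and> d = b) * (straight q u v a b * F c d)
     + of_bool (c = b \<and> d = a) * (turn q u v a b * F c d)" for c d
    unfolding weight_def by (rule trans[OF distrib_right]) (simp only: mult.assoc)
  then have "(\<Sum>c\<in>{1..n}. \<Sum>d\<in>{1..n}. weight q u v a b c d * F c d)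
     = (\<Sum>c\<in>{1..n}. \<Sum>d\<in>{1..n}. of_bool (c = a \<and> d = b) * (straight q u v a b * F c d))
     + (\<Sum>c\<in>{1..n}. \<Sum>d\<in>{1..n}. of_bool (c = b \<and> d = a) * (turn q u v a b * F c d))"
    by (simp only: sum.distrib)
  also have "\<dots> = straight q u v a b * F a b + turn q u v a b * F b a"
    by (simp only: sum_sum_delta[OF assms] sum_sum_delta[OF assms(2,1)])
  finally show ?thesis .
qed

text \<open>
  \<open>R(u,v) (e_a \<otimes> e_b)\<close> evaluated against a test function; the Yang--Baxter equation becomes an
  identity without sums over the inner colours.
\<close>

definition act :: "'a::field \<Rightarrow> 'a \<Rightarrow> 'a \<Rightarrow> nat \<Rightarrow> nat \<Rightarrow> (nat \<Rightarrow> nat \<Rightarrow> 'a) \<Rightarrow> 'a" where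
  "act q u v a b F = straight q u v a b * F a b + turn q u v a b * F b a"

text \<open>Both sides are combinations of values of \<open>F\<close> at rearrangements of
  \<open>a, b, c\<close>, with coefficients that depend only on the relative order of the three
  colours. There are 13 weak orders, and each gives polynomial identities in
  \<open>q, x, y, z\<close>.\<close>

lemma yang_baxter_act:
  "act q x y a b (\<lambda>a b. act q x z a c (\<lambda>a c. act q y z b c (\<lambda>b c. F a b c)))
     = act q y z b c (\<lambda>b c. act q x z a c (\<lambda>a c. act q x y a b (\<lambda>a b. F a b c)))"
proof -
  consider "b = a" "c = a" | "b = a" "a < c" | "b = a" "c < a" | "c = b" "a < b" | "c = b" "b < a"
    | "c = a" "a < b" | "c = a" "b < a"
    | "a < b" "b < c" "a < c" | "a < c" "c < b" "a < b" | "b < a" "a < c" "b < c"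
    | "b < c" "c < a" "b < a" | "c < a" "a < b" "c < b" | "c < b" "b < a" "c < a"
    by (cases a b rule: linorder_cases; cases b c rule: linorder_cases; cases a c rule: linorder_cases; metis less_trans)
  then show ?thesis
    by cases (simp add: act_def straight_def turn_def; simp add: algebra_simps)+
qed

section \<open>Rows and grids of vertices\<close>

definition words :: "nat \<Rightarrow> nat \<Rightarrow> nat list set" where
  "words n N = {xs. set xs \<subseteq> {1..n} \<and> length xs = N}"

lemma finite_words [simp, intro]: "finite (words n N)"
  unfolding words_def by (rule finite_lists_length_eq) simp

lemma words_0 [simp]: "words n 0 = {[]}"
  by (auto simp: words_def)

lemma sum_words_Suc:
  "(\<Sum>xs\<in>words n (Suc N). f xs) = (\<Sum>x\<in>{1..n}. \<Sum>xs\<in>words n N. f (x # xs))"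
proof -
  have "(\<Sum>xs\<in>words n (Suc N). f xs) = (\<Sum>p\<in>{1..n} \<times> words n N. f (fst p # snd p))"
    by (rule sum.reindex_bij_witness[of _ "\<lambda>p. fst p # snd p" "\<lambda>xs. (hd xs, tl xs)"])
       (auto simp: words_def length_Suc_conv)
  then show ?thesis by (simp add: sum.cartesian_product case_prod_beta)
qed

lemma sum_words_add:
  "(\<Sum>xs\<in>words n (N + K). f xs) = (\<Sum>xs\<in>words n N. \<Sum>ys\<in>words n K. f (xs @ ys))"
  by (induction N arbitrary: f) (simp_all add: sum_words_Suc)

lemma replicate_in_words: "m \<in> {1..n} \<Longrightarrow> replicate N m \<in> words n N"
  by (auto simp: words_def)

text \<open>The colours come in the order left, bottom, top, right. Words of the wrong length give
  0, so that the lemmas on polynomial dependence and on conservation of colours need no length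
  assumptions.\<close>

fun row :: "nat \<Rightarrow> 'a::field \<Rightarrow> 'a \<Rightarrow> 'a list \<Rightarrow> nat \<Rightarrow> nat list \<Rightarrow> nat list \<Rightarrow> nat \<Rightarrow> 'a" where
  "row n q u [] a [] [] c = of_bool (a = c)"
| "row n q u (v # vs) a (b # bs) (t # ts) c =
     (\<Sum>e\<in>{1..n}. weight q u v a b e t * row n q u vs e bs ts c)"
| "row n q u vs a bs ts c = 0"

fun grid :: "nat \<Rightarrow> 'a::field \<Rightarrow> 'a list \<Rightarrow> 'a list \<Rightarrow> nat list \<Rightarrow> nat list \<Rightarrow> nat list \<Rightarrow> nat list \<Rightarrow> 'a" where
  "grid n q [] vs [] bs ts [] = of_bool (bs = ts)"
| "grid n q (u # us) vs (l # ls) bs ts (r # rs) =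
     (\<Sum>ms\<in>words n (length vs). row n q u vs l ms ts r * grid n q us vs ls bs ms rs)"
| "grid n q us vs ls bs ts rs = 0"

section \<open>An R-matrix passing through two neighbouring rows\<close>

definition two_rows ::
  "nat \<Rightarrow> 'a::field \<Rightarrow> 'a \<Rightarrow> 'a \<Rightarrow> 'a list \<Rightarrow> nat \<Rightarrow> nat \<Rightarrow> nat list \<Rightarrow> nat list \<Rightarrow> nat \<Rightarrow> nat \<Rightarrow> 'a" where
  "two_rows n q u u' vs l l' bs ts r r' =
     (\<Sum>ms\<in>words n (length vs). row n q u vs l ms ts r * row n q u' vs l' bs ms r')"

lemma two_rows_Nil: "two_rows n q u u' [] l l' [] [] r r' = of_bool (l = r \<and> l' = r')"
  by (simp add: two_rows_def)

lemma two_rows_Cons: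
  "two_rows n q u u' (v # vs) l l' (b # bs) (t # ts) r r' =
     (\<Sum>m\<in>{1..n}. \<Sum>e\<in>{1..n}. \<Sum>e'\<in>{1..n}.
        weight q u v l m e t * weight q u' v l' b e' m * two_rows n q u u' vs e e' bs ts r r')"
proof -
  have "two_rows n q u u' (v # vs) l l' (b # bs) (t # ts) r r' =
    (\<Sum>m\<in>{1..n}. \<Sum>ms\<in>words n (length vs). \<Sum>e\<in>{1..n}. \<Sum>e'\<in>{1..n}.
        weight q u v l m e t * weight q u' v l' b e' m * (row n q u vs e ms ts r * row n q u' vs e' bs ms r'))"
    by (simp add: two_rows_def sum_words_Suc sum_product mult_ac)
  also have "\<dots> = (\<Sum>m\<in>{1..n}. \<Sum>e\<in>{1..n}. \<Sum>e'\<in>{1..n}. \<Sum>ms\<in>words n (length vs).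
        weight q u v l m e t * weight q u' v l' b e' m * (row n q u vs e ms ts r * row n q u' vs e' bs ms r'))"
    by (subst sum.swap[where A = "words n (length vs)"], subst sum.swap[where A = "words n (length vs)"]) (rule refl)
  finally show ?thesis by (simp add: two_rows_def sum_distrib_left)
qed

text \<open>A prescribed top colour becomes a test function supported at that colour. In this way
  boundary colours are fed into \<open>yang_baxter_act\<close>.\<close>

lemma sum_weight_of_bool:
  assumes "a \<in> {1..n}" "b \<in> {1..n}" "t \<in> {1..n}"
  shows "(\<Sum>e\<in>{1..n}. weight q u v a b e t * H e) = act q u v a b (\<lambda>e x. of_bool (x = t) * H e)"
proof -
  have "act q u v a b (\<lambda>e x. of_bool (x = t) * H e)
     = (\<Sum>e\<in>{1..n}. \<Sum>x\<in>{1..n}. weight q u v a b e x * (of_bool (x = t) * H e))"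
    using assms by (simp only: sum_weight act_def)
  also have "\<dots> = (\<Sum>e\<in>{1..n}. \<Sum>x\<in>{1..n}. if x = t then weight q u v a b e t * H e else 0)"
    by (intro sum.cong refl) auto
  finally show ?thesis using assms by (simp add: sum.delta)
qed

lemma act_cong:
  assumes "\<And>c d. c \<in> {1..n} \<Longrightarrow> d \<in> {1..n} \<Longrightarrow> H c d = K c d" "a \<in> {1..n}" "b \<in> {1..n}"
  shows "act q u v a b H = act q u v a b K"
  using assms by (simp add: act_def)

text \<open>This is the Yang-Baxter equation for the lines \<open>u\<close>, \<open>u'\<close>,
  \<open>v\<close> at one column. The test function \<open>G\<close> stands for everything to the
  right, so that an induction over the columns can substitute the rest of the two rows for
  it.\<close>

lemma yang_baxter_rows_local:
  assumes "l \<in> {1..n}" "l' \<in> {1..n}" "b \<in> {1..n}" "t \<in> {1..n}"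
  shows "(\<Sum>m\<in>{1..n}. \<Sum>m'\<in>{1..n}. weight q u u' l l' m m' *
            (\<Sum>x\<in>{1..n}. \<Sum>e'\<in>{1..n}. \<Sum>e\<in>{1..n}. weight q u' v m' x e' t * weight q u v m b e x * G e e'))
       = (\<Sum>x\<in>{1..n}. \<Sum>e\<in>{1..n}. \<Sum>e'\<in>{1..n}. weight q u v l x e t * weight q u' v l' b e' x *
            (\<Sum>m\<in>{1..n}. \<Sum>m'\<in>{1..n}. weight q u u' e e' m m' * G m m'))"
proof -
  define F where "F e e' x = of_bool (x = t) * G e e'" for e e' x
  have "(\<Sum>m\<in>{1..n}. \<Sum>m'\<in>{1..n}. weight q u u' l l' m m' *
            (\<Sum>x\<in>{1..n}. \<Sum>e'\<in>{1..n}. \<Sum>e\<in>{1..n}. weight q u' v m' x e' t * weight q u v m b e x * G e e'))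
     = act q u u' l l' (\<lambda>m m'. \<Sum>x\<in>{1..n}. \<Sum>e'\<in>{1..n}. \<Sum>e\<in>{1..n}. weight q u' v m' x e' t * weight q u v m b e x * G e e')"
    using assms by (simp only: sum_weight act_def)
  also have "\<dots> = act q u u' l l' (\<lambda>m m'. act q u v m b (\<lambda>e x. act q u' v m' x (\<lambda>e' y. F e e' y)))"
  proof (rule act_cong[where n = n])
    fix m m' assume m: "m \<in> {1..n}" "m' \<in> {1..n}"
    have "(\<Sum>x\<in>{1..n}. \<Sum>e'\<in>{1..n}. \<Sum>e\<in>{1..n}. weight q u' v m' x e' t * weight q u v m b e x * G e e')
       = (\<Sum>x\<in>{1..n}. \<Sum>e\<in>{1..n}. \<Sum>e'\<in>{1..n}. weight q u' v m' x e' t * weight q u v m b e x * G e e')"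
      by (intro sum.cong refl sum.swap)
    also have "\<dots> = (\<Sum>e\<in>{1..n}. \<Sum>x\<in>{1..n}. \<Sum>e'\<in>{1..n}. weight q u' v m' x e' t * weight q u v m b e x * G e e')"
      by (rule sum.swap)
    also have "\<dots> = (\<Sum>e\<in>{1..n}. \<Sum>x\<in>{1..n}. weight q u v m b e x * (\<Sum>e'\<in>{1..n}. weight q u' v m' x e' t * G e e'))"
      by (simp add: sum_distrib_left mult_ac)
    also have "\<dots> = act q u v m b (\<lambda>e x. \<Sum>e'\<in>{1..n}. weight q u' v m' x e' t * G e e')"
      using m assms by (simp only: sum_weight act_def)
    also have "\<dots> = act q u v m b (\<lambda>e x. act q u' v m' x (\<lambda>e' y. F e e' y))"
      by (rule act_cong[where n = n]) (use m assms in \<open>simp_all only: sum_weight_of_bool F_def\<close>)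
    finally show "(\<Sum>x\<in>{1..n}. \<Sum>e'\<in>{1..n}. \<Sum>e\<in>{1..n}. weight q u' v m' x e' t * weight q u v m b e x * G e e')
        = act q u v m b (\<lambda>e x. act q u' v m' x (\<lambda>e' y. F e e' y))" .
  qed (use assms in auto)
  also have "\<dots> = act q u' v l' b (\<lambda>e' x. act q u v l x (\<lambda>e y. act q u u' e e' (\<lambda>m m'. F m m' y)))"
    by (rule yang_baxter_act)
  also have "\<dots> = act q u' v l' b (\<lambda>e' x. (\<Sum>e\<in>{1..n}. weight q u v l x e t * (\<Sum>m\<in>{1..n}. \<Sum>m'\<in>{1..n}. weight q u u' e e' m m' * G m m')))"
  proof (rule act_cong[where n = n])
    fix e' x assume e: "e' \<in> {1..n}" "x \<in> {1..n}"
    have "(\<Sum>e\<in>{1..n}. weight q u v l x e t * (\<Sum>m\<in>{1..n}. \<Sum>m'\<in>{1..n}. weight q u u' e e' m m' * G m m'))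
      = act q u v l x (\<lambda>e y. of_bool (y = t) * (\<Sum>m\<in>{1..n}. \<Sum>m'\<in>{1..n}. weight q u u' e e' m m' * G m m'))"
      using assms e by (simp only: sum_weight_of_bool)
    also have "\<dots> = act q u v l x (\<lambda>e y. act q u u' e e' (\<lambda>m m'. F m m' y))"
    proof (rule act_cong[where n = n])
      fix c d assume "c \<in> {1..n}" "d \<in> {1..n}"
      then show "of_bool (d = t) * (\<Sum>m\<in>{1..n}. \<Sum>m'\<in>{1..n}. weight q u u' c e' m m' * G m m') =
         act q u u' c e' (\<lambda>m m'. F m m' d)"
        using e by (simp only: sum_weight act_def F_def) (simp add: algebra_simps)
    qed (use assms e in auto)
    finally show "act q u v l x (\<lambda>e y. act q u u' e e' (\<lambda>m m'. F m m' y)) =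
       (\<Sum>e\<in>{1..n}. weight q u v l x e t * (\<Sum>m\<in>{1..n}. \<Sum>m'\<in>{1..n}. weight q u u' e e' m m' * G m m'))" ..
  qed (use assms in auto)
  also have "\<dots> = (\<Sum>e'\<in>{1..n}. \<Sum>x\<in>{1..n}. weight q u' v l' b e' x * (\<Sum>e\<in>{1..n}. weight q u v l x e t * (\<Sum>m\<in>{1..n}. \<Sum>m'\<in>{1..n}. weight q u u' e e' m m' * G m m')))"
    using assms by (simp only: sum_weight act_def)
  also have "\<dots> = (\<Sum>x\<in>{1..n}. \<Sum>e'\<in>{1..n}. \<Sum>e\<in>{1..n}. weight q u v l x e t * weight q u' v l' b e' x * (\<Sum>m\<in>{1..n}. \<Sum>m'\<in>{1..n}. weight q u u' e e' m m' * G m m'))"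
    by (subst sum.swap) (simp add: sum_distrib_left mult_ac)
  also have "\<dots> = (\<Sum>x\<in>{1..n}. \<Sum>e\<in>{1..n}. \<Sum>e'\<in>{1..n}. weight q u v l x e t * weight q u' v l' b e' x * (\<Sum>m\<in>{1..n}. \<Sum>m'\<in>{1..n}. weight q u u' e e' m m' * G m m'))"
    by (intro sum.cong refl sum.swap)
  finally show ?thesis .
qed

text \<open>The R-vertex is carried from the left end to the right end, one column at a time. The
  two lines cross in it: columns to its right have the row of \<open>u'\<close> on top, columns to
  its left the row of \<open>u\<close>.\<close>

lemma two_rows_swap:
  assumes "l \<in> {1..n}" "l' \<in> {1..n}" "set bs \<subseteq> {1..n}" "set ts \<subseteq> {1..n}" "r \<in> {1..n}" "r' \<in> {1..n}"
    and "length bs = length vs" "length ts = length vs"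
  shows "(\<Sum>m\<in>{1..n}. \<Sum>m'\<in>{1..n}. weight q u u' l l' m m' * two_rows n q u' u vs m' m bs ts r' r)
       = (\<Sum>m\<in>{1..n}. \<Sum>m'\<in>{1..n}. two_rows n q u u' vs l l' bs ts m m' * weight q u u' m m' r r')"
  using assms
proof (induction vs arbitrary: l l' bs ts)
  case Nil
  have "(\<Sum>m\<in>{1..n}. \<Sum>m'\<in>{1..n}. weight q u u' l l' m m' * of_bool (m' = r' \<and> m = r))
     = (\<Sum>m\<in>{1..n}. if m = r then (\<Sum>m'\<in>{1..n}. if m' = r' then weight q u u' l l' r r' else 0) else 0)"
    by (intro sum.cong refl) (auto intro!: sum.cong)
  moreover have "(\<Sum>m\<in>{1..n}. \<Sum>m'\<in>{1..n}. of_bool (l = m \<and> l' = m') * weight q u u' m m' r r')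
     = (\<Sum>m\<in>{1..n}. if m = l then (\<Sum>m'\<in>{1..n}. if m' = l' then weight q u u' l l' r r' else 0) else 0)"
    by (intro sum.cong refl) (auto intro!: sum.cong)
  ultimately show ?case using Nil by (simp add: two_rows_Nil sum.delta)
next
  case (Cons v vs)
  obtain b bs' t ts' where [simp]: "bs = b # bs'" "ts = t # ts'"
    using Cons.prems by (metis length_Suc_conv)
  have prems: "b \<in> {1..n}" "t \<in> {1..n}" "set bs' \<subseteq> {1..n}" "set ts' \<subseteq> {1..n}" "length bs' = length vs" "length ts' = length vs"
    using Cons.prems by auto
  define G where "G e e' = two_rows n q u' u vs e' e bs' ts' r' r" for e e'
  have "(\<Sum>m\<in>{1..n}. \<Sum>m'\<in>{1..n}. weight q u u' l l' m m' * two_rows n q u' u (v # vs) m' m bs ts r' r)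
    = (\<Sum>m\<in>{1..n}. \<Sum>m'\<in>{1..n}. weight q u u' l l' m m' *
            (\<Sum>x\<in>{1..n}. \<Sum>e'\<in>{1..n}. \<Sum>e\<in>{1..n}. weight q u' v m' x e' t * weight q u v m b e x * G e e'))"
    by (simp add: two_rows_Cons G_def)
  also have "\<dots> = (\<Sum>x\<in>{1..n}. \<Sum>e\<in>{1..n}. \<Sum>e'\<in>{1..n}. weight q u v l x e t * weight q u' v l' b e' x *
            (\<Sum>m\<in>{1..n}. \<Sum>m'\<in>{1..n}. weight q u u' e e' m m' * G m m'))"
    by (rule yang_baxter_rows_local) (use Cons.prems prems in auto)
  also have "\<dots> = (\<Sum>x\<in>{1..n}. \<Sum>e\<in>{1..n}. \<Sum>e'\<in>{1..n}. weight q u v l x e t * weight q u' v l' b e' x *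
            (\<Sum>m\<in>{1..n}. \<Sum>m'\<in>{1..n}. two_rows n q u u' vs e e' bs' ts' m m' * weight q u u' m m' r r'))"
    unfolding G_def using Cons.prems prems by (intro Cons.IH sum.cong refl arg_cong2[of _ _ _ _ "(*)"]) auto
  also have "\<dots> = (\<Sum>x\<in>{1..n}. \<Sum>e\<in>{1..n}. \<Sum>e'\<in>{1..n}. \<Sum>m\<in>{1..n}. \<Sum>m'\<in>{1..n}. weight q u v l x e t * weight q u' v l' b e' x *
            two_rows n q u u' vs e e' bs' ts' m m' * weight q u u' m m' r r')"
    by (simp add: sum_distrib_left mult_ac)
  also have "\<dots> = (\<Sum>m\<in>{1..n}. \<Sum>m'\<in>{1..n}. \<Sum>x\<in>{1..n}. \<Sum>e\<in>{1..n}. \<Sum>e'\<in>{1..n}. weight q u v l x e t * weight q u' v l' b e' x *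
            two_rows n q u u' vs e e' bs' ts' m m' * weight q u u' m m' r r')"
    unfolding sum.cartesian_product
    by (rule sum.reindex_bij_witness[of _ "\<lambda>(m,m',x,e,e'). (x,e,e',m,m')" "\<lambda>(x,e,e',m,m'). (m,m',x,e,e')"]) auto
  finally show ?case by (simp add: two_rows_Cons sum_distrib_right)
qed

section \<open>An R-matrix passing through two neighbouring columns\<close>

lemma yang_baxter_columns_local:
  assumes "l \<in> {1..n}" "b \<in> {1..n}" "b' \<in> {1..n}" "t \<in> {1..n}" "t' \<in> {1..n}"
  shows "(\<Sum>c\<in>{1..n}. \<Sum>d\<in>{1..n}.
            (\<Sum>e\<in>{1..n}. \<Sum>r\<in>{1..n}. weight q x y l b e c * weight q x y' e b' r d * G r) * weight q y y' c d t t')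
       = (\<Sum>c\<in>{1..n}. \<Sum>d\<in>{1..n}. weight q y y' b b' c d *
            (\<Sum>e\<in>{1..n}. \<Sum>r\<in>{1..n}. weight q x y' l d e t' * weight q x y e c r t * G r))"
proof -
  define F where "F r s s' = of_bool (s' = t') * (of_bool (s = t) * G r)" for r s s'
  have F: "weight q y y' c d t t' * G r = act q y y' c d (\<lambda>s s'. F r s s')"
    if "c \<in> {1..n}" "d \<in> {1..n}" for c d r
  proof -
    have "act q y y' c d (\<lambda>s s'. F r s s') = (\<Sum>s\<in>{1..n}. weight q y y' c d s t' * (of_bool (s = t) * G r))"
      unfolding F_def by (rule sum_weight_of_bool[symmetric]) (use that assms in auto)
    also have "\<dots> = (\<Sum>s\<in>{1..n}. if s = t then weight q y y' c d t t' * G r else 0)"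
      by (intro sum.cong refl) auto
    finally show ?thesis using assms by (simp add: sum.delta)
  qed
  have "(\<Sum>c\<in>{1..n}. \<Sum>d\<in>{1..n}.
            (\<Sum>e\<in>{1..n}. \<Sum>r\<in>{1..n}. weight q x y l b e c * weight q x y' e b' r d * G r) * weight q y y' c d t t')
     = (\<Sum>c\<in>{1..n}. \<Sum>d\<in>{1..n}. \<Sum>e\<in>{1..n}. \<Sum>r\<in>{1..n}.
          weight q x y l b e c * (weight q x y' e b' r d * (weight q y y' c d t t' * G r)))"
    by (simp add: sum_distrib_left sum_distrib_right mult_ac)
  also have "\<dots> = (\<Sum>e\<in>{1..n}. \<Sum>c\<in>{1..n}. \<Sum>r\<in>{1..n}. \<Sum>d\<in>{1..n}.
          weight q x y l b e c * (weight q x y' e b' r d * (weight q y y' c d t t' * G r)))"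
    unfolding sum.cartesian_product
    by (rule sum.reindex_bij_witness[of _ "\<lambda>(e,c,r,d). (c,d,e,r)" "\<lambda>(c,d,e,r). (e,c,r,d)"]) auto
  also have "\<dots> = (\<Sum>e\<in>{1..n}. \<Sum>c\<in>{1..n}. weight q x y l b e c *
       (\<Sum>r\<in>{1..n}. \<Sum>d\<in>{1..n}. weight q x y' e b' r d * (weight q y y' c d t t' * G r)))"
    by (simp add: sum_distrib_left)
  also have "\<dots> = act q x y l b (\<lambda>e c. \<Sum>r\<in>{1..n}. \<Sum>d\<in>{1..n}. weight q x y' e b' r d * (weight q y y' c d t t' * G r))"
    using assms by (simp only: sum_weight act_def)
  also have "\<dots> = act q x y l b (\<lambda>e c. act q x y' e b' (\<lambda>r d. act q y y' c d (\<lambda>s s'. F r s s')))"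
  proof (rule act_cong[where n = n])
    fix e c assume ec: "e \<in> {1..n}" "c \<in> {1..n}"
    have "(\<Sum>r\<in>{1..n}. \<Sum>d\<in>{1..n}. weight q x y' e b' r d * (weight q y y' c d t t' * G r))
       = act q x y' e b' (\<lambda>r d. weight q y y' c d t t' * G r)"
      using assms ec by (simp only: sum_weight act_def)
    also have "\<dots> = act q x y' e b' (\<lambda>r d. act q y y' c d (\<lambda>s s'. F r s s'))"
      by (rule act_cong[where n = n]) (use assms ec F in auto)
    finally show "(\<Sum>r\<in>{1..n}. \<Sum>d\<in>{1..n}. weight q x y' e b' r d * (weight q y y' c d t t' * G r)) = \<dots>" .
  qed (use assms in auto)
  also have "\<dots> = act q y y' b b' (\<lambda>c d. act q x y' l d (\<lambda>e s'. act q x y e c (\<lambda>r s. F r s s')))"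
    by (rule yang_baxter_act)
  also have "\<dots> = act q y y' b b' (\<lambda>c d. \<Sum>e\<in>{1..n}. \<Sum>r\<in>{1..n}. weight q x y' l d e t' * weight q x y e c r t * G r)"
  proof (rule act_cong[where n = n])
    fix c d assume cd: "c \<in> {1..n}" "d \<in> {1..n}"
    have "act q x y' l d (\<lambda>e s'. act q x y e c (\<lambda>r s. F r s s'))
      = act q x y' l d (\<lambda>e s'. of_bool (s' = t') * act q x y e c (\<lambda>r s. of_bool (s = t) * G r))"
      unfolding act_def F_def by (simp add: algebra_simps)
    also have "\<dots> = (\<Sum>e\<in>{1..n}. weight q x y' l d e t' * act q x y e c (\<lambda>r s. of_bool (s = t) * G r))"
      by (rule sum_weight_of_bool[symmetric]) (use cd assms in auto)
    also have "\<dots> = (\<Sum>e\<in>{1..n}. weight q x y' l d e t' * (\<Sum>r\<in>{1..n}. weight q x y e c r t * G r))"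
    proof (intro sum.cong refl arg_cong2[of _ _ _ _ "(*)"])
      fix e assume "e \<in> {1..n}"
      then show "act q x y e c (\<lambda>r s. of_bool (s = t) * G r) = (\<Sum>r\<in>{1..n}. weight q x y e c r t * G r)"
        by (intro sum_weight_of_bool[symmetric]) (use cd assms in auto)
    qed
    finally show "act q x y' l d (\<lambda>e s'. act q x y e c (\<lambda>r s. F r s s'))
       = (\<Sum>e\<in>{1..n}. \<Sum>r\<in>{1..n}. weight q x y' l d e t' * weight q x y e c r t * G r)"
      by (simp add: sum_distrib_left sum_distrib_right mult_ac)
  qed (use assms in auto)
  also have "\<dots> = (\<Sum>c\<in>{1..n}. \<Sum>d\<in>{1..n}. weight q y y' b b' c d *
            (\<Sum>e\<in>{1..n}. \<Sum>r\<in>{1..n}. weight q x y' l d e t' * weight q x y e c r t * G r))"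
    using assms by (simp only: sum_weight act_def)
  finally show ?thesis .
qed

text \<open>Only the two crossing columns take part in the local identity: the columns
  \<open>A\<close> are peeled off by induction, and the columns \<open>B\<close> are hidden in its
  test function.\<close>

lemma row_swap_columns:
  assumes "l \<in> {1..n}" "set bs \<subseteq> {1..n}" "b \<in> {1..n}" "b' \<in> {1..n}" "t \<in> {1..n}" "t' \<in> {1..n}"
    and "length bs = length A" "length ts = length A"
  shows "(\<Sum>c\<in>{1..n}. \<Sum>d\<in>{1..n}.
            row n q x (A @ y # y' # B) l (bs @ b # b' # bs') (ts @ c # d # ts') r * weight q y y' c d t t')
       = (\<Sum>c\<in>{1..n}. \<Sum>d\<in>{1..n}. weight q y y' b b' c d *
            row n q x (A @ y' # y # B) l (bs @ d # c # bs') (ts @ t' # t # ts') r)"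
  using assms
proof (induction A arbitrary: l bs ts)
  case Nil
  then show ?case
    using yang_baxter_columns_local[of l n b b' t t' q x y y' "\<lambda>e. row n q x B e bs' ts' r"]
    by (simp add: sum_distrib_left sum_distrib_right mult_ac)
next
  case (Cons v A)
  obtain b0 bs0 t0 ts0 where [simp]: "bs = b0 # bs0" "ts = t0 # ts0"
    using Cons.prems by (metis length_Suc_conv)
  let ?R = "\<lambda>e c d. row n q x (A @ y # y' # B) e (bs0 @ b # b' # bs') (ts0 @ c # d # ts') r"
  let ?R' = "\<lambda>e c d. row n q x (A @ y' # y # B) e (bs0 @ d # c # bs') (ts0 @ t' # t # ts') r"
  have "(\<Sum>c\<in>{1..n}. \<Sum>d\<in>{1..n}. (\<Sum>e\<in>{1..n}. weight q x v l b0 e t0 * ?R e c d) * weight q y y' c d t t')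
     = (\<Sum>c\<in>{1..n}. \<Sum>d\<in>{1..n}. \<Sum>e\<in>{1..n}. weight q x v l b0 e t0 * (?R e c d * weight q y y' c d t t'))"
    by (simp add: sum_distrib_left sum_distrib_right mult_ac)
  also have "\<dots> = (\<Sum>e\<in>{1..n}. \<Sum>c\<in>{1..n}. \<Sum>d\<in>{1..n}. weight q x v l b0 e t0 * (?R e c d * weight q y y' c d t t'))"
    unfolding sum.cartesian_product
    by (rule sum.reindex_bij_witness[of _ "\<lambda>(e,c,d). (c,d,e)" "\<lambda>(c,d,e). (e,c,d)"]) auto
  also have "\<dots> = (\<Sum>e\<in>{1..n}. weight q x v l b0 e t0 * (\<Sum>c\<in>{1..n}. \<Sum>d\<in>{1..n}. ?R e c d * weight q y y' c d t t'))"
    by (simp add: sum_distrib_left)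
  also have "\<dots> = (\<Sum>e\<in>{1..n}. weight q x v l b0 e t0 * (\<Sum>c\<in>{1..n}. \<Sum>d\<in>{1..n}. weight q y y' b b' c d * ?R' e c d))"
    using Cons.prems by (intro Cons.IH sum.cong refl arg_cong2[of _ _ _ _ "(*)"]) auto
  also have "\<dots> = (\<Sum>e\<in>{1..n}. \<Sum>c\<in>{1..n}. \<Sum>d\<in>{1..n}. weight q y y' b b' c d * (weight q x v l b0 e t0 * ?R' e c d))"
    by (simp add: sum_distrib_left sum_distrib_right mult_ac)
  also have "\<dots> = (\<Sum>c\<in>{1..n}. \<Sum>d\<in>{1..n}. \<Sum>e\<in>{1..n}. weight q y y' b b' c d * (weight q x v l b0 e t0 * ?R' e c d))"
    unfolding sum.cartesian_product
    by (rule sum.reindex_bij_witness[of _ "\<lambda>(c,d,e). (e,c,d)" "\<lambda>(e,c,d). (c,d,e)"]) auto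
  finally show ?case by (simp add: sum_distrib_left)
qed

lemma sum_words_split_two:
  "(\<Sum>xs\<in>words n (length (A @ y # y' # B)). f xs)
     = (\<Sum>as\<in>words n (length A). \<Sum>c\<in>{1..n}. \<Sum>d\<in>{1..n}. \<Sum>bs\<in>words n (length B). f (as @ c # d # bs))"
  using sum_words_add[of f n "length A" "Suc (Suc (length B))"] by (simp add: sum_words_Suc)

lemma length_in_words: "xs \<in> words n N \<Longrightarrow> length xs = N"
  and set_in_words: "xs \<in> words n N \<Longrightarrow> set xs \<subseteq> {1..n}"
  by (auto simp: words_def)

lemma append_two_eq_iff:
  assumes "length as = length cs"
  shows "as @ a # a' # bs = cs @ c # c' # ds \<longleftrightarrow> as = cs \<and> a = c \<and> a' = c' \<and> bs = ds"
  using assms by auto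

text \<open>The vertex on the top edges of the two columns sinks through one row at a time. Below
  the top row it sits at the same position of the inner word, which is why the induction generalises
  over the top colours.\<close>

lemma grid_swap_columns:
  assumes "set ls \<subseteq> {1..n}" "set bs \<subseteq> {1..n}" "b \<in> {1..n}" "b' \<in> {1..n}" "t \<in> {1..n}" "t' \<in> {1..n}"
    and "length bs = length A" "length ts = length A"
    and "length ls = length us" "length rs = length us"
  shows "(\<Sum>c\<in>{1..n}. \<Sum>d\<in>{1..n}.
            grid n q us (A @ y # y' # B) ls (bs @ b # b' # bs') (ts @ c # d # ts') rs * weight q y y' c d t t')
       = (\<Sum>c\<in>{1..n}. \<Sum>d\<in>{1..n}. weight q y y' b b' c d *
            grid n q us (A @ y' # y # B) ls (bs @ d # c # bs') (ts @ t' # t # ts') rs)"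
  using assms
proof (induction us arbitrary: ls rs ts t t' ts')
  case Nil
  then have [simp]: "ls = []" "rs = []" "length bs = length ts" by auto
  let ?p = "bs = ts \<and> bs' = ts'"
  have "(\<Sum>c\<in>{1..n}. \<Sum>d\<in>{1..n}. of_bool (bs @ b # b' # bs' = ts @ c # d # ts') * weight q y y' c d t t')
     = (\<Sum>c\<in>{1..n}. \<Sum>d\<in>{1..n}. of_bool (c = b \<and> d = b') * (of_bool ?p * weight q y y' c d t t'))"
    by (intro sum.cong refl) (auto simp: append_two_eq_iff)
  also have "\<dots> = of_bool ?p * weight q y y' b b' t t'"
    by (rule sum_sum_delta) (use Nil in auto)
  also have "\<dots> = (\<Sum>c\<in>{1..n}. \<Sum>d\<in>{1..n}. of_bool (c = t \<and> d = t') * (of_bool ?p * weight q y y' b b' c d))"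
    by (rule sum_sum_delta[symmetric]) (use Nil in auto)
  also have "\<dots> = (\<Sum>c\<in>{1..n}. \<Sum>d\<in>{1..n}. weight q y y' b b' c d * of_bool (bs @ d # c # bs' = ts @ t' # t # ts'))"
    by (intro sum.cong refl) (auto simp: append_two_eq_iff)
  finally show ?case by simp
next
  case (Cons u us)
  obtain l ls0 r rs0 where [simp]: "ls = l # ls0" "rs = r # rs0"
    using Cons.prems by (metis length_Suc_conv)
  let ?V = "A @ y # y' # B" and ?W = "A @ y' # y # B"
  let ?C = "{1..n}" and ?P = "words n (length A)" and ?Q = "words n (length B)"
  let ?R = "\<lambda>as e f zs c d. row n q u ?V l (as @ e # f # zs) (ts @ c # d # ts') r"
  let ?R' = "\<lambda>as e f zs. row n q u ?W l (as @ f # e # zs) (ts @ t' # t # ts') r"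
  let ?G = "\<lambda>as e f zs. grid n q us ?V ls0 (bs @ b # b' # bs') (as @ e # f # zs) rs0"
  let ?G' = "\<lambda>as e f zs c d. grid n q us ?W ls0 (bs @ d # c # bs') (as @ f # e # zs) rs0"
  have "(\<Sum>c\<in>?C. \<Sum>d\<in>?C. grid n q (u # us) ?V ls (bs @ b # b' # bs') (ts @ c # d # ts') rs * weight q y y' c d t t')
    = (\<Sum>c\<in>?C. \<Sum>d\<in>?C. \<Sum>as\<in>?P. \<Sum>e\<in>?C. \<Sum>f\<in>?C. \<Sum>zs\<in>?Q.
         (?R as e f zs c d * weight q y y' c d t t') * ?G as e f zs)"
    unfolding \<open>ls = l # ls0\<close> \<open>rs = r # rs0\<close> grid.simps(2) sum_words_split_two
    by (simp add: sum_distrib_left sum_distrib_right mult_ac)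
  also have "\<dots> = (\<Sum>as\<in>?P. \<Sum>zs\<in>?Q. \<Sum>e\<in>?C. \<Sum>f\<in>?C. \<Sum>c\<in>?C. \<Sum>d\<in>?C.
         (?R as e f zs c d * weight q y y' c d t t') * ?G as e f zs)"
    unfolding sum.cartesian_product
    by (rule sum.reindex_bij_witness[of _ "\<lambda>(as,zs,e,f,c,d). (c,d,as,e,f,zs)" "\<lambda>(c,d,as,e,f,zs). (as,zs,e,f,c,d)"]) auto
  also have "\<dots> = (\<Sum>as\<in>?P. \<Sum>zs\<in>?Q. \<Sum>e\<in>?C. \<Sum>f\<in>?C. (\<Sum>c\<in>?C. \<Sum>d\<in>?C.
         ?R as e f zs c d * weight q y y' c d t t') * ?G as e f zs)"
    by (simp add: sum_distrib_right)
  also have "\<dots> = (\<Sum>as\<in>?P. \<Sum>zs\<in>?Q. \<Sum>e\<in>?C. \<Sum>f\<in>?C. (\<Sum>c\<in>?C. \<Sum>d\<in>?C.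
         weight q y y' e f c d * ?R' as c d zs) * ?G as e f zs)"
    using Cons.prems
    by (intro row_swap_columns sum.cong refl arg_cong2[of _ _ _ _ "(*)"]) (auto simp: words_def)
  also have "\<dots> = (\<Sum>as\<in>?P. \<Sum>zs\<in>?Q. \<Sum>e\<in>?C. \<Sum>f\<in>?C. \<Sum>c\<in>?C. \<Sum>d\<in>?C.
         ?R' as c d zs * (?G as e f zs * weight q y y' e f c d))"
    by (simp add: sum_distrib_left sum_distrib_right mult_ac)
  also have "\<dots> = (\<Sum>as\<in>?P. \<Sum>zs\<in>?Q. \<Sum>c\<in>?C. \<Sum>d\<in>?C. \<Sum>e\<in>?C. \<Sum>f\<in>?C.
         ?R' as c d zs * (?G as e f zs * weight q y y' e f c d))"
    unfolding sum.cartesian_product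
    by (rule sum.reindex_bij_witness[of _ "\<lambda>(as,zs,c,d,e,f). (as,zs,e,f,c,d)" "\<lambda>(as,zs,e,f,c,d). (as,zs,c,d,e,f)"]) auto
  also have "\<dots> = (\<Sum>as\<in>?P. \<Sum>zs\<in>?Q. \<Sum>c\<in>?C. \<Sum>d\<in>?C.
         ?R' as c d zs * (\<Sum>e\<in>?C. \<Sum>f\<in>?C. ?G as e f zs * weight q y y' e f c d))"
    by (simp add: sum_distrib_left)
  also have "\<dots> = (\<Sum>as\<in>?P. \<Sum>zs\<in>?Q. \<Sum>c\<in>?C. \<Sum>d\<in>?C.
         ?R' as c d zs * (\<Sum>e\<in>?C. \<Sum>f\<in>?C. weight q y y' b b' e f * ?G' as c d zs e f))"
    using Cons.prems
    by (intro Cons.IH sum.cong refl arg_cong2[of _ _ _ _ "(*)"]) (auto simp: words_def)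
  also have "\<dots> = (\<Sum>as\<in>?P. \<Sum>zs\<in>?Q. \<Sum>c\<in>?C. \<Sum>d\<in>?C. \<Sum>e\<in>?C. \<Sum>f\<in>?C.
         weight q y y' b b' e f * (?R' as c d zs * ?G' as c d zs e f))"
    by (simp add: sum_distrib_left sum_distrib_right mult_ac)
  also have "\<dots> = (\<Sum>e\<in>?C. \<Sum>f\<in>?C. \<Sum>as\<in>?P. \<Sum>d\<in>?C. \<Sum>c\<in>?C. \<Sum>zs\<in>?Q.
         weight q y y' b b' e f * (?R' as c d zs * ?G' as c d zs e f))"
    unfolding sum.cartesian_product
    by (rule sum.reindex_bij_witness[of _ "\<lambda>(e,f,as,d,c,zs). (as,zs,c,d,e,f)" "\<lambda>(as,zs,c,d,e,f). (e,f,as,d,c,zs)"]) auto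
  also have "\<dots> = (\<Sum>e\<in>?C. \<Sum>f\<in>?C. weight q y y' b b' e f *
            grid n q (u # us) ?W ls (bs @ f # e # bs') (ts @ t' # t # ts') rs)"
    unfolding \<open>ls = l # ls0\<close> \<open>rs = r # rs0\<close> grid.simps(2) sum_words_split_two
    by (simp add: sum_distrib_left)
  finally show ?case .
qed

lemma grid_two_rows:
  "grid n q (u # u' # us) vs (l # l' # ls) bs ts (r # r' # rs)
     = (\<Sum>ms\<in>words n (length vs). two_rows n q u u' vs l l' ms ts r r' * grid n q us vs ls bs ms rs)"
proof -
  have "grid n q (u # u' # us) vs (l # l' # ls) bs ts (r # r' # rs)
    = (\<Sum>xs\<in>words n (length vs). \<Sum>ms\<in>words n (length vs). row n q u vs l xs ts r * row n q u' vs l' ms xs r' * grid n q us vs ls bs ms rs)"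
    by (simp add: sum_distrib_left sum_distrib_right mult_ac)
  also have "\<dots> = (\<Sum>ms\<in>words n (length vs). \<Sum>xs\<in>words n (length vs). row n q u vs l xs ts r * row n q u' vs l' ms xs r' * grid n q us vs ls bs ms rs)"
    by (rule sum.swap)
  finally show ?thesis by (simp add: two_rows_def sum_distrib_right)
qed

text \<open>The rows in \<open>A\<close> are peeled off until the pair is on top. There
  \<open>two_rows_swap\<close> applies for each fixed word entering the pair from below.\<close>

lemma grid_swap_rows:
  assumes "l \<in> {1..n}" "l' \<in> {1..n}" "set ts \<subseteq> {1..n}" "r \<in> {1..n}" "r' \<in> {1..n}"
    and "length ts = length vs" "length ls = length A" "length rs = length A"
  shows "(\<Sum>m\<in>{1..n}. \<Sum>m'\<in>{1..n}. weight q u u' l l' m m' *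
            grid n q (A @ u' # u # B) vs (ls @ m' # m # ls') bs ts (rs @ r' # r # rs'))
       = (\<Sum>m\<in>{1..n}. \<Sum>m'\<in>{1..n}.
            grid n q (A @ u # u' # B) vs (ls @ l # l' # ls') bs ts (rs @ m # m' # rs') * weight q u u' m m' r r')"
  using assms
proof (induction A arbitrary: ls rs ts)
  case Nil
  then have [simp]: "ls = []" "rs = []" by auto
  let ?C = "{1..n}" and ?W = "words n (length vs)"
  have "(\<Sum>m\<in>?C. \<Sum>m'\<in>?C. weight q u u' l l' m m' * grid n q (u' # u # B) vs (m' # m # ls') bs ts (r' # r # rs'))
     = (\<Sum>m\<in>?C. \<Sum>m'\<in>?C. \<Sum>ms\<in>?W. weight q u u' l l' m m' * two_rows n q u' u vs m' m ms ts r' r * grid n q B vs ls' bs ms rs')"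
    unfolding grid_two_rows by (simp add: sum_distrib_left sum_distrib_right mult_ac)
  also have "\<dots> = (\<Sum>ms\<in>?W. \<Sum>m\<in>?C. \<Sum>m'\<in>?C. weight q u u' l l' m m' * two_rows n q u' u vs m' m ms ts r' r * grid n q B vs ls' bs ms rs')"
    unfolding sum.cartesian_product
    by (rule sum.reindex_bij_witness[of _ "\<lambda>(e,c,d). (c,d,e)" "\<lambda>(c,d,e). (e,c,d)"]) auto
  also have "\<dots> = (\<Sum>ms\<in>?W. (\<Sum>m\<in>?C. \<Sum>m'\<in>?C. weight q u u' l l' m m' * two_rows n q u' u vs m' m ms ts r' r) * grid n q B vs ls' bs ms rs')"
    by (simp add: sum_distrib_right)
  also have "\<dots> = (\<Sum>ms\<in>?W. (\<Sum>m\<in>?C. \<Sum>m'\<in>?C. two_rows n q u u' vs l l' ms ts m m' * weight q u u' m m' r r') * grid n q B vs ls' bs ms rs')"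
    using Nil by (intro two_rows_swap sum.cong refl arg_cong2[of _ _ _ _ "(*)"]) (auto simp: words_def)
  also have "\<dots> = (\<Sum>ms\<in>?W. \<Sum>m\<in>?C. \<Sum>m'\<in>?C. two_rows n q u u' vs l l' ms ts m m' * grid n q B vs ls' bs ms rs' * weight q u u' m m' r r')"
    by (simp add: sum_distrib_left sum_distrib_right mult_ac)
  also have "\<dots> = (\<Sum>m\<in>?C. \<Sum>m'\<in>?C. \<Sum>ms\<in>?W. two_rows n q u u' vs l l' ms ts m m' * grid n q B vs ls' bs ms rs' * weight q u u' m m' r r')"
    unfolding sum.cartesian_product
    by (rule sum.reindex_bij_witness[of _ "\<lambda>(c,d,e). (e,c,d)" "\<lambda>(e,c,d). (c,d,e)"]) auto
  finally show ?case by (simp add: grid_two_rows sum_distrib_right del: grid.simps)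
next
  case (Cons x A)
  obtain k ks s ss where [simp]: "ls = k # ks" "rs = s # ss"
    using Cons.prems by (metis length_Suc_conv)
  let ?C = "{1..n}" and ?W = "words n (length vs)"
  let ?G = "\<lambda>m m' ms. grid n q (A @ u' # u # B) vs (ks @ m' # m # ls') bs ms (ss @ r' # r # rs')"
  let ?G' = "\<lambda>m m' ms. grid n q (A @ u # u' # B) vs (ks @ l # l' # ls') bs ms (ss @ m # m' # rs')"
  have "(\<Sum>m\<in>?C. \<Sum>m'\<in>?C. weight q u u' l l' m m' * (\<Sum>ms\<in>?W. row n q x vs k ms ts s * ?G m m' ms))
     = (\<Sum>m\<in>?C. \<Sum>m'\<in>?C. \<Sum>ms\<in>?W. row n q x vs k ms ts s * (weight q u u' l l' m m' * ?G m m' ms))"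
    by (simp add: sum_distrib_left sum_distrib_right mult_ac)
  also have "\<dots> = (\<Sum>ms\<in>?W. \<Sum>m\<in>?C. \<Sum>m'\<in>?C. row n q x vs k ms ts s * (weight q u u' l l' m m' * ?G m m' ms))"
    unfolding sum.cartesian_product
    by (rule sum.reindex_bij_witness[of _ "\<lambda>(e,c,d). (c,d,e)" "\<lambda>(c,d,e). (e,c,d)"]) auto
  also have "\<dots> = (\<Sum>ms\<in>?W. row n q x vs k ms ts s * (\<Sum>m\<in>?C. \<Sum>m'\<in>?C. weight q u u' l l' m m' * ?G m m' ms))"
    by (simp add: sum_distrib_left)
  also have "\<dots> = (\<Sum>ms\<in>?W. row n q x vs k ms ts s * (\<Sum>m\<in>?C. \<Sum>m'\<in>?C. ?G' m m' ms * weight q u u' m m' r r'))"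
    using Cons.prems by (intro Cons.IH sum.cong refl arg_cong2[of _ _ _ _ "(*)"]) (auto simp: words_def)
  also have "\<dots> = (\<Sum>ms\<in>?W. \<Sum>m\<in>?C. \<Sum>m'\<in>?C. row n q x vs k ms ts s * ?G' m m' ms * weight q u u' m m' r r')"
    by (simp add: sum_distrib_left sum_distrib_right mult_ac)
  also have "\<dots> = (\<Sum>m\<in>?C. \<Sum>m'\<in>?C. \<Sum>ms\<in>?W. row n q x vs k ms ts s * ?G' m m' ms * weight q u u' m m' r r')"
    unfolding sum.cartesian_product
    by (rule sum.reindex_bij_witness[of _ "\<lambda>(c,d,e). (e,c,d)" "\<lambda>(e,c,d). (c,d,e)"]) auto
  finally show ?case by (simp add: sum_distrib_right)
qed

section \<open>Stacking the layers\<close>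

lemma sum_weight_same:
  assumes "b \<in> {1..n}"
  shows "(\<Sum>c\<in>{1..n}. \<Sum>d\<in>{1..n}. weight q u v b b c d * F c d) = (u - q * v) * F b b"
  using assms by (simp only: sum_weight) (simp add: straight_def turn_def)

text \<open>Nothing but \<open>e_r \<otimes> e_r\<close> is sent to a multiple of
  \<open>e_r \<otimes> e_r\<close>, so the R-matrix is the same scalar on equal outgoing colours as
  on equal incoming ones.\<close>

lemma weight_out_same: "weight q u v a b r r = of_bool (a = r \<and> b = r) * (u - q * v)"
  by (cases "a = r"; cases "b = r") (simp_all add: weight_def straight_def turn_def)

lemma sum_weight_out_same:
  assumes "r \<in> {1..n}"
  shows "(\<Sum>a\<in>{1..n}. \<Sum>b\<in>{1..n}. F a b * weight q u v a b r r) = (u - q * v) * F r r"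
proof -
  have "(\<Sum>a\<in>{1..n}. \<Sum>b\<in>{1..n}. F a b * weight q u v a b r r)
      = (\<Sum>a\<in>{1..n}. \<Sum>b\<in>{1..n}. of_bool (a = r \<and> b = r) * ((u - q * v) * F a b))"
    by (simp only: weight_out_same mult_ac)
  then show ?thesis using assms by (simp only: sum_sum_delta)
qed

text \<open>
  \<open>below n q X CI CII p nxt ls\<close> is the partition function of the layers \<open>1, \<dots>, p\<close> as a function of the
  colours \<open>ls\<close> of the edges that lead from layer \<open>p\<close> to the rows \<open>nxt\<close> of layer \<open>p + 1\<close>, and
  \<open>total\<close> adds a top layer whose right and bottom boundary colours are \<open>N\<close>.
\<close>

primrec below ::
  "nat \<Rightarrow> 'a::field \<Rightarrow> 'a vars \<Rightarrow> (nat \<Rightarrow> nat list) \<Rightarrow> (nat \<Rightarrow> nat list) \<Rightarrow> nat \<Rightarrow> 'a list \<Rightarrow> nat list \<Rightarrow> 'a"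
  where
  "below n q X CI CII 0 nxt ls = of_bool (ls = replicate (length nxt) 1)"
| "below n q X CI CII (Suc p) nxt ls =
     (\<Sum>ks\<in>words n (length (uvars X (Suc p))). below n q X CI CII p (uvars X (Suc p)) ks *
        grid n q (uvars X (Suc p)) (vIvars X (Suc p) @ nxt @ vIIvars X (Suc p)) ks
          (replicate (length (vIvars X (Suc p) @ nxt @ vIIvars X (Suc p))) (p + 2))
          (CI (Suc p) @ ls @ CII (Suc p)) (replicate (length (uvars X (Suc p))) (p + 2)))"

definition total ::
  "nat \<Rightarrow> 'a::field \<Rightarrow> 'a vars \<Rightarrow> (nat \<Rightarrow> nat list) \<Rightarrow> (nat \<Rightarrow> nat list) \<Rightarrow> nat \<Rightarrow> nat \<Rightarrow>
     'a list \<Rightarrow> 'a list \<Rightarrow> nat list \<Rightarrow> 'a"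
  where
  "total n q X CI CII p N us vs ts =
     (\<Sum>ks\<in>words n (length us). below n q X CI CII p us ks *
        grid n q us vs ks (replicate (length vs) N) ts (replicate (length us) N))"

text \<open>For the layer underneath, the rows \<open>nxt\<close> are just some of its columns.
  Hence \<open>below\<close> is a \<open>total\<close> with one layer fewer, in which regrouping the
  columns turns a \<open>u\<close>-variable into a \<open>v\<close>-variable; case A and the initial
  condition rest on this.\<close>

lemma below_Suc_eq_total:
  "below n q X CI CII (Suc p) nxt ls =
     total n q X CI CII p (p + 2) (uvars X (Suc p)) (vIvars X (Suc p) @ nxt @ vIIvars X (Suc p))
       (CI (Suc p) @ ls @ CII (Suc p))"
  by (simp add: total_def)

lemma below_cong:
  assumes "\<And>j. j \<in> {1..p} \<Longrightarrow> uvars X j = uvars Y j \<and> vIvars X j = vIvars Y j \<and> vIIvars X j = vIIvars Y j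
      \<and> CI j = CI' j \<and> CII j = CII' j"
  shows "below n q X CI CII p nxt ls = below n q Y CI' CII' p nxt ls"
  using assms
proof (induction p arbitrary: nxt ls)
  case (Suc p)
  have "below n q X CI CII p = below n q Y CI' CII' p"
    by (intro ext Suc.IH Suc.prems) auto
  then show ?case
    using Suc.prems[of "Suc p"] by (simp only: below.simps) simp
qed simp

lemma replicate_append_two: "replicate (length A) r @ r # r # replicate (length B) r = replicate (length (A @ u # u' # B)) r"
  by (simp add: replicate_add replicate_app_Cons_same)

text \<open>
  An \<open>R\<close>-matrix on top of two neighbouring columns passes to their bottom edges, where the colours
  agree and it acts as the scalar \<open>u - q * u'\<close>.
\<close>

lemma below_swap:
  assumes "p < n" "\<And>j. j \<in> {1..p} \<Longrightarrow> length (CI j) = length (vIvars X j)" "t \<in> {1..n}" "t' \<in> {1..n}" "length la = length A"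
  shows "(\<Sum>c\<in>{1..n}. \<Sum>d\<in>{1..n}. below n q X CI CII p (A @ u # u' # B) (la @ c # d # lb) * weight q u u' c d t t')
       = (u - q * u') * below n q X CI CII p (A @ u' # u # B) (la @ t' # t # lb)"
proof (cases p)
  \<comment> \<open>Without a lower layer all left colours are 1, so the vertex meets two equal
    colours at once.\<close>
  case 0
  define R where "R \<longleftrightarrow> la = replicate (length A) 1 \<and> lb = replicate (length B) 1"
  have *: "of_bool (la @ c # d # lb = replicate (length (A @ u # u' # B)) 1) = of_bool (c = 1 \<and> d = 1) * (of_bool R :: 'a)"
    for c d and u u' :: 'a
    unfolding replicate_append_two[symmetric] R_def using assms(5) by (auto simp: append_two_eq_iff)
  have "(\<Sum>c\<in>{1..n}. \<Sum>d\<in>{1..n}. below n q X CI CII p (A @ u # u' # B) (la @ c # d # lb) * weight q u u' c d t t')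
      = (\<Sum>c\<in>{1..n}. \<Sum>d\<in>{1..n}. of_bool (c = 1 \<and> d = 1) * (of_bool R * weight q u u' c d t t'))"
    unfolding 0 below.simps * mult.assoc ..
  also have "\<dots> = of_bool R * weight q u u' 1 1 t t'"
    by (rule sum_sum_delta) (use assms in auto)
  also have "\<dots> = (u - q * u') * (of_bool (t' = 1 \<and> t = 1) * of_bool R)"
    by (cases "t = 1"; cases "t' = 1") (simp_all add: weight_def straight_def turn_def)
  finally show ?thesis unfolding 0 below.simps * .
next
  case (Suc p')
  let ?U = "uvars X (Suc p')" and ?VI = "vIvars X (Suc p')" and ?VII = "vIIvars X (Suc p')"
  let ?r = "p' + 2"
  have r: "?r \<in> {1..n}" using assms Suc by auto
  define bs where "bs = replicate (length ?VI + length A) ?r"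
  define bs' where "bs' = replicate (length B + length ?VII) ?r"
  have bs: "replicate (length (?VI @ (A @ u # u' # B) @ ?VII)) ?r = bs @ ?r # ?r # bs'" for u u' :: 'a
    unfolding bs_def bs'_def by (simp add: replicate_add[symmetric] replicate_append_same)
       (simp flip: replicate_Suc replicate_add add: replicate_app_Cons_same)
  let ?ts = "CI (Suc p') @ la" and ?ts' = "lb @ CII (Suc p')"
  let ?rs = "replicate (length ?U) ?r"
  have eq: "below n q X CI CII p (A @ u # u' # B) (la @ c # d # lb)
     = (\<Sum>ks\<in>words n (length ?U). below n q X CI CII p' ?U ks *
         grid n q ?U ((?VI @ A) @ u # u' # (B @ ?VII)) ks (bs @ ?r # ?r # bs') (?ts @ c # d # ?ts') ?rs)" for c d u u'
    unfolding Suc below.simps bs by simp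
  have CI: "length (CI (Suc p')) = length ?VI"
    using assms(2)[of "Suc p'"] Suc by simp
    have "(\<Sum>c\<in>{1..n}. \<Sum>d\<in>{1..n}. below n q X CI CII p (A @ u # u' # B) (la @ c # d # lb) * weight q u u' c d t t')
      = (\<Sum>c\<in>{1..n}. \<Sum>d\<in>{1..n}. \<Sum>ks\<in>words n (length ?U). below n q X CI CII p' ?U ks *
         (grid n q ?U ((?VI @ A) @ u # u' # (B @ ?VII)) ks (bs @ ?r # ?r # bs') (?ts @ c # d # ?ts') ?rs * weight q u u' c d t t'))"
      unfolding eq by (simp only: sum_distrib_right mult.assoc)
    also have "\<dots> = (\<Sum>ks\<in>words n (length ?U). \<Sum>c\<in>{1..n}. \<Sum>d\<in>{1..n}. below n q X CI CII p' ?U ks *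
         (grid n q ?U ((?VI @ A) @ u # u' # (B @ ?VII)) ks (bs @ ?r # ?r # bs') (?ts @ c # d # ?ts') ?rs * weight q u u' c d t t'))"
      unfolding sum.cartesian_product
      by (rule sum.reindex_bij_witness[of _ "\<lambda>(e,c,d). (c,d,e)" "\<lambda>(c,d,e). (e,c,d)"]) auto
    also have "\<dots> = (\<Sum>ks\<in>words n (length ?U). below n q X CI CII p' ?U ks *
         (\<Sum>c\<in>{1..n}. \<Sum>d\<in>{1..n}. grid n q ?U ((?VI @ A) @ u # u' # (B @ ?VII)) ks (bs @ ?r # ?r # bs') (?ts @ c # d # ?ts') ?rs * weight q u u' c d t t'))"
      by (simp only: sum_distrib_left)
    also have "\<dots> = (\<Sum>ks\<in>words n (length ?U). below n q X CI CII p' ?U ks *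
         (\<Sum>c\<in>{1..n}. \<Sum>d\<in>{1..n}. weight q u u' ?r ?r c d * grid n q ?U ((?VI @ A) @ u' # u # (B @ ?VII)) ks (bs @ d # c # bs') (?ts @ t' # t # ?ts') ?rs))"
      using assms r CI
      by (intro sum.cong[OF refl] arg_cong2[of _ _ _ _ "(*)"] refl grid_swap_columns)
         (auto simp: bs_def words_def)
    also have "\<dots> = (u - q * u') * (\<Sum>ks\<in>words n (length ?U). below n q X CI CII p' ?U ks *
         grid n q ?U ((?VI @ A) @ u' # u # (B @ ?VII)) ks (bs @ ?r # ?r # bs') (?ts @ t' # t # ?ts') ?rs)"
      unfolding sum_weight_same[OF r] by (simp only: sum_distrib_left mult_ac)
    finally show ?thesis unfolding eq .
qed

lemma total_swap:
  assumes "p < n" "\<And>j. j \<in> {1..p} \<Longrightarrow> length (CI j) = length (vIvars X j)"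
    and "N \<in> {1..n}" "set ts \<subseteq> {1..n}" "length ts = length vs"
  shows "(u - q * u') * total n q X CI CII p N (A @ u # u' # B) vs ts
       = (u - q * u') * total n q X CI CII p N (A @ u' # u # B) vs ts"
proof -
  let ?P = "words n (length A)" and ?Q = "words n (length B)" and ?C = "{1..n}"
  let ?b = "below n q X CI CII p"
  let ?V = "replicate (length vs) N" and ?RA = "replicate (length A) N" and ?RB = "replicate (length B) N"
  let ?G = "\<lambda>u u' la c d lb. grid n q (A @ u # u' # B) vs (la @ c # d # lb) ?V ts"
  have eq: "total n q X CI CII p N (A @ u # u' # B) vs ts =
     (\<Sum>la\<in>?P. \<Sum>c\<in>?C. \<Sum>d\<in>?C. \<Sum>lb\<in>?Q. ?b (A @ u # u' # B) (la @ c # d # lb) *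
        ?G u u' la c d lb (?RA @ N # N # ?RB))" for u u'
    unfolding total_def sum_words_split_two replicate_append_two[of A N B u u'] ..
  have "(u - q * u') * total n q X CI CII p N (A @ u # u' # B) vs ts =
     (\<Sum>la\<in>?P. \<Sum>c\<in>?C. \<Sum>d\<in>?C. \<Sum>lb\<in>?Q. ?b (A @ u # u' # B) (la @ c # d # lb) *
        ((u - q * u') * ?G u u' la c d lb (?RA @ N # N # ?RB)))"
    unfolding eq by (simp only: sum_distrib_left mult_ac)
  \<comment> \<open>The scalar is read backwards as an R-vertex with outgoing colours
    \<open>N, N\<close> at the right end of the two rows. After it has moved to the left,
    \<open>below_swap\<close> absorbs it as the same scalar.\<close>
  also have "\<dots> = (\<Sum>la\<in>?P. \<Sum>c\<in>?C. \<Sum>d\<in>?C. \<Sum>lb\<in>?Q. ?b (A @ u # u' # B) (la @ c # d # lb) *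
        (\<Sum>m\<in>?C. \<Sum>m'\<in>?C. ?G u u' la c d lb (?RA @ m # m' # ?RB) * weight q u u' m m' N N))"
    using assms by (simp only: sum_weight_out_same)
  also have "\<dots> = (\<Sum>la\<in>?P. \<Sum>c\<in>?C. \<Sum>d\<in>?C. \<Sum>lb\<in>?Q. ?b (A @ u # u' # B) (la @ c # d # lb) *
        (\<Sum>m\<in>?C. \<Sum>m'\<in>?C. weight q u u' c d m m' * ?G u' u la m' m lb (?RA @ N # N # ?RB)))"
    using assms
    by (intro sum.cong[OF refl] arg_cong2[of _ _ _ _ "(*)"] refl grid_swap_rows[symmetric])
       (auto simp: words_def)
  also have "\<dots> = (\<Sum>la\<in>?P. \<Sum>c\<in>?C. \<Sum>d\<in>?C. \<Sum>lb\<in>?Q. \<Sum>m\<in>?C. \<Sum>m'\<in>?C.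
        ?G u' u la m' m lb (?RA @ N # N # ?RB) * (?b (A @ u # u' # B) (la @ c # d # lb) * weight q u u' c d m m'))"
    by (simp only: sum_distrib_left mult_ac)
  also have "\<dots> = (\<Sum>la\<in>?P. \<Sum>m'\<in>?C. \<Sum>m\<in>?C. \<Sum>lb\<in>?Q. \<Sum>c\<in>?C. \<Sum>d\<in>?C.
        ?G u' u la m' m lb (?RA @ N # N # ?RB) * (?b (A @ u # u' # B) (la @ c # d # lb) * weight q u u' c d m m'))"
    unfolding sum.cartesian_product
    by (rule sum.reindex_bij_witness[of _ "\<lambda>(la,m',m,lb,c,d). (la,c,d,lb,m,m')" "\<lambda>(la,c,d,lb,m,m'). (la,m',m,lb,c,d)"]) auto
  also have "\<dots> = (\<Sum>la\<in>?P. \<Sum>m'\<in>?C. \<Sum>m\<in>?C. \<Sum>lb\<in>?Q. ?G u' u la m' m lb (?RA @ N # N # ?RB) *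
        (\<Sum>c\<in>?C. \<Sum>d\<in>?C. ?b (A @ u # u' # B) (la @ c # d # lb) * weight q u u' c d m m'))"
    by (simp only: sum_distrib_left)
  also have "\<dots> = (\<Sum>la\<in>?P. \<Sum>m'\<in>?C. \<Sum>m\<in>?C. \<Sum>lb\<in>?Q. ?G u' u la m' m lb (?RA @ N # N # ?RB) *
        ((u - q * u') * ?b (A @ u' # u # B) (la @ m' # m # lb)))"
    using assms
    by (intro sum.cong[OF refl] arg_cong2[of _ _ _ _ "(*)"] refl below_swap) (auto simp: words_def)
  also have "\<dots> = (u - q * u') * total n q X CI CII p N (A @ u' # u # B) vs ts"
    unfolding eq by (simp only: sum_distrib_left mult_ac)
  finally show ?thesis .
qed

section \<open>Polynomial dependence and symmetry\<close>

text \<open>Dependence on a variable is a property of functions on the field, since the variables of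
  \<open>psi\<close> are field elements. The degree is tracked only for the last column variable;
  the symmetry argument works with \<open>polyfun\<close>.\<close>

definition poly_le :: "nat \<Rightarrow> ('a::field \<Rightarrow> 'a) \<Rightarrow> bool" where
  "poly_le d f \<longleftrightarrow> (\<exists>P. degree P \<le> d \<and> (\<forall>x. f x = poly P x))"

definition polyfun :: "('a::field \<Rightarrow> 'a) \<Rightarrow> bool" where
  "polyfun f \<longleftrightarrow> (\<exists>P. \<forall>x. f x = poly P x)"

lemma poly_le_const: "poly_le d (\<lambda>x. c)"
  unfolding poly_le_def by (rule exI[of _ "[:c:]"]) simp

lemma poly_le_add: "poly_le d f \<Longrightarrow> poly_le d g \<Longrightarrow> poly_le d (\<lambda>x. f x + g x)"
  unfolding poly_le_def by (metis degree_add_le poly_add)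

lemma poly_le_mult: "poly_le d f \<Longrightarrow> poly_le e g \<Longrightarrow> poly_le (d + e) (\<lambda>x. f x * g x)"
  unfolding poly_le_def by (metis add_mono degree_mult_le order_trans poly_mult)

lemma poly_le_linear: "poly_le 1 (\<lambda>x. a + b * x)"
  unfolding poly_le_def by (rule exI[of _ "[:a, b:]"]) (simp add: mult.commute)

lemma poly_le_sum: "(\<And>i. i \<in> S \<Longrightarrow> poly_le d (f i)) \<Longrightarrow> poly_le d (\<lambda>x. \<Sum>i\<in>S. f i x)"
  by (induction S rule: infinite_finite_induct) (simp_all add: poly_le_const poly_le_add)

named_theorems polyfun_intros

lemma polyfun_const [polyfun_intros]: "polyfun (\<lambda>x. c)"
  unfolding polyfun_def by (rule exI[of _ "[:c:]"]) simp

lemma polyfun_id [polyfun_intros]: "polyfun (\<lambda>x. x)"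
  unfolding polyfun_def by (rule exI[of _ "[:0, 1:]"]) simp

lemma polyfun_add [polyfun_intros]: "polyfun f \<Longrightarrow> polyfun g \<Longrightarrow> polyfun (\<lambda>x. f x + g x)"
  unfolding polyfun_def by (metis poly_add)

lemma polyfun_diff [polyfun_intros]: "polyfun f \<Longrightarrow> polyfun g \<Longrightarrow> polyfun (\<lambda>x. f x - g x)"
  unfolding polyfun_def by (metis poly_diff)

lemma polyfun_mult [polyfun_intros]: "polyfun f \<Longrightarrow> polyfun g \<Longrightarrow> polyfun (\<lambda>x. f x * g x)"
  unfolding polyfun_def by (metis poly_mult)

lemma polyfun_sum [polyfun_intros]: "(\<And>i. i \<in> S \<Longrightarrow> polyfun (f i)) \<Longrightarrow> polyfun (\<lambda>x. \<Sum>i\<in>S. f i x)"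
  by (induction S rule: infinite_finite_induct) (simp_all add: polyfun_intros)

lemma polyfun_weight [polyfun_intros]:
  assumes "polyfun f" "polyfun g"
  shows "polyfun (\<lambda>x. weight q (f x) (g x) a b c d)"
proof -
  have "polyfun (\<lambda>x. straight q (f x) (g x) a b)" "polyfun (\<lambda>x. turn q (f x) (g x) a b)"
    by (cases a b rule: linorder_cases; simp add: straight_def turn_def polyfun_intros assms)+
  then show ?thesis
    unfolding weight_def by (intro polyfun_intros)
qed

text \<open>The variables are a list of functions of one parameter \<open>x\<close>, so that a
  single statement covers a varying entry at any position among constant ones.\<close>

lemma polyfun_row [polyfun_intros]:
  assumes "polyfun f" "\<And>g. g \<in> set gs \<Longrightarrow> polyfun g"
  shows "polyfun (\<lambda>x. row n q (f x) (map (\<lambda>g. g x) gs) a bs ts c)"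
  using assms
proof (induction gs arbitrary: a bs ts)
  case Nil
  then show ?case by (cases bs; cases ts) (simp_all add: polyfun_const)
next
  case (Cons g gs)
  then show ?case by (cases bs; cases ts) (auto intro!: polyfun_intros)
qed

lemma polyfun_grid [polyfun_intros]:
  assumes "\<And>f. f \<in> set fs \<Longrightarrow> polyfun f" "\<And>g. g \<in> set gs \<Longrightarrow> polyfun g"
  shows "polyfun (\<lambda>x. grid n q (map (\<lambda>f. f x) fs) (map (\<lambda>g. g x) gs) ls bs ts rs)"
  using assms
proof (induction fs arbitrary: ls ts rs)
  case Nil
  then show ?case by (cases ls; cases rs) (simp_all add: polyfun_const)
next
  case (Cons f fs)
  then show ?case by (cases ls; cases rs) (auto intro!: polyfun_intros)
qed

text \<open>The variables \<open>fs\<close> occur in one lower layer only, as columns of layer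
  \<open>p\<close>; everything deeper is constant in them. Therefore a case distinction on
  \<open>p\<close> replaces an induction.\<close>

lemma polyfun_below [polyfun_intros]:
  assumes "\<And>f. f \<in> set fs \<Longrightarrow> polyfun f"
  shows "polyfun (\<lambda>x. below n q X CI CII p (map (\<lambda>f. f x) fs) ls)"
proof (cases p)
  case (Suc p')
  let ?U = "uvars X (Suc p')" and ?VI = "vIvars X (Suc p')" and ?VII = "vIIvars X (Suc p')"
  let ?gs = "map (\<lambda>a _. a) ?VI @ fs @ map (\<lambda>a _. a) ?VII"
  have U: "?U = map (\<lambda>f. f x) (map (\<lambda>a _. a) ?U)" and V: "?VI @ map (\<lambda>f. f x) fs @ ?VII = map (\<lambda>g. g x) ?gs" for x
    by (simp_all add: o_def)
  have "polyfun (\<lambda>x. grid n q (map (\<lambda>f. f x) (map (\<lambda>a _. a) ?U)) (map (\<lambda>g. g x) ?gs) ks bs ts rs)" for ks bs ts rs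
    by (rule polyfun_grid) (use assms in \<open>auto intro: polyfun_intros\<close>)
  then show ?thesis
    unfolding Suc below.simps V by (auto simp: o_def intro!: polyfun_intros)
qed (simp add: polyfun_const)

lemma polyfun_total:
  assumes "\<And>f. f \<in> set fs \<Longrightarrow> polyfun f"
  shows "polyfun (\<lambda>x. total n q X CI CII p N (map (\<lambda>f. f x) fs) vs ts)"
proof -
  have V: "vs = map (\<lambda>g. g x) (map (\<lambda>a _. a) vs)" for x :: 'a
    by (simp add: o_def)
  have "polyfun (\<lambda>x. grid n q (map (\<lambda>f. f x) fs) (map (\<lambda>g. g x) (map (\<lambda>a _. a) vs)) ks bs ts rs)" for ks bs ts rs
    by (rule polyfun_grid) (use assms in \<open>auto intro: polyfun_intros\<close>)
  then show ?thesis
    unfolding total_def using assms by (auto simp: o_def intro!: polyfun_intros)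
qed

text \<open>A field of characteristic 0 is infinite, so a polynomial that vanishes outside one point
  has infinitely many roots.\<close>

lemma polyfun_eq_0:
  fixes f :: "'a::field_char_0 \<Rightarrow> 'a"
  assumes "polyfun f" "\<And>x. x \<noteq> c \<Longrightarrow> f x = 0"
  shows "f x = 0"
proof -
  obtain P where P: "\<And>x. f x = poly P x"
    using assms(1) by (auto simp: polyfun_def)
  have "UNIV - {c} \<subseteq> {x. poly P x = 0}"
    using assms(2) P by auto
  moreover have "infinite (UNIV - {c} :: 'a set)"
    using infinite_UNIV_char_0 by simp
  ultimately have "P = 0"
    using poly_roots_finite infinite_super by blast
  then show ?thesis using P by simp
qed

text \<open>The factor in \<open>total_swap\<close> may vanish, but both sides are polynomials in \<open>u\<close>.\<close>

lemma total_adjacent_swap: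
  fixes q :: "'a::field_char_0"
  assumes "p < n" "\<And>j. j \<in> {1..p} \<Longrightarrow> length (CI j) = length (vIvars X j)"
    and "N \<in> {1..n}" "set ts \<subseteq> {1..n}" "length ts = length vs"
  shows "total n q X CI CII p N (A @ u # u' # B) vs ts = total n q X CI CII p N (A @ u' # u # B) vs ts"
proof -
  let ?f = "\<lambda>x. total n q X CI CII p N (A @ x # u' # B) vs ts"
  let ?g = "\<lambda>x. total n q X CI CII p N (A @ u' # x # B) vs ts"
  let ?c = "map (\<lambda>a _. a)"
  have "polyfun (\<lambda>x. total n q X CI CII p N (map (\<lambda>f. f x) (?c A @ (\<lambda>x. x) # (\<lambda>_. u') # ?c B)) vs ts)"
       "polyfun (\<lambda>x. total n q X CI CII p N (map (\<lambda>f. f x) (?c A @ (\<lambda>_. u') # (\<lambda>x. x) # ?c B)) vs ts)"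
    by (rule polyfun_total; auto intro: polyfun_intros)+
  then have "polyfun ?f" "polyfun ?g"
    by (simp_all add: o_def)
  then have "polyfun (\<lambda>x. ?f x - ?g x)"
    by (rule polyfun_diff)
  moreover have "?f x - ?g x = 0" if "x \<noteq> q * u'" for x
    using total_swap[OF assms, of x q u' CII A B] that by simp
  ultimately have "?f u - ?g u = 0"
    by (rule polyfun_eq_0)
  then show ?thesis by simp
qed

lemma mset_invariant_if_adjacent_swap:
  assumes swap: "\<And>A x y B. f (A @ x # y # B) = f (A @ y # x # B)"
    and "mset xs = mset ys"
  shows "f xs = f ys"
proof -
  \<comment> \<open>A letter is moved to the front of the block \<open>A\<close> behind a fixed
    prefix \<open>C\<close>. The prefix lets the induction continue behind the letters that are
    already in place.\<close>
  have front: "f (C @ A @ x # B) = f (C @ x # A @ B)" for C A x B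
  proof (induction A arbitrary: B rule: rev_induct)
    case (snoc a A)
    show ?case
      using swap[of "C @ A" a x B] snoc[of "a # B"] by simp
  qed simp
  have "f (C @ xs) = f (C @ ys)" for C
    using assms(2)
  proof (induction ys arbitrary: xs C)
    case (Cons y ys)
    then have "y \<in> set xs"
      by (metis list.set_intros(1) set_mset_mset)
    then obtain A B where xs: "xs = A @ y # B"
      by (meson split_list)
    then have "f ((C @ [y]) @ A @ B) = f ((C @ [y]) @ ys)"
      using Cons by (intro Cons.IH) simp
    then show ?case
      using front[of C A y B] xs by simp
  qed simp
  from this[of "[]"] show ?thesis by simp
qed

section \<open>Removing the last column and the bottom row\<close>

fun column :: "nat \<Rightarrow> 'a::field \<Rightarrow> 'a list \<Rightarrow> 'a \<Rightarrow> nat list \<Rightarrow> nat \<Rightarrow> nat \<Rightarrow> nat list \<Rightarrow> 'a" where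
  "column n q [] v [] b t [] = of_bool (b = t)"
| "column n q (u # us) v (l # ls) b t (r # rs) =
     (\<Sum>m\<in>{1..n}. weight q u v l m r t * column n q us v ls b m rs)"
| "column n q us v ls b t rs = 0"

lemma row_snoc:
  assumes "l \<in> {1..n}" "r \<in> {1..n}" "length bs = length vs" "length ts = length vs"
  shows "row n q u (vs @ [v]) l (bs @ [b]) (ts @ [t]) r
       = (\<Sum>e\<in>{1..n}. row n q u vs l bs ts e * weight q u v e b r t)"
  using assms
proof (induction vs arbitrary: l bs ts)
  case Nil
  have "(\<Sum>e\<in>{1..n}. weight q u v l b e t * of_bool (e = r)) = (\<Sum>e\<in>{1..n}. if e = r then weight q u v l b r t else 0)"
    by (rule sum.cong) auto
  moreover have "(\<Sum>e\<in>{1..n}. of_bool (l = e) * weight q u v e b r t) = (\<Sum>e\<in>{1..n}. if e = l then weight q u v l b r t else 0)"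
    by (rule sum.cong) auto
  ultimately show ?case
    using Nil by simp
next
  case (Cons x vs)
  obtain b0 bs0 t0 ts0 where [simp]: "bs = b0 # bs0" "ts = t0 # ts0"
    using Cons.prems by (metis length_Suc_conv)
  have "row n q u ((x # vs) @ [v]) l (bs @ [b]) (ts @ [t]) r
      = (\<Sum>e'\<in>{1..n}. weight q u x l b0 e' t0 * (\<Sum>e\<in>{1..n}. row n q u vs e' bs0 ts0 e * weight q u v e b r t))"
    using Cons by simp
  also have "\<dots> = (\<Sum>e'\<in>{1..n}. \<Sum>e\<in>{1..n}. weight q u x l b0 e' t0 * row n q u vs e' bs0 ts0 e * weight q u v e b r t)"
    by (simp only: sum_distrib_left mult.assoc)
  also have "\<dots> = (\<Sum>e\<in>{1..n}. \<Sum>e'\<in>{1..n}. weight q u x l b0 e' t0 * row n q u vs e' bs0 ts0 e * weight q u v e b r t)"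
    by (rule sum.swap)
  finally show ?case
    by (simp add: sum_distrib_right)
qed

lemma sum_words_snoc:
  "(\<Sum>xs\<in>words n (Suc N). f xs) = (\<Sum>xs\<in>words n N. \<Sum>x\<in>{1..n}. f (xs @ [x]))"
  using sum_words_add[of f n N 1] by (simp add: sum_words_Suc)

text \<open>\<open>grid\<close> starts from the top row and \<open>row\<close> from the left, so the
  last column has to be separated by induction. The word \<open>es\<close> carries the colours of
  the horizontal edges that enter it.\<close>

lemma grid_snoc_column:
  assumes "set ls \<subseteq> {1..n}" "set rs \<subseteq> {1..n}" "length ls = length us" "length rs = length us"
    and "length bs = length vs" "length ts = length vs"
  shows "grid n q us (vs @ [v]) ls (bs @ [b]) (ts @ [t]) rs
       = (\<Sum>es\<in>words n (length us). grid n q us vs ls bs ts es * column n q us v es b t rs)"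
  using assms
proof (induction us arbitrary: ls rs ts t)
  case Nil
  then show ?case by simp
next
  case (Cons u us)
  obtain l ls0 r rs0 where [simp]: "ls = l # ls0" "rs = r # rs0"
    using Cons.prems by (metis length_Suc_conv)
  let ?C = "{1..n}" and ?W = "words n (length vs)" and ?E = "words n (length us)"
  have "grid n q (u # us) (vs @ [v]) ls (bs @ [b]) (ts @ [t]) rs
    = (\<Sum>ms\<in>?W. \<Sum>m\<in>?C. row n q u (vs @ [v]) l (ms @ [m]) (ts @ [t]) r
         * grid n q us (vs @ [v]) ls0 (bs @ [b]) (ms @ [m]) rs0)"
    by (simp add: sum_words_snoc)
  also have "\<dots> = (\<Sum>ms\<in>?W. \<Sum>m\<in>?C. (\<Sum>e\<in>?C. row n q u vs l ms ts e * weight q u v e m r t)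
         * (\<Sum>es\<in>?E. grid n q us vs ls0 bs ms es * column n q us v es b m rs0))"
    using Cons.prems
    by (intro sum.cong[OF refl] arg_cong2[of _ _ _ _ "(*)"] row_snoc Cons.IH) (auto simp: words_def)
  also have "\<dots> = (\<Sum>ms\<in>?W. \<Sum>m\<in>?C. \<Sum>e\<in>?C. \<Sum>es\<in>?E. row n q u vs l ms ts e * weight q u v e m r t
         * (grid n q us vs ls0 bs ms es * column n q us v es b m rs0))"
    by (simp only: sum_product)
  also have "\<dots> = (\<Sum>e\<in>?C. \<Sum>es\<in>?E. \<Sum>ms\<in>?W. \<Sum>m\<in>?C. row n q u vs l ms ts e * weight q u v e m r t
         * (grid n q us vs ls0 bs ms es * column n q us v es b m rs0))"
    unfolding sum.cartesian_product
    by (rule sum.reindex_bij_witness[of _ "\<lambda>(e,es,ms,m). (ms,m,e,es)" "\<lambda>(ms,m,e,es). (e,es,ms,m)"]) auto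
  also have "\<dots> = (\<Sum>e\<in>?C. \<Sum>es\<in>?E. (\<Sum>ms\<in>?W. row n q u vs l ms ts e * grid n q us vs ls0 bs ms es)
         * (\<Sum>m\<in>?C. weight q u v e m r t * column n q us v es b m rs0))"
    unfolding sum_product by (simp only: mult_ac)
  finally show ?case
    by (simp add: sum_words_Suc)
qed

text \<open>The row that gets frozen in case A is the last one, at the end opposite to the recursion
  of \<open>grid\<close>.\<close>

lemma grid_snoc_row:
  assumes "set bs \<subseteq> {1..n}" "set ts \<subseteq> {1..n}" "length ls = length us" "length rs = length us"
    and "length bs = length vs" "length ts = length vs"
  shows "grid n q (us @ [u]) vs (ls @ [l]) bs ts (rs @ [r])
       = (\<Sum>ms\<in>words n (length vs). grid n q us vs ls ms ts rs * row n q u vs l bs ms r)"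
  using assms
proof (induction us arbitrary: ls rs ts)
  case Nil
  have "(\<Sum>ms\<in>words n (length vs). row n q u vs l ms ts r * of_bool (bs = ms))
      = (\<Sum>ms\<in>words n (length vs). if ms = bs then row n q u vs l bs ts r else 0)"
    by (rule sum.cong) auto
  moreover have "(\<Sum>ms\<in>words n (length vs). of_bool (ms = ts) * row n q u vs l bs ms r)
      = (\<Sum>ms\<in>words n (length vs). if ms = ts then row n q u vs l bs ts r else 0)"
    by (rule sum.cong) auto
  moreover have "bs \<in> words n (length vs)" "ts \<in> words n (length vs)"
    using Nil by (auto simp: words_def)
  ultimately show ?case using Nil by simp
next
  case (Cons x us)
  obtain k ls0 s rs0 where [simp]: "ls = k # ls0" "rs = s # rs0"
    using Cons.prems by (metis length_Suc_conv)
  let ?W = "words n (length vs)"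
  have "grid n q ((x # us) @ [u]) vs (ls @ [l]) bs ts (rs @ [r])
    = (\<Sum>xs\<in>?W. row n q x vs k xs ts s * (\<Sum>ms\<in>?W. grid n q us vs ls0 ms xs rs0 * row n q u vs l bs ms r))"
    using Cons.prems Cons.IH by (simp add: words_def)
  also have "\<dots> = (\<Sum>xs\<in>?W. \<Sum>ms\<in>?W. row n q x vs k xs ts s * grid n q us vs ls0 ms xs rs0 * row n q u vs l bs ms r)"
    by (simp only: sum_distrib_left mult.assoc)
  also have "\<dots> = (\<Sum>ms\<in>?W. \<Sum>xs\<in>?W. row n q x vs k xs ts s * grid n q us vs ls0 ms xs rs0 * row n q u vs l bs ms r)"
    by (rule sum.swap)
  finally show ?case by (simp add: sum_distrib_right)
qed

section \<open>Weights forced by a boundary of colour \<open>N\<close>\<close>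

lemma weight_out_gt:
  assumes "a < N"
  shows "weight q u v l x N a = of_bool (l = N \<and> x = a) * (q * (u - v)) + of_bool (l = a \<and> x = N) * ((1 - q) * u)"
proof -
  consider "l = N" "x = a" | "l = a" "x = N" | "\<not> (l = N \<and> x = a)" "\<not> (l = a \<and> x = N)" by blast
  then show ?thesis
  proof cases
    case 3
    then have "weight q u v l x N a = 0" by (intro weight_eq_0) auto
    then show ?thesis using 3 by (simp only: of_bool_eq) simp
  qed (use assms in \<open>simp_all add: weight_def straight_def turn_def\<close>)
qed

text \<open>The right colour \<open>a\<close> differs from the bottom colour \<open>N\<close>, so
  nothing can turn: \<open>a\<close> has come from the left and \<open>N\<close> leaves at the
  top.\<close>

lemma weight_bottom_gt:
  assumes "a < N"
  shows "weight q u v l N a t = of_bool (l = a \<and> t = N) * (u - v)"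
proof (cases "l = a \<and> t = N")
  case False
  then have "weight q u v l N a t = 0" using assms by (intro weight_eq_0) auto
  then show ?thesis using False by (simp only: of_bool_eq) simp
qed (use assms in \<open>simp add: weight_def straight_def turn_def\<close>)

lemma column_same:
  assumes "N \<in> {1..n}" "length ls = length us"
  shows "column n q us v ls N N (replicate (length us) N)
       = of_bool (ls = replicate (length us) N) * prod_list (map (\<lambda>u. u - q * v) us)"
  using assms
proof (induction us arbitrary: ls)
  case (Cons u us)
  then obtain l ls0 where [simp]: "ls = l # ls0" by (metis length_Suc_conv)
  have "(\<Sum>m\<in>{1..n}. weight q u v l m N N * column n q us v ls0 N m (replicate (length us) N))
     = (\<Sum>m\<in>{1..n}. if m = N then of_bool (l = N) * (u - q * v) * column n q us v ls0 N N (replicate (length us) N) else 0)"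
    by (rule sum.cong) (auto simp: weight_out_same)
  then show ?case
    using Cons by simp
qed simp

text \<open>While \<open>N\<close> enters from the left, the colour \<open>a\<close> must still come
  up from below. Once \<open>a\<close> enters from the left, the rest of the column has
  \<open>N\<close> on both ends, the situation of \<open>column_same\<close>.\<close>

lemma column_Cons_gt:
  assumes "N \<in> {1..n}" "a \<in> {1..n}" "a < N"
  shows "column n q (u # us) v (l # ls) N a (N # rs)
       = of_bool (l = N) * (q * (u - v)) * column n q us v ls N a rs
         + of_bool (l = a) * ((1 - q) * u) * column n q us v ls N N rs"
proof -
  have "column n q (u # us) v (l # ls) N a (N # rs)
    = (\<Sum>m\<in>{1..n}. (if m = a then of_bool (l = N) * (q * (u - v)) * column n q us v ls N a rs else 0)
        + (if m = N then of_bool (l = a) * ((1 - q) * u) * column n q us v ls N N rs else 0))"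
    unfolding column.simps by (rule sum.cong) (use assms in \<open>auto simp: weight_out_gt\<close>)
  then show ?thesis
    using assms by (simp add: sum.distrib)
qed

lemma poly_le_column_same:
  assumes "N \<in> {1..n}" "length ls = length us"
  shows "poly_le (length us) (\<lambda>v. column n q us v ls N N (replicate (length us) N))"
  using assms
proof (induction us arbitrary: ls)
  case (Cons u us)
  then obtain l ls0 where [simp]: "ls = l # ls0" by (metis length_Suc_conv)
  have eq: "column n q (u # us) v ls N N (replicate (length (u # us)) N)
     = (of_bool (l = N) * u + (- (of_bool (l = N) * q)) * v) * column n q us v ls0 N N (replicate (length us) N)" for v
  proof -
    have "(\<Sum>m\<in>{1..n}. weight q u v l m N N * column n q us v ls0 N m (replicate (length us) N))
       = (\<Sum>m\<in>{1..n}. if m = N then of_bool (l = N) * (u - q * v) * column n q us v ls0 N N (replicate (length us) N) else 0)"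
      by (rule sum.cong) (auto simp: weight_out_same)
    then show ?thesis using Cons.prems by (simp add: algebra_simps)
  qed
  show ?case
    unfolding eq unfolding length_Cons unfolding plus_1_eq_Suc[symmetric]
    by (intro poly_le_mult poly_le_linear Cons.IH) (use Cons.prems in auto)
qed (simp add: poly_le_const)

lemma poly_le_column:
  assumes "N \<in> {1..n}" "a \<in> {1..n}" "a < N" "length ls = length us"
  shows "poly_le (length us - 1) (\<lambda>v. column n q us v ls N a (replicate (length us) N))"
  using assms
proof (induction us arbitrary: ls)
  case (Cons u us)
  then obtain l ls0 where [simp]: "ls = l # ls0" by (metis length_Suc_conv)
  have eq: "column n q (u # us) v ls N a (replicate (length (u # us)) N)
     = (of_bool (l = N) * q * u + (- (of_bool (l = N) * q)) * v) * column n q us v ls0 N a (replicate (length us) N)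
       + of_bool (l = a) * ((1 - q) * u) * column n q us v ls0 N N (replicate (length us) N)" for v
    using column_Cons_gt[OF Cons.prems(1-3), of q u us v l ls0 "replicate (length us) N"]
    by (simp add: algebra_simps)
  have IH: "poly_le (length us - 1) (\<lambda>v. column n q us v ls0 N a (replicate (length us) N))"
    by (rule Cons.IH) (use Cons.prems in auto)
  have 1: "poly_le (length us) (\<lambda>v. (of_bool (l = N) * q * u + (- (of_bool (l = N) * q)) * v) * column n q us v ls0 N a (replicate (length us) N))"
  \<comment> \<open>For empty \<open>us\<close> the truncated difference
    \<open>length us - 1\<close> leaves no room for the linear factor. The product is then zero,
    since the empty column is \<open>of_bool (N = a)\<close>.\<close>
  proof (cases us)
    case Nil
    then show ?thesis using Cons.prems by (simp add: poly_le_const)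
  next
    case (Cons u' us')
    then have len: "length us = 1 + (length us - 1)" by simp
    show ?thesis
      using poly_le_mult[OF poly_le_linear IH] unfolding len[symmetric] .
  qed
  have 2: "poly_le (0 + length us) (\<lambda>v. of_bool (l = a) * ((1 - q) * u) * column n q us v ls0 N N (replicate (length us) N))"
    using Cons.prems by (intro poly_le_mult poly_le_const poly_le_column_same) auto
  show ?case
    unfolding eq using poly_le_add[OF 1 2[simplified]] by simp
qed (simp add: poly_le_const)

text \<open>If \<open>a\<close> entered above the last row, the last vertex would have four equal
  colours and contribute \<open>u - q * v\<close>. A single row has nothing above it, so the
  relation between \<open>u\<close> and \<open>v\<close> is asked only for nonempty
  \<open>us\<close>; this lets the initial condition hold for every \<open>v\<close>.\<close>

lemma column_snoc_special:
  assumes "N \<in> {1..n}" "a \<in> {1..n}" "a < N" "length ls = Suc (length us)" "us \<noteq> [] \<Longrightarrow> u = q * v"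
  shows "column n q (us @ [u]) v ls N a (replicate (Suc (length us)) N)
       = of_bool (ls = replicate (length us) N @ [a]) * (prod_list (map (\<lambda>x. q * (x - v)) us) * ((1 - q) * u))"
  using assms(4,5)
proof (induction us arbitrary: ls)
  case Nil
  then obtain l where [simp]: "ls = [l]" by (metis length_0_conv length_Suc_conv)
  show ?case
    using assms(3) column_Cons_gt[OF assms(1-3), of q u "[]" v l "[]" "[]"] by simp
next
  case (Cons x us)
  then obtain l ls0 where [simp]: "ls = l # ls0" by (metis length_Suc_conv)
  \<comment> \<open>The product in \<open>column_same\<close> contains the factor
    \<open>u - q * v\<close>, which vanishes here because a row \<open>x\<close> precedes the last
    one.\<close>
  have "column n q (us @ [u]) v ls0 N N (replicate (length (us @ [u])) N) = 0"
    using Cons.prems by (subst column_same) (use assms in auto)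
  then show ?case
    using Cons.IH[of ls0] Cons.prems
      column_Cons_gt[OF assms(1-3), of q x "us @ [u]" v l ls0 "replicate (Suc (length us)) N"]
    by simp
qed

text \<open>The colour \<open>a\<close> leaving on the right can never have turned, since every
  bottom colour is \<open>N\<close>. It runs straight through the row, and all top colours are
  \<open>N\<close> again.\<close>

lemma row_bottom_gt:
  assumes "a < N" "a \<in> {1..n}" "length ts = length vs"
  shows "row n q u vs l (replicate (length vs) N) ts a
       = of_bool (l = a \<and> ts = replicate (length vs) N) * prod_list (map (\<lambda>v. u - v) vs)"
  using assms(3)
proof (induction vs arbitrary: l ts)
  case (Cons v vs)
  then obtain t ts0 where [simp]: "ts = t # ts0" by (metis length_Suc_conv)
  have "row n q u (v # vs) l (replicate (length (v # vs)) N) ts a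
     = (\<Sum>e\<in>{1..n}. if e = a then weight q u v l N a t * (of_bool (ts0 = replicate (length vs) N) * prod_list (map (\<lambda>v. u - v) vs)) else 0)"
    unfolding \<open>ts = t # ts0\<close> list.size replicate_Suc row.simps add_0_right add_Suc_right
    by (rule sum.cong) (use Cons in auto)
  also have "\<dots> = weight q u v l N a t * (of_bool (ts0 = replicate (length vs) N) * prod_list (map (\<lambda>v. u - v) vs))"
    using assms(2) by simp
  finally show ?case
    by (simp add: weight_bottom_gt[OF assms(1)])
qed simp

lemma total_snoc:
  assumes "N \<in> {1..n}" "length ts = length vs"
  shows "total n q X CI CII p N us (vs @ [v]) (ts @ [t])
       = (\<Sum>ks\<in>words n (length us). below n q X CI CII p us ks *
          (\<Sum>es\<in>words n (length us). grid n q us vs ks (replicate (length vs) N) ts es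
            * column n q us v es N t (replicate (length us) N)))"
  unfolding total_def
proof (intro sum.cong[OF refl] arg_cong2[of _ _ _ _ "(*)"] refl)
  fix ks assume "ks \<in> words n (length us)"
  moreover have "replicate (length (vs @ [v])) N = replicate (length vs) N @ [N]"
    by (simp add: replicate_append_same)
  ultimately show "grid n q us (vs @ [v]) ks (replicate (length (vs @ [v])) N) (ts @ [t]) (replicate (length us) N)
     = (\<Sum>es\<in>words n (length us). grid n q us vs ks (replicate (length vs) N) ts es
            * column n q us v es N t (replicate (length us) N))"
    using assms grid_snoc_column[of ks n "replicate (length us) N" us "replicate (length vs) N" vs ts q v N t]
    using set_in_words[OF replicate_in_words[OF assms(1)]] by (simp add: words_def)
qed

lemma poly_le_total:
  assumes "N \<in> {1..n}" "a \<in> {1..n}" "a < N" "length ts = length vs"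
  shows "poly_le (length us - 1) (\<lambda>v. total n q X CI CII p N us (vs @ [v]) (ts @ [a]))"
proof -
  \<comment> \<open>The two zeros are the degrees of \<open>below\<close> and of the grid without
    its last column, the factors in \<open>total_snoc\<close> that are constant in
    \<open>v\<close>.\<close>
  have "poly_le (0 + (0 + (length us - 1))) (\<lambda>v. total n q X CI CII p N us (vs @ [v]) (ts @ [a]))"
    unfolding total_snoc[OF assms(1,4)]
    by (intro poly_le_mult poly_le_sum poly_le_const poly_le_column) (use assms in \<open>auto simp: words_def\<close>)
  then show ?thesis by simp
qed

lemma sum_words_delta:
  assumes "w \<in> words n N"
  shows "(\<Sum>xs\<in>words n N. f xs * (of_bool (xs = w) * c)) = f w * (c :: 'a::comm_semiring_1)"
proof -
  have "(\<Sum>xs\<in>words n N. f xs * (of_bool (xs = w) * c)) = (\<Sum>xs\<in>words n N. if xs = w then f w * c else 0)"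
    by (rule sum.cong) auto
  then show ?thesis using assms by simp
qed

lemma total_snoc_same:
  assumes "N \<in> {1..n}" "length ts = length vs"
  shows "total n q X CI CII p N us (vs @ [v]) (ts @ [N])
       = prod_list (map (\<lambda>u. u - q * v) us) * total n q X CI CII p N us vs ts"
proof -
  have "(\<Sum>es\<in>words n (length us). grid n q us vs ks (replicate (length vs) N) ts es
            * column n q us v es N N (replicate (length us) N))
      = grid n q us vs ks (replicate (length vs) N) ts (replicate (length us) N)
          * prod_list (map (\<lambda>u. u - q * v) us)" for ks
  proof -
    have "(\<Sum>es\<in>words n (length us). grid n q us vs ks (replicate (length vs) N) ts es
            * column n q us v es N N (replicate (length us) N))
       = (\<Sum>es\<in>words n (length us). grid n q us vs ks (replicate (length vs) N) ts es
            * (of_bool (es = replicate (length us) N) * prod_list (map (\<lambda>u. u - q * v) us)))"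
      using assms by (intro sum.cong[OF refl]) (simp add: column_same words_def)
    then show ?thesis
      using sum_words_delta[OF replicate_in_words[OF assms(1)]] by simp
  qed
  then show ?thesis
    unfolding total_snoc[OF assms] unfolding total_def by (simp only: sum_distrib_left mult_ac)
qed

text \<open>Two freezings follow each other. The special column is entered by the colours
  \<open>N, ..., N, a\<close>; hence the bottom row of the remaining grid leaves with
  \<open>a\<close> and, having only \<open>N\<close> underneath, is frozen too. The grid loses this
  row, but \<open>below\<close> still sees \<open>us @ [u]\<close>, with \<open>a\<close> on the
  last edge.\<close>

lemma total_snoc_special:
  assumes "N \<in> {1..n}" "a \<in> {1..n}" "a < N" "length ts = length vs" "set ts \<subseteq> {1..n}" "us \<noteq> [] \<Longrightarrow> u = q * v"
  shows "total n q X CI CII p N (us @ [u]) (vs @ [v]) (ts @ [a])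
       = prod_list (map (\<lambda>x. q * (x - v)) us) * ((1 - q) * u) * prod_list (map (\<lambda>v. u - v) vs) *
         (\<Sum>ks\<in>words n (length us). below n q X CI CII p (us @ [u]) (ks @ [a]) *
            grid n q us vs ks (replicate (length vs) N) ts (replicate (length us) N))"
proof -
  let ?c = "prod_list (map (\<lambda>x. q * (x - v)) us) * ((1 - q) * u)"
  let ?d = "prod_list (map (\<lambda>v. u - v) vs)"
  let ?R = "replicate (length us) N" and ?V = "replicate (length vs) N"
  have 1: "(\<Sum>es\<in>words n (length (us @ [u])). grid n q (us @ [u]) vs ks ?V ts es
            * column n q (us @ [u]) v es N a (replicate (length (us @ [u])) N))
      = grid n q (us @ [u]) vs ks ?V ts (?R @ [a]) * ?c" for ks
  proof -
    have "(\<Sum>es\<in>words n (length (us @ [u])). grid n q (us @ [u]) vs ks ?V ts es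
            * column n q (us @ [u]) v es N a (replicate (length (us @ [u])) N))
       = (\<Sum>es\<in>words n (length (us @ [u])). grid n q (us @ [u]) vs ks ?V ts es * (of_bool (es = ?R @ [a]) * ?c))"
      using column_snoc_special[OF assms(1-3) _ assms(6)]
      by (intro sum.cong[OF refl]) (simp add: words_def)
    moreover have "?R @ [a] \<in> words n (length (us @ [u]))"
      using assms by (auto simp: words_def)
    ultimately show ?thesis
      using sum_words_delta by simp
  qed
  have 2: "grid n q (us @ [u]) vs (ks @ [l]) ?V ts (?R @ [a])
      = grid n q us vs ks ?V ts ?R * (of_bool (l = a) * ?d)" if "ks \<in> words n (length us)" for ks l
  proof -
    have "grid n q (us @ [u]) vs (ks @ [l]) ?V ts (?R @ [a])
       = (\<Sum>ms\<in>words n (length vs). grid n q us vs ks ms ts ?R * row n q u vs l ?V ms a)"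
      by (rule grid_snoc_row) (use assms that in \<open>auto simp: words_def\<close>)
    also have "\<dots> = (\<Sum>ms\<in>words n (length vs). grid n q us vs ks ms ts ?R * (of_bool (ms = ?V) * (of_bool (l = a) * ?d)))"
      by (intro sum.cong[OF refl]) (simp only: row_bottom_gt[OF assms(3,2)] length_in_words of_bool_conj mult_ac)
    also have "\<dots> = grid n q us vs ks ?V ts ?R * (of_bool (l = a) * ?d)"
      by (rule sum_words_delta) (rule replicate_in_words[OF assms(1)])
    finally show ?thesis .
  qed
  have "total n q X CI CII p N (us @ [u]) (vs @ [v]) (ts @ [a])
     = (\<Sum>ks\<in>words n (length us). \<Sum>l\<in>{1..n}. below n q X CI CII p (us @ [u]) (ks @ [l]) *
           (grid n q (us @ [u]) vs (ks @ [l]) ?V ts (?R @ [a]) * ?c))"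
    unfolding total_snoc[OF assms(1,4)] 1 by (simp add: sum_words_snoc)
  also have "\<dots> = (\<Sum>ks\<in>words n (length us). \<Sum>l\<in>{1..n}. if l = a then
       ?c * ?d * (below n q X CI CII p (us @ [u]) (ks @ [a]) * grid n q us vs ks ?V ts ?R) else 0)"
    by (intro sum.cong[OF refl]) (auto simp: 2)
  also have "\<dots> = ?c * ?d * (\<Sum>ks\<in>words n (length us). below n q X CI CII p (us @ [u]) (ks @ [a]) * grid n q us vs ks ?V ts ?R)"
    using assms(2) by (simp add: sum_distrib_left)
  finally show ?thesis .
qed

lemma total_single_row:
  assumes "N \<in> {1..n}" "a \<in> {1..n}" "a < N"
  shows "total n q X CI CII p N [u] (vs @ [v]) (replicate (length vs) N @ [a])
       = (1 - q) * u * prod_list (map (\<lambda>v. u - v) vs) * below n q X CI CII p [u] [a]"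
proof -
  have "set (replicate (length vs) N) \<subseteq> {1..n}"
    using set_in_words[OF replicate_in_words[OF assms(1)]] .
  then show ?thesis
    using total_snoc_special[OF assms, of "replicate (length vs) N" vs "[]" u q v X CI CII p] by simp
qed

section \<open>Colour conservation and restriction to fewer colours\<close>

lemma row_conserves:
  assumes "row n q u vs l bs ts r \<noteq> 0"
  shows "mset (l # bs) = mset (r # ts)"
  using assms
proof (induction n q u vs l bs ts r rule: row.induct)
  case (2 n q u v vs a b bs t ts c)
  then obtain e where e: "e \<in> {1..n}" "weight q u v a b e t * row n q u vs e bs ts c \<noteq> 0"
    by (metis (no_types, lifting) row.simps(2) sum.not_neutral_contains_not_neutral)
  then have "(e, t) = (a, b) \<or> (e, t) = (b, a)"
    using weight_eq_0 by (metis mult_zero_left)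
  moreover have "mset (e # bs) = mset (c # ts)"
    using 2 e by simp
  ultimately show ?case by auto
qed (auto split: if_splits)

lemma grid_conserves:
  assumes "grid n q us vs ls bs ts rs \<noteq> 0"
  shows "mset ls + mset bs = mset rs + mset ts"
  using assms
proof (induction n q us vs ls bs ts rs rule: grid.induct)
  case (2 n q u us vs l ls bs ts r rs)
  then obtain ms where "ms \<in> words n (length vs)" "row n q u vs l ms ts r * grid n q us vs ls bs ms rs \<noteq> 0"
    by (metis (no_types, lifting) grid.simps(2) sum.not_neutral_contains_not_neutral)
  then have nz: "ms \<in> words n (length vs)" "row n q u vs l ms ts r \<noteq> 0" "grid n q us vs ls bs ms rs \<noteq> 0"
    by auto
  have "mset (l # ms) = mset (r # ts)" "mset ls + mset bs = mset rs + mset ms"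
    using row_conserves[OF nz(2)] 2(1)[OF nz(1,3)] .
  then show ?case by auto
qed (auto split: if_splits)

text \<open>A vertex only hands on its two incoming colours, so colours above \<open>m\<close>
  cannot arise inside the row.\<close>

lemma row_restrict:
  assumes "m \<le> n" "l \<in> {1..m}" "set bs \<subseteq> {1..m}"
  shows "row n q u vs l bs ts r = row m q u vs l bs ts r"
  using assms
proof (induction n q u vs l bs ts r rule: row.induct)
  case (2 n q u v vs a b bs t ts c)
  have "(\<Sum>e\<in>{1..n}. weight q u v a b e t * row n q u vs e bs ts c)
      = (\<Sum>e\<in>{1..m}. weight q u v a b e t * row n q u vs e bs ts c)"
  proof (rule sum.mono_neutral_right)
    show "\<forall>e\<in>{1..n} - {1..m}. weight q u v a b e t * row n q u vs e bs ts c = 0"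
    proof
      fix e assume "e \<in> {1..n} - {1..m}"
      then have "weight q u v a b e t = 0"
        using 2 by (intro weight_eq_0) auto
      then show "weight q u v a b e t * row n q u vs e bs ts c = 0" by simp
    qed
  qed (use 2 in auto)
  also have "\<dots> = (\<Sum>e\<in>{1..m}. weight q u v a b e t * row m q u vs e bs ts c)"
    using 2 by (intro sum.cong refl) auto
  finally show ?case by simp
qed auto

lemma words_mono: "m \<le> n \<Longrightarrow> words m N \<subseteq> words n N"
  by (auto simp: words_def)

text \<open>An inner word is the top word of the rows below it, and all colours entering those rows
  are at most \<open>m\<close>. Conservation then bounds the inner word as well.\<close>

lemma grid_restrict:
  assumes "m \<le> n" "set ls \<subseteq> {1..m}" "set bs \<subseteq> {1..m}"
  shows "grid n q us vs ls bs ts rs = grid m q us vs ls bs ts rs"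
  using assms
proof (induction n q us vs ls bs ts rs rule: grid.induct)
  case (2 n q u us vs l ls bs ts r rs)
  have "(\<Sum>ms\<in>words n (length vs). row n q u vs l ms ts r * grid n q us vs ls bs ms rs)
      = (\<Sum>ms\<in>words m (length vs). row n q u vs l ms ts r * grid n q us vs ls bs ms rs)"
  proof (rule sum.mono_neutral_right)
    show "\<forall>ms\<in>words n (length vs) - words m (length vs). row n q u vs l ms ts r * grid n q us vs ls bs ms rs = 0"
    proof
      fix ms assume ms: "ms \<in> words n (length vs) - words m (length vs)"
      have "grid n q us vs ls bs ms rs = 0"
      proof (rule ccontr)
        assume "grid n q us vs ls bs ms rs \<noteq> 0"
        then have "mset ls + mset bs = mset rs + mset ms" by (rule grid_conserves)
        then have "set ls \<union> set bs = set rs \<union> set ms"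
          by (metis set_mset_mset set_mset_union)
        then show False
          using ms 2 by (auto simp: words_def)
      qed
      then show "row n q u vs l ms ts r * grid n q us vs ls bs ms rs = 0" by simp
    qed
  qed (use 2 words_mono in auto)
  also have "\<dots> = (\<Sum>ms\<in>words m (length vs). row m q u vs l ms ts r * grid m q us vs ls bs ms rs)"
  proof (rule sum.cong[OF refl])
    fix ms assume ms: "ms \<in> words m (length vs)"
    then have "ms \<in> words n (length vs)" using words_mono 2 by blast
    then have "grid n q us vs ls bs ms rs = grid m q us vs ls bs ms rs"
      by (rule 2(1)) (use 2 in auto)
    moreover have "row n q u vs l ms ts r = row m q u vs l ms ts r"
      by (rule row_restrict) (use 2 ms in \<open>auto simp: words_def\<close>)
    ultimately show "row n q u vs l ms ts r * grid n q us vs ls bs ms rs = row m q u vs l ms ts r * grid m q us vs ls bs ms rs"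
      by simp
  qed
  finally show ?case by simp
qed auto

text \<open>By colour conservation only the colours \<open>1, \<dots>, p + 1\<close> occur in the layers up to \<open>p\<close>.\<close>

lemma below_restrict:
  assumes "m \<le> n" "p < m"
  shows "below n q X CI CII p nxt ls = below m q X CI CII p nxt ls
     \<and> (below m q X CI CII p nxt ls \<noteq> 0 \<longrightarrow> set ls \<subseteq> {1..p + 1})"
  using assms(2)
proof (induction p arbitrary: nxt ls)
  case 0
  then show ?case by auto
next
  case (Suc p)
  let ?U = "uvars X (Suc p)" and ?VV = "vIvars X (Suc p) @ nxt @ vIIvars X (Suc p)"
  let ?B = "replicate (length ?VV) (p + 2)" and ?T = "CI (Suc p) @ ls @ CII (Suc p)"
    and ?R = "replicate (length ?U) (p + 2)"
  have IH: "below n q X CI CII p ?U ks = below m q X CI CII p ?U ks"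
      "below m q X CI CII p ?U ks \<noteq> 0 \<Longrightarrow> set ks \<subseteq> {1..p + 1}" for ks
    using Suc by auto
  have "(\<Sum>ks\<in>words n (length ?U). below n q X CI CII p ?U ks * grid n q ?U ?VV ks ?B ?T ?R)
      = (\<Sum>ks\<in>words m (length ?U). below n q X CI CII p ?U ks * grid n q ?U ?VV ks ?B ?T ?R)"
  proof (rule sum.mono_neutral_right)
    show "\<forall>ks\<in>words n (length ?U) - words m (length ?U). below n q X CI CII p ?U ks * grid n q ?U ?VV ks ?B ?T ?R = 0"
    proof
      fix ks assume "ks \<in> words n (length ?U) - words m (length ?U)"
      \<comment> \<open>Such a word has a letter above \<open>m\<close>, hence outside
        \<open>{1..p + 1}\<close>, and the second half of the induction hypothesis kills its
        term.\<close>
      then have "below m q X CI CII p ?U ks = 0"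
        using IH(2)[of ks] Suc.prems by (force simp: words_def)
      then show "below n q X CI CII p ?U ks * grid n q ?U ?VV ks ?B ?T ?R = 0"
        using IH(1) by simp
    qed
  qed (use assms words_mono in auto)
  also have "\<dots> = (\<Sum>ks\<in>words m (length ?U). below m q X CI CII p ?U ks * grid m q ?U ?VV ks ?B ?T ?R)"
    using Suc.prems assms IH(1)
    by (intro sum.cong refl arg_cong2[of _ _ _ _ "(*)"] grid_restrict) (auto simp: words_def)
  finally have 1: "below n q X CI CII (Suc p) nxt ls = below m q X CI CII (Suc p) nxt ls"
    unfolding below.simps .
  have "set ls \<subseteq> {1..Suc p + 1}" if "below m q X CI CII (Suc p) nxt ls \<noteq> 0"
  proof -
    from that obtain ks where "below m q X CI CII p ?U ks * grid m q ?U ?VV ks ?B ?T ?R \<noteq> 0"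
      unfolding below.simps by (metis (no_types, lifting) sum.not_neutral_contains_not_neutral)
    then have nz: "below m q X CI CII p ?U ks \<noteq> 0" "grid m q ?U ?VV ks ?B ?T ?R \<noteq> 0"
      by auto
    have ks: "set ks \<subseteq> {1..p + 1}" and "mset ks + mset ?B = mset ?R + mset ?T"
      using IH(2)[OF nz(1)] grid_conserves[OF nz(2)] .
    then have "set ks \<union> set ?B = set ?R \<union> set ?T"
      by (metis set_mset_mset set_mset_union)
    then have "set ls \<subseteq> set ks \<union> set ?B" by auto
    moreover have "set ?B \<subseteq> {p + 2}" by (simp only: set_replicate_conv_if) auto
    ultimately show ?thesis using ks by fastforce
  qed
  then show ?case using 1 by blast
qed

section \<open>The partition function as a product of layers\<close>

text \<open>The second assumption says that \<open>f h\<close> depends only on the values of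
  \<open>h\<close> on \<open>A\<close> and on \<open>B\<close>. Phrased through \<open>F\<close>, it
  can be checked in each application without handling a glued function.\<close>

lemma sum_PiE_Un:
  assumes "A \<inter> B = {}"
    and "\<And>h x y. (\<And>e. e \<in> A \<Longrightarrow> h e = x e) \<Longrightarrow> (\<And>e. e \<in> B \<Longrightarrow> h e = y e) \<Longrightarrow> f h = F x y"
  shows "(\<Sum>h\<in>(A \<union> B) \<rightarrow>\<^sub>E C. f h) = (\<Sum>x\<in>A \<rightarrow>\<^sub>E C. \<Sum>y\<in>B \<rightarrow>\<^sub>E C. F x y)"
proof -
  have "(\<Sum>h\<in>(A \<union> B) \<rightarrow>\<^sub>E C. f h) = (\<Sum>(x, y)\<in>(A \<rightarrow>\<^sub>E C) \<times> (B \<rightarrow>\<^sub>E C). F x y)"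
  proof (rule sum.reindex_bij_witness[of _ "\<lambda>(x, y) e. if e \<in> A then x e else y e" "\<lambda>h. (restrict h A, restrict h B)"])
    fix h assume h: "h \<in> (A \<union> B) \<rightarrow>\<^sub>E C"
    then show "(case (restrict h A, restrict h B) of (x, y) \<Rightarrow> \<lambda>e. if e \<in> A then x e else y e) = h"
      by (auto simp: PiE_def extensional_def fun_eq_iff)
    show "(restrict h A, restrict h B) \<in> (A \<rightarrow>\<^sub>E C) \<times> (B \<rightarrow>\<^sub>E C)"
      using h by (auto simp: PiE_def)
    show "(case (restrict h A, restrict h B) of (x, y) \<Rightarrow> F x y) = f h"
      by (simp add: assms(2)[of h "restrict h A" "restrict h B"])
  next
    fix xy assume xy: "xy \<in> (A \<rightarrow>\<^sub>E C) \<times> (B \<rightarrow>\<^sub>E C)"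
    then obtain x y where [simp]: "xy = (x, y)" and x: "x \<in> A \<rightarrow>\<^sub>E C" and y: "y \<in> B \<rightarrow>\<^sub>E C" by auto
    show "(restrict (case xy of (x, y) \<Rightarrow> \<lambda>e. if e \<in> A then x e else y e) A,
           restrict (case xy of (x, y) \<Rightarrow> \<lambda>e. if e \<in> A then x e else y e) B) = xy"
      using x y assms(1) by (auto simp: PiE_def extensional_def fun_eq_iff restrict_def)
    show "(case xy of (x, y) \<Rightarrow> \<lambda>e. if e \<in> A then x e else y e) \<in> (A \<union> B) \<rightarrow>\<^sub>E C"
      using x y by (auto simp: PiE_def extensional_def Pi_def)
  qed
  then show ?thesis by (simp add: sum.cartesian_product)
qed

lemma sum_PiE_prod:
  fixes F :: "'i \<Rightarrow> ('e \<Rightarrow> 'c) \<Rightarrow> 'a::comm_semiring_1"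
  assumes "finite R" "\<And>i j. i \<in> R \<Longrightarrow> j \<in> R \<Longrightarrow> i \<noteq> j \<Longrightarrow> A i \<inter> A j = {}"
    and "\<And>i h h'. i \<in> R \<Longrightarrow> (\<And>e. e \<in> A i \<Longrightarrow> h e = h' e) \<Longrightarrow> F i h = F i h'"
  shows "(\<Sum>h\<in>(\<Union>i\<in>R. A i) \<rightarrow>\<^sub>E C. \<Prod>i\<in>R. F i h) = (\<Prod>i\<in>R. \<Sum>h\<in>A i \<rightarrow>\<^sub>E C. F i h)"
  using assms
proof (induction R rule: finite_induct)
  case empty
  then show ?case by simp
next
  case (insert i R)
  have "(\<Sum>h\<in>(\<Union>j\<in>insert i R. A j) \<rightarrow>\<^sub>E C. \<Prod>j\<in>insert i R. F j h)
      = (\<Sum>h\<in>(A i \<union> (\<Union>j\<in>R. A j)) \<rightarrow>\<^sub>E C. F i h * (\<Prod>j\<in>R. F j h))"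
    by (simp only: UN_insert prod.insert[OF insert.hyps])
  also have "\<dots> = (\<Sum>x\<in>A i \<rightarrow>\<^sub>E C. \<Sum>y\<in>(\<Union>j\<in>R. A j) \<rightarrow>\<^sub>E C. F i x * (\<Prod>j\<in>R. F j y))"
  proof (rule sum_PiE_Un)
    show "A i \<inter> (\<Union>j\<in>R. A j) = {}"
    proof -
      have "A i \<inter> A j = {}" if "j \<in> R" for j
        using insert.hyps(2) that by (intro insert.prems(1)) auto
      then show ?thesis by blast
    qed
    fix h x y :: "'e \<Rightarrow> 'c" assume "\<And>e. e \<in> A i \<Longrightarrow> h e = x e" "\<And>e. e \<in> (\<Union>j\<in>R. A j) \<Longrightarrow> h e = y e"
    then show "F i h * (\<Prod>j\<in>R. F j h) = F i x * (\<Prod>j\<in>R. F j y)"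
      by (intro arg_cong2[of _ _ _ _ "(*)"] prod.cong refl insert.prems(2)) auto
  qed
  also have "\<dots> = (\<Sum>x\<in>A i \<rightarrow>\<^sub>E C. F i x) * (\<Sum>y\<in>(\<Union>j\<in>R. A j) \<rightarrow>\<^sub>E C. \<Prod>j\<in>R. F j y)"
    by (simp only: sum_product)
  also have "(\<Sum>y\<in>(\<Union>j\<in>R. A j) \<rightarrow>\<^sub>E C. \<Prod>j\<in>R. F j y) = (\<Prod>j\<in>R. \<Sum>h\<in>A j \<rightarrow>\<^sub>E C. F j h)"
    by (rule insert.IH) (use insert.prems in blast)+
  finally show ?case by (simp only: prod.insert[OF insert.hyps])
qed

section \<open>Edge colourings as words\<close>

lemma sum_PiE_words:
  assumes "distinct es"
  shows "(\<Sum>h\<in>set es \<rightarrow>\<^sub>E {1..n}. f (map h es)) = (\<Sum>w\<in>words n (length es). f w)"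
proof (rule sum.reindex_bij_witness[of _ "\<lambda>w. restrict (\<lambda>e. the (map_of (zip es w) e)) (set es)" "\<lambda>h. map h es"])
  fix h assume h: "h \<in> set es \<rightarrow>\<^sub>E {1..n}"
  show "restrict (\<lambda>e. the (map_of (zip es (map h es)) e)) (set es) = h"
    using h by (auto simp: map_of_zip_map PiE_def extensional_def fun_eq_iff)
  show "map h es \<in> words n (length es)"
    using h by (auto simp: words_def)
next
  fix w assume w: "w \<in> words n (length es)"
  then show "map (restrict (\<lambda>e. the (map_of (zip es w) e)) (set es)) es = w"
    using assms by (auto simp: words_def map_of_zip_nth intro!: nth_equalityI)
  show "restrict (\<lambda>e. the (map_of (zip es w) e)) (set es) \<in> set es \<rightarrow>\<^sub>E {1..n}"
  proof (rule PiE_I)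
    fix e assume "e \<in> set es"
    then obtain i where i: "i < length es" "e = es ! i" by (metis in_set_conv_nth)
    then have "the (map_of (zip es w) e) = w ! i" "w ! i \<in> set w"
      using assms w by (auto simp: words_def map_of_zip_nth)
    then show "restrict (\<lambda>e. the (map_of (zip es w) e)) (set es) e \<in> {1..n}"
      using \<open>e \<in> set es\<close> w by (auto simp: words_def)
  qed auto
qed simp

text \<open>Configurations are sorted by the word that two neighbouring pieces share. This turns a
  sum over edge colourings into a composition of transfer matrices.\<close>

lemma sum_group_words:
  assumes "\<And>x. x \<in> S \<Longrightarrow> g x \<in> words n N"
  shows "(\<Sum>x\<in>S. F (g x) * H x) = (\<Sum>w\<in>words n N. F w * (\<Sum>x\<in>S. of_bool (g x = w) * (H x :: 'a::comm_semiring_1)))"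
proof -
  have "(\<Sum>x\<in>S. F (g x) * H x) = (\<Sum>x\<in>S. \<Sum>w\<in>words n N. if w = g x then F (g x) * H x else 0)"
    using assms by (intro sum.cong refl) simp
  also have "\<dots> = (\<Sum>x\<in>S. \<Sum>w\<in>words n N. F w * (of_bool (g x = w) * H x))"
    by (intro sum.cong refl) auto
  also have "\<dots> = (\<Sum>w\<in>words n N. \<Sum>x\<in>S. F w * (of_bool (g x = w) * H x))"
    by (rule sum.swap)
  finally show ?thesis by (simp only: sum_distrib_left)
qed

text \<open>The word has one letter for each horizontal edge, both ends included, so that it matches
  a full row of \<open>hedges\<close>; the prescribed ends are imposed by the indicator.\<close>

lemma row_eq_sum_words:
  assumes "a \<in> {1..n}" "length bs = length vs" "length ts = length vs"
  shows "row n q u vs a bs ts c =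
     (\<Sum>w\<in>words n (Suc (length vs)). of_bool (w ! 0 = a \<and> w ! length vs = c) *
        (\<Prod>s<length vs. weight q u (vs ! s) (w ! s) (bs ! s) (w ! Suc s) (ts ! s)))"
  using assms
proof (induction vs arbitrary: a bs ts)
  case Nil
  have "(\<Sum>x\<in>{1..n}. of_bool (x = a \<and> x = c)) = (\<Sum>x\<in>{1..n}. if x = a then of_bool (a = c) else (0::'a))"
    by (rule sum.cong) auto
  then show ?case using Nil by (simp add: sum_words_Suc)
next
  case (Cons v vs)
  obtain b bs0 t ts0 where [simp]: "bs = b # bs0" "ts = t # ts0"
    using Cons.prems by (metis length_Suc_conv)
  let ?P = "\<lambda>w. \<Prod>s<length vs. weight q u (vs ! s) (w ! s) (bs0 ! s) (w ! Suc s) (ts0 ! s)"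
  have "(\<Sum>w\<in>words n (Suc (length (v # vs))). of_bool (w ! 0 = a \<and> w ! length (v # vs) = c) *
        (\<Prod>s<length (v # vs). weight q u ((v # vs) ! s) (w ! s) (bs ! s) (w ! Suc s) (ts ! s)))
    = (\<Sum>x\<in>{1..n}. if x = a then \<Sum>w\<in>words n (Suc (length vs)). of_bool (w ! length vs = c) *
        (weight q u v a b (w ! 0) t * ?P w) else 0)"
    unfolding sum_words_Suc[of _ n "length (v # vs)"] unfolding list.size add_0_right add_Suc_right
    by (intro sum.cong refl) (auto simp: prod.lessThan_Suc_shift simp del: prod.lessThan_Suc intro!: sum.cong)
  also have "\<dots> = (\<Sum>w\<in>words n (Suc (length vs)). of_bool (w ! length vs = c) * (weight q u v a b (w ! 0) t * ?P w))"
    using Cons.prems by simp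
  also have "\<dots> = (\<Sum>w\<in>words n (Suc (length vs)). \<Sum>e\<in>{1..n}. if e = w ! 0 then of_bool (w ! length vs = c) * (weight q u v a b (w ! 0) t * ?P w) else 0)"
  proof (rule sum.cong[OF refl])
    fix w assume "w \<in> words n (Suc (length vs))"
    then have "w ! 0 \<in> {1..n}" by (auto simp: words_def length_Suc_conv)
    then show "of_bool (w ! length vs = c) * (weight q u v a b (w ! 0) t * ?P w)
      = (\<Sum>e\<in>{1..n}. if e = w ! 0 then of_bool (w ! length vs = c) * (weight q u v a b (w ! 0) t * ?P w) else 0)"
      by simp
  qed
  also have "\<dots> = (\<Sum>w\<in>words n (Suc (length vs)). \<Sum>e\<in>{1..n}. weight q u v a b e t * (of_bool (w ! 0 = e \<and> w ! length vs = c) * ?P w))"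
    by (intro sum.cong refl) auto
  also have "\<dots> = (\<Sum>e\<in>{1..n}. \<Sum>w\<in>words n (Suc (length vs)). weight q u v a b e t * (of_bool (w ! 0 = e \<and> w ! length vs = c) * ?P w))"
    by (rule sum.swap)
  also have "\<dots> = (\<Sum>e\<in>{1..n}. weight q u v a b e t * row n q u vs e bs0 ts0 c)"
  proof (rule sum.cong[OF refl])
    fix e assume "e \<in> {1..n}"
    then have IH: "row n q u vs e bs0 ts0 c =
        (\<Sum>w\<in>words n (Suc (length vs)). of_bool (w ! 0 = e \<and> w ! length vs = c) * ?P w)"
      by (rule Cons.IH) (use Cons.prems in auto)
    show "(\<Sum>w\<in>words n (Suc (length vs)). weight q u v a b e t * (of_bool (w ! 0 = e \<and> w ! length vs = c) * ?P w))
        = weight q u v a b e t * row n q u vs e bs0 ts0 c"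
      by (simp only: IH sum_distrib_left)
  qed
  finally show ?case by simp
qed

text \<open>Here \<open>r\<close> is a level of vertical edges, not a row of vertices: level 0 is
  the top boundary of layer \<open>p\<close>, and row \<open>r\<close> of vertices lies between the
  levels \<open>r - 1\<close> and \<open>r\<close>.\<close>

definition row_word :: "(nat \<times> nat \<times> nat \<Rightarrow> nat) \<Rightarrow> nat \<Rightarrow> nat \<Rightarrow> nat \<Rightarrow> nat list" where
  "row_word t N p r = map (\<lambda>s. t (p, r, s)) [1..<Suc N]"

lemma length_row_word [simp]: "length (row_word t N p r) = N"
  by (simp add: row_word_def)

lemma row_word_nth: "s < N \<Longrightarrow> row_word t N p r ! s = t (p, r, Suc s)"
  by (simp add: row_word_def del: upt_Suc)

lemma row_word_cong:
  "(\<And>s. s \<in> {1..N} \<Longrightarrow> t (p, r, s) = t' (p, r, s)) \<Longrightarrow> row_word t N p r = row_word t' N p r"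
  by (auto simp: row_word_def)

lemma row_word_in_words:
  "(\<And>s. s \<in> {1..N} \<Longrightarrow> t (p, r, s) \<in> {1..n}) \<Longrightarrow> row_word t N p r \<in> words n N"
  by (auto simp: words_def row_word_def)

lemma sum_row_words:
  "(\<Sum>t\<in>({p} \<times> {r} \<times> {1..N}) \<rightarrow>\<^sub>E {1..n}. f (row_word t N p r)) = (\<Sum>w\<in>words n N. f w)"
proof -
  let ?es = "map (\<lambda>s. (p, r, s)) [1..<Suc N]"
  have "set ?es = {p} \<times> {r} \<times> {1..N}" by auto
  moreover have "distinct ?es" by (simp add: distinct_map inj_on_def del: upt_Suc)
  moreover have "row_word t N p r = map t ?es" for t by (simp add: row_word_def o_def del: upt_Suc)
  ultimately show ?thesis
    using sum_PiE_words[of ?es f n] by (simp del: upt_Suc)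
qed

text \<open>The layer is cut at level \<open>j\<close> along the word \<open>T\<close>, and
  \<open>drop j\<close> selects the rows below the cut. The induction on \<open>k - j\<close> raises
  the cut from the bottom, one row at a time.\<close>

lemma layer_sum_eq_grid:
  assumes "k = length us" "length ls = k" "length rs = k" "N = length vs" "j \<le> k"
    and "T \<in> words n N" "length bs = N"
  shows "(\<Sum>t\<in>({p} \<times> {j..k} \<times> {1..N}) \<rightarrow>\<^sub>E {1..n}.
            of_bool (row_word t N p j = T) * (of_bool (row_word t N p k = bs) *
              (\<Prod>r\<in>{j..<k}. row n q (us ! r) vs (ls ! r) (row_word t N p (Suc r)) (row_word t N p r) (rs ! r))))
       = grid n q (drop j us) vs (drop j ls) bs T (drop j rs)"
  using assms(5,6)
proof (induction "k - j" arbitrary: j T)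
  case 0
  then have [simp]: "j = k" by simp
  have "(\<Sum>w\<in>words n N. of_bool (w = T) * of_bool (w = bs)) = (\<Sum>w\<in>words n N. if w = T then of_bool (bs = T) else (0::'a))"
    by (rule sum.cong) auto
  then show ?case
    using sum_row_words[where f = "\<lambda>w. of_bool (w = T) * (of_bool (w = bs) :: 'a)" and r = k and N = N and p = p and n = n] 0 assms
    by simp
next
  case (Suc d)
  then have j: "j < k" by simp
  let ?G = "\<lambda>t. of_bool (row_word t N p k = bs) *
     (\<Prod>r\<in>{Suc j..<k}. row n q (us ! r) vs (ls ! r) (row_word t N p (Suc r)) (row_word t N p r) (rs ! r))"
  let ?R = "\<lambda>w. row n q (us ! j) vs (ls ! j) w T (rs ! j)"
  have split: "{p} \<times> {j..k} \<times> {1..N} = ({p} \<times> {j} \<times> {1..N}) \<union> ({p} \<times> {Suc j..k} \<times> {1..N})"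
    using j by auto
  have "(\<Sum>t\<in>({p} \<times> {j..k} \<times> {1..N}) \<rightarrow>\<^sub>E {1..n}.
            of_bool (row_word t N p j = T) * (of_bool (row_word t N p k = bs) *
              (\<Prod>r\<in>{j..<k}. row n q (us ! r) vs (ls ! r) (row_word t N p (Suc r)) (row_word t N p r) (rs ! r))))
     = (\<Sum>x\<in>({p} \<times> {j} \<times> {1..N}) \<rightarrow>\<^sub>E {1..n}. \<Sum>y\<in>({p} \<times> {Suc j..k} \<times> {1..N}) \<rightarrow>\<^sub>E {1..n}.
          of_bool (row_word x N p j = T) * (?R (row_word y N p (Suc j)) * ?G y))"
    unfolding split
  proof (rule sum_PiE_Un)
    fix h x y :: "nat \<times> nat \<times> nat \<Rightarrow> nat" assume x: "\<And>e. e \<in> {p} \<times> {j} \<times> {1..N} \<Longrightarrow> h e = x e"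
      and y: "\<And>e. e \<in> {p} \<times> {Suc j..k} \<times> {1..N} \<Longrightarrow> h e = y e"
    have 1: "row_word h N p j = row_word x N p j"
      by (rule row_word_cong) (use x in auto)
    have 2: "row_word h N p r = row_word y N p r" if "r \<in> {Suc j..k}" for r
      by (rule row_word_cong) (use y that in auto)
    have 3: "(\<Prod>r\<in>{Suc j..<k}. row n q (us ! r) vs (ls ! r) (row_word h N p (Suc r)) (row_word h N p r) (rs ! r))
       = (\<Prod>r\<in>{Suc j..<k}. row n q (us ! r) vs (ls ! r) (row_word y N p (Suc r)) (row_word y N p r) (rs ! r))"
      by (rule prod.cong) (auto simp: 2)
    show "of_bool (row_word h N p j = T) * (of_bool (row_word h N p k = bs) *
              (\<Prod>r\<in>{j..<k}. row n q (us ! r) vs (ls ! r) (row_word h N p (Suc r)) (row_word h N p r) (rs ! r)))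
       = of_bool (row_word x N p j = T) * (?R (row_word y N p (Suc j)) * ?G y)"
      using j by (cases "row_word x N p j = T") (simp_all add: prod.atLeast_Suc_lessThan 1 2 3 mult_ac)
  qed auto
  also have "\<dots> = (\<Sum>x\<in>({p} \<times> {j} \<times> {1..N}) \<rightarrow>\<^sub>E {1..n}. of_bool (row_word x N p j = T)) *
      (\<Sum>y\<in>({p} \<times> {Suc j..k} \<times> {1..N}) \<rightarrow>\<^sub>E {1..n}. ?R (row_word y N p (Suc j)) * ?G y)"
    by (simp only: sum_product)
  also have "(\<Sum>x\<in>({p} \<times> {j} \<times> {1..N}) \<rightarrow>\<^sub>E {1..n}. of_bool (row_word x N p j = T)) = (1 :: 'a)"
  proof -
    have "(\<Sum>w\<in>words n N. of_bool (w = T)) = (\<Sum>w\<in>words n N. if w = T then 1 else (0::'a))"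
      by (rule sum.cong) auto
    then show ?thesis
      using Suc.prems sum_row_words[where f = "\<lambda>w. of_bool (w = T) :: 'a" and r = j and N = N and p = p and n = n] by simp
  qed
  also have "(\<Sum>y\<in>({p} \<times> {Suc j..k} \<times> {1..N}) \<rightarrow>\<^sub>E {1..n}. ?R (row_word y N p (Suc j)) * ?G y)
     = (\<Sum>w\<in>words n N. ?R w * (\<Sum>y\<in>({p} \<times> {Suc j..k} \<times> {1..N}) \<rightarrow>\<^sub>E {1..n}. of_bool (row_word y N p (Suc j) = w) * ?G y))"
  proof (rule sum_group_words, rule row_word_in_words)
    fix x s assume "x \<in> {p} \<times> {Suc j..k} \<times> {1..N} \<rightarrow>\<^sub>E {1..n}" "s \<in> {1..N}"
    then show "x (p, Suc j, s) \<in> {1..n}"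
      using j by (auto dest!: PiE_mem[of x _ _ "(p, Suc j, s)"])
  qed
  also have "\<dots> = (\<Sum>w\<in>words n N. ?R w * grid n q (drop (Suc j) us) vs (drop (Suc j) ls) bs w (drop (Suc j) rs))"
  proof (rule sum.cong[OF refl])
    fix w assume w: "w \<in> words n N"
    have d: "d = k - Suc j" and le: "Suc j \<le> k" using Suc.hyps(2) j by linarith+
    show "?R w * (\<Sum>y\<in>({p} \<times> {Suc j..k} \<times> {1..N}) \<rightarrow>\<^sub>E {1..n}. of_bool (row_word y N p (Suc j) = w) * ?G y)
        = ?R w * grid n q (drop (Suc j) us) vs (drop (Suc j) ls) bs w (drop (Suc j) rs)"
      using Suc.hyps(1)[OF d le w] by (simp only:)
  qed
  also have "(\<Sum>w\<in>words n N. ?R w * grid n q (drop (Suc j) us) vs (drop (Suc j) ls) bs w (drop (Suc j) rs))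
      = grid n q (drop j us) vs (drop j ls) bs T (drop j rs)"
  proof -
    have "drop j us = us ! j # drop (Suc j) us" "drop j ls = ls ! j # drop (Suc j) ls" "drop j rs = rs ! j # drop (Suc j) rs"
      using j assms by (simp_all add: Cons_nth_drop_Suc)
    then show ?thesis by (simp only: grid.simps assms(4))
  qed
  finally show ?case by simp
qed

text \<open>The constant left boundary of layer 1 is treated as a word that comes from a layer 0, so
  that every layer receives its left colours in the same way.\<close>

definition u_word :: "'a vars \<Rightarrow> nat \<Rightarrow> (nat \<times> nat \<times> nat \<Rightarrow> nat) \<Rightarrow> nat list" where
  "u_word X p t = (if p = 0 then replicate (nrows X 1) 1
     else map (\<lambda>r. t (p, 0, length (vIvars X p) + r)) [1..<Suc (nrows X (Suc p))])"

definition coloursI :: "'a vars \<Rightarrow> (nat \<Rightarrow> nat set) \<Rightarrow> nat \<Rightarrow> nat list" where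
  "coloursI X I p = map (\<lambda>s. colour X I (coordI X p s)) [1..<Suc (length (vIvars X p))]"

definition coloursII :: "'a vars \<Rightarrow> (nat \<Rightarrow> nat set) \<Rightarrow> nat \<Rightarrow> nat list" where
  "coloursII X I p = map (\<lambda>s. colour X I (coordII X p s)) [1..<Suc (length (vIIvars X p))]"

definition coloursM :: "'a vars \<Rightarrow> (nat \<Rightarrow> nat set) \<Rightarrow> nat list" where
  "coloursM X I = map (\<lambda>s. colour X I (coordM X s)) [1..<Suc (length (vMvars X))]"

text \<open>The middle part is read off from \<open>t\<close> itself. Requiring the top edges of a
  lower layer to equal \<open>tops\<close> therefore constrains its \<open>v\<close>-columns only
  and leaves the edges to the next layer free.\<close>

definition tops :: "'a vars \<Rightarrow> (nat \<Rightarrow> nat set) \<Rightarrow> nat \<Rightarrow> (nat \<times> nat \<times> nat \<Rightarrow> nat) \<Rightarrow> nat list" where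
  "tops X I p t = (if p < nlayers X then coloursI X I p @ u_word X p t @ coloursII X I p else coloursM X I)"

lemma length_u_word [simp]: "length (u_word X p t) = nrows X (Suc p)"
  by (simp add: u_word_def del: upt_Suc)

lemma length_colours [simp]:
  "length (coloursI X I p) = length (vIvars X p)"
  "length (coloursII X I p) = length (vIIvars X p)"
  "length (coloursM X I) = length (vMvars X)"
  by (simp_all add: coloursI_def coloursII_def coloursM_def del: upt_Suc)

lemma map_upt_add: "map f [1..<Suc (a + b)] = map f [1..<Suc a] @ map (\<lambda>s. f (a + s)) [1..<Suc b]"
  by (rule nth_equalityI) (auto simp: nth_append simp del: upt_Suc)

lemma map_upt_eq_iff: "map f [1..<Suc a] = map g [1..<Suc a] \<longleftrightarrow> (\<forall>s\<in>{1..a}. f s = g s)"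
  by (auto simp del: upt_Suc simp: map_eq_conv)

lemma row_word_eq_replicate_iff: "row_word t N p r = replicate N c \<longleftrightarrow> (\<forall>s\<in>{1..N}. t (p, r, s) = c)"
proof -
  have "replicate N c = map (\<lambda>_. c) [1..<Suc N]"
    by (simp add: map_replicate_const del: upt_Suc)
  then show ?thesis
    unfolding row_word_def by (simp only: map_upt_eq_iff)
qed

lemma ncols_lower: "p < nlayers X \<Longrightarrow> ncols X p = length (vIvars X p) + (nrows X (Suc p) + length (vIIvars X p))"
  by (simp add: ncols_def col_vars_def nrows_def)

lemma ncols_top: "ncols X (nlayers X) = length (vMvars X)"
  by (simp add: ncols_def col_vars_def)

lemma row_word_0_lower:
  assumes "p < nlayers X" "p \<noteq> 0"
  shows "row_word t (ncols X p) p 0 = map (\<lambda>s. t (p, 0, s)) [1..<Suc (length (vIvars X p))] @ u_word X p t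
     @ map (\<lambda>s. t (p, 0, length (vIvars X p) + nrows X (p + 1) + s)) [1..<Suc (length (vIIvars X p))]"
  unfolding row_word_def ncols_lower[OF assms(1)] map_upt_add u_word_def
  using assms(2) by (simp add: add.assoc del: upt_Suc)

lemma row_word_eq_tops_iff:
  assumes "p < nlayers X" "p \<noteq> 0"
  shows "row_word t (ncols X p) p 0 = tops X I p t \<longleftrightarrow>
     (\<forall>s\<in>{1..length (vIvars X p)}. t (p, 0, s) = colour X I (coordI X p s)) \<and>
     (\<forall>s\<in>{1..length (vIIvars X p)}. t (p, 0, length (vIvars X p) + nrows X (p + 1) + s) = colour X I (coordII X p s))"
proof -
  have "row_word t (ncols X p) p 0 = tops X I p t \<longleftrightarrow>
     map (\<lambda>s. t (p, 0, s)) [1..<Suc (length (vIvars X p))] = coloursI X I p \<and>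
     map (\<lambda>s. t (p, 0, length (vIvars X p) + nrows X (p + 1) + s)) [1..<Suc (length (vIIvars X p))] = coloursII X I p"
    unfolding row_word_0_lower[OF assms] tops_def using assms by (simp del: upt_Suc)
  then show ?thesis
    unfolding coloursI_def coloursII_def map_upt_eq_iff .
qed

lemma row_word_eq_coloursM_iff:
  "row_word t (ncols X (nlayers X)) (nlayers X) 0 = tops X I (nlayers X) t \<longleftrightarrow>
     (\<forall>s\<in>{1..length (vMvars X)}. t (nlayers X, 0, s) = colour X I (coordM X s))"
  unfolding row_word_def tops_def coloursM_def ncols_top by (simp only: less_irrefl if_False map_upt_eq_iff)

lemma u_word_nth:
  "r \<in> {1..nrows X (Suc p)} \<Longrightarrow>
     u_word X p t ! (r - 1) = (if p = 0 then 1 else t (p, 0, length (vIvars X p) + r))"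
  by (auto simp: u_word_def simp del: upt_Suc)

definition top_bottom :: "'a vars \<Rightarrow> (nat \<Rightarrow> nat set) \<Rightarrow> (nat \<times> nat \<times> nat \<Rightarrow> nat) \<Rightarrow> nat \<Rightarrow> bool" where
  "top_bottom X I t p \<longleftrightarrow> row_word t (ncols X p) p 0 = tops X I p t
     \<and> row_word t (ncols X p) p (nrows X p) = replicate (ncols X p) (p + 1)"

definition layer_rows :: "'a vars \<Rightarrow> (nat \<times> nat) set" where
  "layer_rows X = (SIGMA p:{1..nlayers X}. {1..nrows X p})"

lemma ball_lower: "M \<ge> 1 \<Longrightarrow> (\<forall>p\<in>{1..M}. P p) \<longleftrightarrow> (\<forall>p\<in>{1..<M}. P p) \<and> P (M::nat)"
  by (auto simp: le_less)

text \<open>The conditions are regrouped into conditions on vertical edges, one for each layer, and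
  on horizontal edges, one for each row. For fixed \<open>t\<close> their indicator is then a
  product over independent rows.\<close>

lemma boundary_conditions_iff:
  assumes "nlayers X \<ge> 1"
  shows "boundary_conditions X I h t \<longleftrightarrow> (\<forall>p\<in>{1..nlayers X}. top_bottom X I t p) \<and>
     (\<forall>(p, r)\<in>layer_rows X. h (p, r, 0) = u_word X (p - 1) t ! (r - 1) \<and> h (p, r, ncols X p) = p + 1)"
proof -
  let ?M = "nlayers X"
  have left: "(\<forall>p\<in>{1..?M}. \<forall>r\<in>{1..nrows X p}. h (p, r, 0) = u_word X (p - 1) t ! (r - 1)) \<longleftrightarrow>
     (\<forall>r\<in>{1..nrows X 1}. h (1, r, 0) = 1) \<and>
     (\<forall>p\<in>{1..<?M}. \<forall>r\<in>{1..nrows X (p + 1)}. h (p + 1, r, 0) = t (p, 0, length (vIvars X p) + r))"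
    (is "(\<forall>p\<in>_. ?L p) \<longleftrightarrow> ?R1 \<and> ?R2")
  proof -
    have "{1..?M} = insert 1 (Suc ` {1..<?M})"
    proof -
      have "{1..?M} = insert 1 {Suc 1..<Suc ?M}" using assms by auto
      then show ?thesis by (simp only: image_Suc_atLeastLessThan)
    qed
    then have "(\<forall>p\<in>{1..?M}. ?L p) \<longleftrightarrow> ?L 1 \<and> (\<forall>p\<in>{1..<?M}. ?L (Suc p))"
      by (simp del: image_Suc_atLeastLessThan)
    also have "?L 1 \<longleftrightarrow> ?R1"
      using u_word_nth[of _ X 0 t] by (intro ball_cong refl) simp
    also have "(\<forall>p\<in>{1..<?M}. ?L (Suc p)) \<longleftrightarrow> ?R2"
    proof (intro ball_cong refl)
      fix p r assume "p \<in> {1..<?M}" "r \<in> {1..nrows X (p + 1)}"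
      then show "h (Suc p, r, 0) = u_word X (Suc p - 1) t ! (r - 1) \<longleftrightarrow> h (p + 1, r, 0) = t (p, 0, length (vIvars X p) + r)"
        using u_word_nth[of r X p t] by simp
    qed simp
    finally show ?thesis .
  qed
  have top: "(\<forall>p\<in>{1..?M}. row_word t (ncols X p) p 0 = tops X I p t) \<longleftrightarrow>
     (\<forall>p\<in>{1..<?M}. \<forall>s\<in>{1..length (vIvars X p)}. t (p, 0, s) = colour X I (coordI X p s)) \<and>
     (\<forall>p\<in>{1..<?M}. \<forall>s\<in>{1..length (vIIvars X p)}.
        t (p, 0, length (vIvars X p) + nrows X (p + 1) + s) = colour X I (coordII X p s)) \<and>
     (\<forall>s\<in>{1..length (vMvars X)}. t (?M, 0, s) = colour X I (coordM X s))"
    unfolding ball_lower[OF assms] row_word_eq_coloursM_iff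
    using row_word_eq_tops_iff[of _ X t I] by (auto simp: Ball_def)
  have tb: "(\<forall>p\<in>{1..?M}. top_bottom X I t p) \<longleftrightarrow> (\<forall>p\<in>{1..?M}. row_word t (ncols X p) p 0 = tops X I p t)
     \<and> (\<forall>p\<in>{1..?M}. \<forall>s\<in>{1..ncols X p}. t (p, nrows X p, s) = p + 1)"
    unfolding top_bottom_def row_word_eq_replicate_iff by blast
  have rows: "(\<forall>(p, r)\<in>layer_rows X. h (p, r, 0) = u_word X (p - 1) t ! (r - 1) \<and> h (p, r, ncols X p) = p + 1)
     \<longleftrightarrow> (\<forall>p\<in>{1..?M}. \<forall>r\<in>{1..nrows X p}. h (p, r, 0) = u_word X (p - 1) t ! (r - 1))
       \<and> (\<forall>p\<in>{1..?M}. \<forall>r\<in>{1..nrows X p}. h (p, r, ncols X p) = p + 1)"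
    unfolding layer_rows_def by blast
  show ?thesis
    unfolding boundary_conditions_def tb rows left top
    by (rule iffI; elim conjE; intro conjI; assumption)
qed

section \<open>Summing over the horizontal edges and stacking the layers\<close>

lemma single_row_sum:
  fixes p r :: nat
  assumes "a \<in> {1..n}" "length vs = N" "length bs = N" "length ts = N"
  shows "(\<Sum>h\<in>({p} \<times> {r} \<times> {0..N}) \<rightarrow>\<^sub>E {1..n}. of_bool (h (p, r, 0) = a \<and> h (p, r, N) = c) *
           (\<Prod>s\<in>{1..N}. weight q u (vs ! (s - 1)) (h (p, r, s - 1)) (bs ! (s - 1)) (h (p, r, s)) (ts ! (s - 1))))
       = row n q u vs a bs ts c"
proof -
  let ?es = "map (\<lambda>s. (p, r, s)) [0..<Suc N]"
  define f where "f w = of_bool (w ! 0 = a \<and> w ! length vs = c) *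
        (\<Prod>s<length vs. weight q u (vs ! s) (w ! s) (bs ! s) (w ! Suc s) (ts ! s))" for w
  have 1: "set ?es = {p} \<times> {r} \<times> {0..N}" by auto
  have 2: "distinct ?es" by (simp add: distinct_map inj_on_def del: upt_Suc)
  have nth: "map h ?es ! s = h (p, r, s)" if "s \<le> N" for h :: "nat \<times> nat \<times> nat \<Rightarrow> nat" and s
    using that by (simp del: upt_Suc)
  have 3: "of_bool (h (p, r, 0) = a \<and> h (p, r, N) = c) *
           (\<Prod>s\<in>{1..N}. weight q u (vs ! (s - 1)) (h (p, r, s - 1)) (bs ! (s - 1)) (h (p, r, s)) (ts ! (s - 1)))
     = f (map h ?es)" for h
  proof -
    have "(\<Prod>s\<in>{1..N}. weight q u (vs ! (s - 1)) (h (p, r, s - 1)) (bs ! (s - 1)) (h (p, r, s)) (ts ! (s - 1)))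
       = (\<Prod>s<N. weight q u (vs ! s) (h (p, r, s)) (bs ! s) (h (p, r, Suc s)) (ts ! s))"
      unfolding One_nat_def prod.atLeast1_atMost_eq by simp
    also have "\<dots> = (\<Prod>s<N. weight q u (vs ! s) (map h ?es ! s) (bs ! s) (map h ?es ! Suc s) (ts ! s))"
      by (rule prod.cong[OF refl]) (simp add: nth del: upt_Suc)
    finally show ?thesis
      unfolding f_def assms(2) by (simp only: nth[of 0 h] nth[of N h] le0 order_refl)
  qed
  have "length ?es = Suc (length vs)" using assms by simp
  then show ?thesis
    using sum_PiE_words[OF 2, of f n] row_eq_sum_words[of a n bs vs ts q u c] assms
    unfolding 1 3 f_def[symmetric] by (simp del: upt_Suc)
qed

definition layer_edges :: "'a vars \<Rightarrow> nat \<Rightarrow> (nat \<times> nat \<times> nat) set" where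
  "layer_edges X p = {p} \<times> {0..nrows X p} \<times> {1..ncols X p}"

text \<open>The left word comes from the edges of another layer. With \<open>ls\<close> and
  \<open>T\<close> as arguments the term depends on \<open>t\<close> only through the edges of layer
  \<open>p\<close>, which allows the layers to be summed separately.\<close>

definition layer_term ::
  "'a::field \<Rightarrow> 'a vars \<Rightarrow> nat \<Rightarrow> nat list \<Rightarrow> nat list \<Rightarrow> (nat \<times> nat \<times> nat \<Rightarrow> nat) \<Rightarrow> 'a" where
  "layer_term q X p ls T t =
     of_bool (row_word t (ncols X p) p 0 = T) *
     (of_bool (row_word t (ncols X p) p (nrows X p) = replicate (ncols X p) (p + 1)) *
      (\<Prod>r\<in>{0..<nrows X p}. row (nlayers X + 1) q (uvars X p ! r) (col_vars X p) (ls ! r)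
         (row_word t (ncols X p) p (Suc r)) (row_word t (ncols X p) p r) (p + 1)))"

lemma layer_edges_range:
  assumes "t \<in> (\<Union>p\<in>{1..P}. layer_edges X p) \<rightarrow>\<^sub>E {1..n}" "p \<in> {1..P}" "r \<le> nrows X p" "s \<in> {1..ncols X p}"
  shows "t (p, r, s) \<in> {1..n}"
  by (rule PiE_mem[OF assms(1)]) (use assms in \<open>auto simp: layer_edges_def\<close>)

lemma u_word_in_words:
  assumes "t \<in> (\<Union>j\<in>{1..p}. layer_edges X j) \<rightarrow>\<^sub>E {1..nlayers X + 1}" "p < nlayers X"
  shows "u_word X p t \<in> words (nlayers X + 1) (nrows X (Suc p))"
proof (cases "p = 0")
  case True
  then show ?thesis by (auto simp: u_word_def words_def)
next
  case False
  have "t (p, 0, length (vIvars X p) + r) \<in> {1..nlayers X + 1}" if "r \<in> {1..nrows X (Suc p)}" for r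
    by (rule layer_edges_range[OF assms(1)]) (use that assms False in \<open>auto simp: ncols_lower\<close>)
  then show ?thesis
    using False by (auto simp: u_word_def words_def simp del: upt_Suc)
qed

lemma edge_sum_rows:
  assumes M: "nlayers X \<ge> 1" and t: "t \<in> (\<Union>p\<in>{1..nlayers X}. layer_edges X p) \<rightarrow>\<^sub>E {1..nlayers X + 1}"
  shows "(\<Sum>h\<in>hedges X \<rightarrow>\<^sub>E {1..nlayers X + 1}. of_bool (boundary_conditions X I h t) *
       (\<Prod>(p, r, s)\<in>vertices X. R_coeff (nlayers X + 1) q (uvars X p ! (r - 1)) (col_vars X p ! (s - 1))
          (h (p, r, s - 1)) (t (p, r, s)) (h (p, r, s)) (t (p, r - 1, s))))
     = (\<Prod>p\<in>{1..nlayers X}. layer_term q X p (u_word X (p - 1) t) (tops X I p t) t)"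
proof -
  let ?n = "nlayers X + 1" and ?M = "nlayers X"
  define a where "a p r = u_word X (p - 1) t ! (r - 1)" for p r
  define bs where "bs p r = row_word t (ncols X p) p r" for p r
  define F where "F i h = (case i of (p, r) \<Rightarrow> of_bool (h (p, r, 0) = a p r \<and> h (p, r, ncols X p) = p + 1) *
      (\<Prod>s\<in>{1..ncols X p}. weight q (uvars X p ! (r - 1)) (col_vars X p ! (s - 1))
          (h (p, r, s - 1)) (bs p r ! (s - 1)) (h (p, r, s)) (bs p (r - 1) ! (s - 1))))" for i and h :: "nat \<times> nat \<times> nat \<Rightarrow> nat"
  define A where "A i = (case i of (p, r) \<Rightarrow> {p} \<times> {r} \<times> {0..ncols X p})" for i :: "nat \<times> nat"
  have fin: "finite (layer_rows X)" by (auto simp: layer_rows_def)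
  have hedges: "hedges X = (\<Union>i\<in>layer_rows X. A i)"
    by (auto simp: hedges_def A_def layer_rows_def)
  have eq: "of_bool (boundary_conditions X I h t) *
       (\<Prod>(p, r, s)\<in>vertices X. R_coeff ?n q (uvars X p ! (r - 1)) (col_vars X p ! (s - 1))
          (h (p, r, s - 1)) (t (p, r, s)) (h (p, r, s)) (t (p, r - 1, s)))
     = (\<Prod>p\<in>{1..?M}. of_bool (top_bottom X I t p)) * (\<Prod>i\<in>layer_rows X. F i h)"
    if h: "h \<in> hedges X \<rightarrow>\<^sub>E {1..?n}" for h
  proof -
    have ball_layers: "(of_bool (\<forall>i\<in>S. P i) :: 'a) = (\<Prod>i\<in>S. of_bool (P i))" if "finite S" for S :: "nat set" and P
      using that by (induction S rule: finite_induct) auto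
    have ball_rows: "(of_bool (\<forall>i\<in>S. P i) :: 'a) = (\<Prod>i\<in>S. of_bool (P i))" if "finite S" for S :: "(nat \<times> nat) set" and P
      using that by (induction S rule: finite_induct) auto
    have bc: "(of_bool (boundary_conditions X I h t) :: 'a) = (\<Prod>p\<in>{1..?M}. of_bool (top_bottom X I t p)) *
       (\<Prod>i\<in>layer_rows X. of_bool (case i of (p, r) \<Rightarrow> h (p, r, 0) = a p r \<and> h (p, r, ncols X p) = p + 1))"
      unfolding boundary_conditions_iff[OF M] of_bool_conj a_def
      by (simp only: ball_layers[OF finite_atLeastAtMost] ball_rows[OF fin])
    have vert: "(\<Prod>(p, r, s)\<in>vertices X. R_coeff ?n q (uvars X p ! (r - 1)) (col_vars X p ! (s - 1))
          (h (p, r, s - 1)) (t (p, r, s)) (h (p, r, s)) (t (p, r - 1, s)))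
       = (\<Prod>(p, r)\<in>layer_rows X. \<Prod>s\<in>{1..ncols X p}. weight q (uvars X p ! (r - 1)) (col_vars X p ! (s - 1))
          (h (p, r, s - 1)) (bs p r ! (s - 1)) (h (p, r, s)) (bs p (r - 1) ! (s - 1)))"
    proof -
      \<comment> \<open>\<open>R_coeff\<close> has been identified with \<open>weight\<close> only
        for incoming colours in range; this is where the codomain of \<open>h\<close> and
        \<open>t\<close> enters.\<close>
      have key: "R_coeff ?n q (uvars X p ! (r - 1)) (col_vars X p ! (s - 1))
          (h (p, r, s - 1)) (t (p, r, s)) (h (p, r, s)) (t (p, r - 1, s))
          = weight q (uvars X p ! (r - 1)) (col_vars X p ! (s - 1))
          (h (p, r, s - 1)) (bs p r ! (s - 1)) (h (p, r, s)) (bs p (r - 1) ! (s - 1))"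
        if p: "p \<in> {1..?M}" and r: "r \<in> {1..nrows X p}" and s: "s \<in> {1..ncols X p}" for p r s
      proof -
        have hr: "h (p, r, s - 1) \<in> {1..?n}"
          by (rule PiE_mem[OF h]) (use p r s in \<open>auto simp: hedges_def\<close>)
        have tr: "t (p, r, s) \<in> {1..?n}"
          by (rule layer_edges_range[OF t]) (use p r s in auto)
        have b: "bs p r ! (s - 1) = t (p, r, s)" "bs p (r - 1) ! (s - 1) = t (p, r - 1, s)"
          unfolding bs_def using s by (auto simp: row_word_nth)
        show ?thesis
          unfolding b by (rule R_coeff_eq_weight[OF hr tr])
      qed
      have "(\<Prod>(p, r)\<in>layer_rows X. \<Prod>s\<in>{1..ncols X p}. weight q (uvars X p ! (r - 1)) (col_vars X p ! (s - 1))
          (h (p, r, s - 1)) (bs p r ! (s - 1)) (h (p, r, s)) (bs p (r - 1) ! (s - 1)))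
        = (\<Prod>((p, r), s)\<in>(SIGMA i:layer_rows X. {1..ncols X (fst i)}). weight q (uvars X p ! (r - 1)) (col_vars X p ! (s - 1))
          (h (p, r, s - 1)) (bs p r ! (s - 1)) (h (p, r, s)) (bs p (r - 1) ! (s - 1)))"
        using fin by (subst prod.Sigma[symmetric]) (auto simp: case_prod_beta)
      also have "\<dots> = (\<Prod>(p, r, s)\<in>vertices X. weight q (uvars X p ! (r - 1)) (col_vars X p ! (s - 1))
          (h (p, r, s - 1)) (bs p r ! (s - 1)) (h (p, r, s)) (bs p (r - 1) ! (s - 1)))"
        by (rule prod.reindex_bij_witness[of _ "\<lambda>(p, r, s). ((p, r), s)" "\<lambda>((p, r), s). (p, r, s)"])
           (auto simp: layer_rows_def vertices_def)
      also have "\<dots> = (\<Prod>(p, r, s)\<in>vertices X. R_coeff ?n q (uvars X p ! (r - 1)) (col_vars X p ! (s - 1))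
          (h (p, r, s - 1)) (t (p, r, s)) (h (p, r, s)) (t (p, r - 1, s)))"
        by (rule prod.cong[OF refl]) (clarsimp simp: vertices_def key simp del: One_nat_def)
      finally show ?thesis ..
    qed
    show ?thesis
      unfolding bc vert F_def by (simp add: prod.distrib[symmetric] case_prod_beta mult.assoc)
  qed
  have "(\<Sum>h\<in>hedges X \<rightarrow>\<^sub>E {1..?n}. of_bool (boundary_conditions X I h t) *
       (\<Prod>(p, r, s)\<in>vertices X. R_coeff ?n q (uvars X p ! (r - 1)) (col_vars X p ! (s - 1))
          (h (p, r, s - 1)) (t (p, r, s)) (h (p, r, s)) (t (p, r - 1, s))))
     = (\<Prod>p\<in>{1..?M}. of_bool (top_bottom X I t p)) * (\<Sum>h\<in>hedges X \<rightarrow>\<^sub>E {1..?n}. \<Prod>i\<in>layer_rows X. F i h)"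
    unfolding sum_distrib_left by (rule sum.cong[OF refl eq])
  also have "(\<Sum>h\<in>hedges X \<rightarrow>\<^sub>E {1..?n}. \<Prod>i\<in>layer_rows X. F i h)
     = (\<Prod>i\<in>layer_rows X. \<Sum>h\<in>A i \<rightarrow>\<^sub>E {1..?n}. F i h)"
    unfolding hedges
  proof (rule sum_PiE_prod[OF fin])
    show "A i \<inter> A j = {}" if "i \<noteq> j" for i j
      using that by (auto simp: A_def split: prod.splits)
    show "F i h = F i h'" if "\<And>e. e \<in> A i \<Longrightarrow> h e = h' e" for i and h h' :: "nat \<times> nat \<times> nat \<Rightarrow> nat"
    proof -
      obtain p r where [simp]: "i = (p, r)" by (cases i)
      have "h (p, r, s) = h' (p, r, s)" if "s \<le> ncols X p" for s
        using that \<open>\<And>e. e \<in> A i \<Longrightarrow> h e = h' e\<close> by (auto simp: A_def)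
      then show ?thesis
        unfolding F_def by (auto intro!: arg_cong2[of _ _ _ _ "(*)"] prod.cong)
    qed
  qed
  also have "\<dots> = (\<Prod>(p, r)\<in>layer_rows X. row ?n q (uvars X p ! (r - 1)) (col_vars X p) (a p r) (bs p r) (bs p (r - 1)) (p + 1))"
  proof (rule prod.cong[OF refl])
    fix i assume "i \<in> layer_rows X"
    then obtain p r where [simp]: "i = (p, r)" and p: "p \<in> {1..?M}" and r: "r \<in> {1..nrows X p}"
      by (auto simp: layer_rows_def)
    have a: "a p r \<in> {1..?n}"
    proof (cases "p = 1")
      case True
      then show ?thesis using u_word_nth[of r X 0 t] r by (simp add: a_def)
    next
      case False
      have "t (p - 1, 0, length (vIvars X (p - 1)) + r) \<in> {1..?n}"
        by (rule layer_edges_range[OF t]) (use False p r ncols_lower[of "p - 1" X] in auto)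
      then show ?thesis using u_word_nth[of r X "p - 1" t] r p False by (simp add: a_def)
    qed
    show "(\<Sum>h\<in>A i \<rightarrow>\<^sub>E {1..?n}. F i h)
       = (case i of (p, r) \<Rightarrow> row ?n q (uvars X p ! (r - 1)) (col_vars X p) (a p r) (bs p r) (bs p (r - 1)) (p + 1))"
      unfolding \<open>i = (p, r)\<close> prod.case A_def F_def
      by (rule single_row_sum[OF a]) (simp_all add: bs_def ncols_def)
  qed
  also have "\<dots> = (\<Prod>p\<in>{1..?M}. \<Prod>r\<in>{0..<nrows X p}. row ?n q (uvars X p ! r) (col_vars X p) (u_word X (p - 1) t ! r)
         (row_word t (ncols X p) p (Suc r)) (row_word t (ncols X p) p r) (p + 1))"
    unfolding layer_rows_def
    by (subst prod.Sigma[symmetric]) (simp_all add: a_def bs_def prod.atLeast1_atMost_eq lessThan_atLeast0)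
  also have "(\<Prod>p\<in>{1..?M}. of_bool (top_bottom X I t p)) * \<dots>
     = (\<Prod>p\<in>{1..?M}. layer_term q X p (u_word X (p - 1) t) (tops X I p t) t)"
    unfolding prod.distrib[symmetric] layer_term_def top_bottom_def of_bool_conj by (simp only: mult.assoc)
  finally show ?thesis .
qed

lemma psi_eq_sum_layers:
  assumes M: "nlayers X \<ge> 1"
  shows "psi q X I = (\<Sum>t\<in>(\<Union>p\<in>{1..nlayers X}. layer_edges X p) \<rightarrow>\<^sub>E {1..nlayers X + 1}.
     \<Prod>p\<in>{1..nlayers X}. layer_term q X p (u_word X (p - 1) t) (tops X I p t) t)"
proof -
  let ?n = "nlayers X + 1"
  define f where "f h t = (\<Prod>(p, r, s)\<in>vertices X. R_coeff ?n q (uvars X p ! (r - 1)) (col_vars X p ! (s - 1))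
          (h (p, r, s - 1)) (t (p, r, s)) (h (p, r, s)) (t (p, r - 1, s)))" for h t
  let ?H = "hedges X \<rightarrow>\<^sub>E {1..?n}" and ?T = "(\<Union>p\<in>{1..nlayers X}. layer_edges X p) \<rightarrow>\<^sub>E {1..?n}"
  have tedges: "tedges X = (\<Union>p\<in>{1..nlayers X}. layer_edges X p)"
    by (auto simp: tedges_def layer_edges_def)
  have fin: "finite ?H" "finite ?T"
    by (auto intro!: finite_PiE simp: hedges_def layer_edges_def)
  have "psi q X I = (\<Sum>x\<in>configurations X I. f (fst x) (snd x))"
    unfolding psi_def f_def by (simp add: case_prod_beta)
  also have "\<dots> = (\<Sum>x\<in>?H \<times> ?T. of_bool (boundary_conditions X I (fst x) (snd x)) * f (fst x) (snd x))"
  proof (rule sum.mono_neutral_cong_left)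
    show "finite (?H \<times> ?T)" using fin by blast
    show "configurations X I \<subseteq> ?H \<times> ?T"
      unfolding configurations_def tedges by blast
    show "\<forall>x\<in>?H \<times> ?T - configurations X I. of_bool (boundary_conditions X I (fst x) (snd x)) * f (fst x) (snd x) = 0"
      unfolding configurations_def tedges by auto
    show "f (fst x) (snd x) = of_bool (boundary_conditions X I (fst x) (snd x)) * f (fst x) (snd x)"
      if "x \<in> configurations X I" for x
      using that unfolding configurations_def by auto
  qed
  also have "\<dots> = (\<Sum>h\<in>?H. \<Sum>t\<in>?T. of_bool (boundary_conditions X I h t) * f h t)"
    by (simp add: sum.cartesian_product case_prod_beta)
  also have "\<dots> = (\<Sum>t\<in>?T. \<Sum>h\<in>?H. of_bool (boundary_conditions X I h t) * f h t)"
    by (rule sum.swap)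
  also have "\<dots> = (\<Sum>t\<in>?T. \<Prod>p\<in>{1..nlayers X}. layer_term q X p (u_word X (p - 1) t) (tops X I p t) t)"
    unfolding f_def by (rule sum.cong[OF refl edge_sum_rows[OF M]])
  finally show ?thesis .
qed

lemma layer_term_sum:
  assumes "length ls = nrows X p" "T \<in> words (nlayers X + 1) (ncols X p)"
  shows "(\<Sum>t\<in>layer_edges X p \<rightarrow>\<^sub>E {1..nlayers X + 1}. layer_term q X p ls T t)
       = grid (nlayers X + 1) q (uvars X p) (col_vars X p) ls (replicate (ncols X p) (p + 1)) T (replicate (nrows X p) (p + 1))"
  using layer_sum_eq_grid[of "nrows X p" "uvars X p" ls "replicate (nrows X p) (p + 1)" "ncols X p" "col_vars X p" 0 T
      "nlayers X + 1" "replicate (ncols X p) (p + 1)" p q] assms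
  unfolding layer_term_def layer_edges_def by (simp add: nrows_def ncols_def)

lemma layer_term_cong:
  assumes "\<And>e. e \<in> layer_edges X p \<Longrightarrow> t e = t' e"
  shows "layer_term q X p ls T t = layer_term q X p ls T t'"
proof -
  have "row_word t (ncols X p) p r = row_word t' (ncols X p) p r" if "r \<le> nrows X p" for r
    by (rule row_word_cong) (use that assms in \<open>auto simp: layer_edges_def\<close>)
  then show ?thesis
    unfolding layer_term_def by (simp cong: prod.cong_simp)
qed

lemma u_word_cong:
  assumes "p < nlayers X" "\<And>e. p \<noteq> 0 \<Longrightarrow> e \<in> layer_edges X p \<Longrightarrow> t e = t' e"
  shows "u_word X p t = u_word X p t'"
  using assms by (auto simp: u_word_def layer_edges_def ncols_lower simp del: upt_Suc)

lemma tops_cong: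
  assumes "p \<noteq> 0" "\<And>e. e \<in> layer_edges X p \<Longrightarrow> t e = t' e"
  shows "tops X I p t = tops X I p t'"
  unfolding tops_def using u_word_cong[of p X t t'] assms by auto

text \<open>The top word \<open>T\<close> is arbitrary so that this step serves twice: in the
  induction over the lower layers, where \<open>T\<close> contains the word passed on to the next
  layer, and for the top layer, where it consists of the colours of \<open>v^(M)\<close>.\<close>

lemma sum_add_layer:
  fixes q :: "'a::field"
  assumes p: "p < nlayers X" and T: "T \<in> words (nlayers X + 1) (ncols X (Suc p))"
    and below: "\<And>w. w \<in> words (nlayers X + 1) (nrows X (Suc p)) \<Longrightarrow>
       (\<Sum>t\<in>(\<Union>j\<in>{1..p}. layer_edges X j) \<rightarrow>\<^sub>E {1..nlayers X + 1}. of_bool (u_word X p t = w) *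
          (\<Prod>j\<in>{1..p}. layer_term q X j (u_word X (j - 1) t) (tops X I j t) t))
       = below (nlayers X + 1) q X CI CII p (uvars X (Suc p)) w"
  shows "(\<Sum>t\<in>(\<Union>j\<in>{1..Suc p}. layer_edges X j) \<rightarrow>\<^sub>E {1..nlayers X + 1}.
          (\<Prod>j\<in>{1..p}. layer_term q X j (u_word X (j - 1) t) (tops X I j t) t) * layer_term q X (Suc p) (u_word X p t) T t)
       = total (nlayers X + 1) q X CI CII p (p + 2) (uvars X (Suc p)) (col_vars X (Suc p)) T"
proof -
  let ?n = "nlayers X + 1" and ?E = "\<Union>j\<in>{1..p}. layer_edges X j"
  let ?P = "\<lambda>t. \<Prod>j\<in>{1..p}. layer_term q X j (u_word X (j - 1) t) (tops X I j t) t"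
  let ?G = "\<lambda>w. grid ?n q (uvars X (Suc p)) (col_vars X (Suc p)) w (replicate (ncols X (Suc p)) (p + 2)) T (replicate (nrows X (Suc p)) (p + 2))"
  have E: "(\<Union>j\<in>{1..Suc p}. layer_edges X j) = ?E \<union> layer_edges X (Suc p)"
    by (auto simp: atLeastAtMostSuc_conv)
  have "(\<Sum>t\<in>(\<Union>j\<in>{1..Suc p}. layer_edges X j) \<rightarrow>\<^sub>E {1..?n}. ?P t * layer_term q X (Suc p) (u_word X p t) T t)
     = (\<Sum>x\<in>?E \<rightarrow>\<^sub>E {1..?n}. \<Sum>y\<in>layer_edges X (Suc p) \<rightarrow>\<^sub>E {1..?n}. ?P x * layer_term q X (Suc p) (u_word X p x) T y)"
    unfolding E
  proof (rule sum_PiE_Un)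
    show "?E \<inter> layer_edges X (Suc p) = {}" by (auto simp: layer_edges_def)
    fix h x y :: "nat \<times> nat \<times> nat \<Rightarrow> nat"
    assume x: "\<And>e. e \<in> ?E \<Longrightarrow> h e = x e" and y: "\<And>e. e \<in> layer_edges X (Suc p) \<Longrightarrow> h e = y e"
    have lay: "h e = x e" if "j \<in> {1..p}" "e \<in> layer_edges X j" for j e
      using x that by blast
    have u: "u_word X j h = u_word X j x" if "j \<le> p" for j
      by (rule u_word_cong) (use p that lay[of j] in auto)
    have "?P h = ?P x"
    proof (rule prod.cong[OF refl])
      fix j assume j: "j \<in> {1..p}"
      have "tops X I j h = tops X I j x"
        by (rule tops_cong) (use j lay in auto)
      moreover have "u_word X (j - 1) h = u_word X (j - 1) x"
        by (rule u) (use j in auto)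
      moreover have "layer_term q X j ls T' h = layer_term q X j ls T' x" for ls T'
        by (rule layer_term_cong) (rule lay[OF j])
      ultimately show "layer_term q X j (u_word X (j - 1) h) (tops X I j h) h = layer_term q X j (u_word X (j - 1) x) (tops X I j x) x"
        by simp
    qed
    moreover have "layer_term q X (Suc p) (u_word X p h) T h = layer_term q X (Suc p) (u_word X p x) T y"
      using layer_term_cong[OF y] u[of p] by simp
    ultimately show "?P h * layer_term q X (Suc p) (u_word X p h) T h = ?P x * layer_term q X (Suc p) (u_word X p x) T y"
      by simp
  qed
  also have "\<dots> = (\<Sum>x\<in>?E \<rightarrow>\<^sub>E {1..?n}. ?G (u_word X p x) * ?P x)"
  proof (rule sum.cong[OF refl])
    fix x
    have G: "(\<Sum>y\<in>layer_edges X (Suc p) \<rightarrow>\<^sub>E {1..?n}. layer_term q X (Suc p) (u_word X p x) T y) = ?G (u_word X p x)"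
      using layer_term_sum[of "u_word X p x" X "Suc p" T q] T by simp
    show "(\<Sum>y\<in>layer_edges X (Suc p) \<rightarrow>\<^sub>E {1..?n}. ?P x * layer_term q X (Suc p) (u_word X p x) T y) = ?G (u_word X p x) * ?P x"
      unfolding sum_distrib_left[symmetric] G by (rule mult.commute)
  qed
  also have "\<dots> = (\<Sum>w\<in>words ?n (nrows X (Suc p)). ?G w * (\<Sum>x\<in>?E \<rightarrow>\<^sub>E {1..?n}. of_bool (u_word X p x = w) * ?P x))"
    by (rule sum_group_words) (rule u_word_in_words[OF _ p])
  also have "\<dots> = (\<Sum>w\<in>words ?n (nrows X (Suc p)). ?G w * below ?n q X CI CII p (uvars X (Suc p)) w)"
    by (rule sum.cong[OF refl]) (simp only: below)
  finally show ?thesis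
    unfolding total_def by (simp only: nrows_def ncols_def mult.commute)
qed

lemma sum_layers_eq_below:
  fixes q :: "'a::field"
  assumes col: "\<And>p. p \<in> {1..<nlayers X} \<Longrightarrow> set (coloursI X I p) \<union> set (coloursII X I p) \<subseteq> {1..nlayers X + 1}"
    and "p < nlayers X" "w \<in> words (nlayers X + 1) (nrows X (Suc p))"
  shows "(\<Sum>t\<in>(\<Union>j\<in>{1..p}. layer_edges X j) \<rightarrow>\<^sub>E {1..nlayers X + 1}. of_bool (u_word X p t = w) *
          (\<Prod>j\<in>{1..p}. layer_term q X j (u_word X (j - 1) t) (tops X I j t) t))
       = below (nlayers X + 1) q X (coloursI X I) (coloursII X I) p (uvars X (Suc p)) w"
  using assms(2,3)
proof (induction p arbitrary: w)
  case 0
  then show ?case by (auto simp: u_word_def nrows_def)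
next
  case (Suc p)
  let ?n = "nlayers X + 1" and ?T = "coloursI X I (Suc p) @ w @ coloursII X I (Suc p)"
  let ?P = "\<lambda>t. \<Prod>j\<in>{1..p}. layer_term q X j (u_word X (j - 1) t) (tops X I j t) t"
  have T: "?T \<in> words ?n (ncols X (Suc p))"
    using Suc.prems col[of "Suc p"] by (auto simp: words_def ncols_lower)
  have step: "of_bool (u_word X (Suc p) t = w) * (\<Prod>j\<in>{1..Suc p}. layer_term q X j (u_word X (j - 1) t) (tops X I j t) t)
      = ?P t * layer_term q X (Suc p) (u_word X p t) ?T t" for t
  proof -
    \<comment> \<open>\<open>tops\<close> leaves the edges to the next layer free and
      \<open>u_word\<close> fixes exactly those, so the two indicators combine into one for the
      whole top word.\<close>
    have "row_word t (ncols X (Suc p)) (Suc p) 0 = tops X I (Suc p) t \<and> u_word X (Suc p) t = w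
        \<longleftrightarrow> row_word t (ncols X (Suc p)) (Suc p) 0 = ?T"
    proof
      assume "row_word t (ncols X (Suc p)) (Suc p) 0 = ?T"
      then have "u_word X (Suc p) t = w"
        unfolding row_word_0_lower[OF Suc.prems(1) nat.simps(3)]
        using Suc.prems(2) by (simp add: words_def del: upt_Suc)
      with \<open>row_word t (ncols X (Suc p)) (Suc p) 0 = ?T\<close>
      show "row_word t (ncols X (Suc p)) (Suc p) 0 = tops X I (Suc p) t \<and> u_word X (Suc p) t = w"
        using Suc.prems by (simp add: tops_def)
    qed (use Suc.prems in \<open>auto simp: tops_def\<close>)
    then have b: "of_bool (u_word X (Suc p) t = w) * of_bool (row_word t (ncols X (Suc p)) (Suc p) 0 = tops X I (Suc p) t)
        = (of_bool (row_word t (ncols X (Suc p)) (Suc p) 0 = ?T) :: 'a)"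
      by (simp only: of_bool_conj[symmetric] conj_commute)
    have "of_bool (u_word X (Suc p) t = w) * layer_term q X (Suc p) (u_word X p t) (tops X I (Suc p) t) t
       = layer_term q X (Suc p) (u_word X p t) ?T t"
      by (simp only: layer_term_def mult.assoc[symmetric] b)
    then show ?thesis
      by (simp add: mult_ac)
  qed
  show ?case
    unfolding step below_Suc_eq_total
    using sum_add_layer[of p X ?T q I "coloursI X I" "coloursII X I"] Suc T
    by (simp add: col_vars_def)
qed

lemma psi_eq_total:
  assumes M: "nlayers X \<ge> 1"
    and col: "\<And>p. p \<in> {1..<nlayers X} \<Longrightarrow> set (coloursI X I p) \<union> set (coloursII X I p) \<subseteq> {1..nlayers X + 1}"
    and colM: "set (coloursM X I) \<subseteq> {1..nlayers X + 1}"
  shows "psi q X I = total (nlayers X + 1) q X (coloursI X I) (coloursII X I) (nlayers X - 1) (nlayers X + 1)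
     (uvars X (nlayers X)) (vMvars X) (coloursM X I)"
proof -
  obtain p where p: "nlayers X = Suc p" using M by (cases "nlayers X") auto
  have T: "coloursM X I \<in> words (nlayers X + 1) (ncols X (Suc p))"
    using colM by (simp add: words_def ncols_top p[symmetric])
  have "psi q X I = (\<Sum>t\<in>(\<Union>j\<in>{1..Suc p}. layer_edges X j) \<rightarrow>\<^sub>E {1..nlayers X + 1}.
      (\<Prod>j\<in>{1..p}. layer_term q X j (u_word X (j - 1) t) (tops X I j t) t)
        * layer_term q X (Suc p) (u_word X p t) (coloursM X I) t)"
    unfolding psi_eq_sum_layers[OF M] by (simp add: p tops_def)
  also have "\<dots> = total (nlayers X + 1) q X (coloursI X I) (coloursII X I) p (p + 2) (uvars X (Suc p))
      (col_vars X (Suc p)) (coloursM X I)"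
    by (rule sum_add_layer[OF _ T sum_layers_eq_below[OF col]]) (use p in auto)
  finally show ?thesis
    by (simp add: p col_vars_def)
qed

section \<open>Colourings after removing coordinates\<close>

definition startI :: "'a vars \<Rightarrow> nat \<Rightarrow> nat" where
  "startI X p = (\<Sum>j=1..<p. length (vIvars X j))"

definition sumII :: "'a vars \<Rightarrow> nat \<Rightarrow> nat" where
  "sumII X p = (\<Sum>j=p..<nlayers X. length (vIIvars X j))"

lemma coord_simps:
  "coordI X p s = startI X p + s"
  "coordM X s = startI X (nlayers X) + s"
  "coordII X p s = LItotal X + sumII X (Suc p) + s"
  "LItotal X = startI X (nlayers X) + length (vMvars X)"
  by (simp_all add: coordI_def coordM_def coordII_def startI_def sumII_def LItotal_def)

lemma startI_Suc: "p \<ge> 1 \<Longrightarrow> startI X (Suc p) = startI X p + length (vIvars X p)"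
  by (simp add: startI_def)

lemma startI_mono: "p \<le> p' \<Longrightarrow> startI X p \<le> startI X p'"
  unfolding startI_def by (rule sum_mono2) auto

lemma sumII_top [simp]: "sumII X (nlayers X) = 0"
  by (simp add: sumII_def)

lemma sumII_step: "p < nlayers X \<Longrightarrow> sumII X p = length (vIIvars X p) + sumII X (Suc p)"
  by (simp add: sumII_def sum.atLeast_Suc_lessThan)

lemma image_add_interval: "(\<lambda>s. a + s) ` {1..n} = {a<..a + n :: nat}"
proof -
  have "x \<in> (\<lambda>s. a + s) ` {1..n}" if "x \<in> {a<..a + n}" for x
    by (rule image_eqI[of _ _ "x - a"]) (use that in auto)
  then show ?thesis by auto
qed

lemma layer_coords_top: "layer_coords X (nlayers X) = {startI X (nlayers X)<..LItotal X}"
  unfolding layer_coords_def coord_simps using image_add_interval by simp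

lemma layer_coords_lower:
  assumes "p \<in> {1..<nlayers X}"
  shows "layer_coords X p = {startI X p<..startI X (Suc p)} \<union> {LItotal X + sumII X (Suc p)<..LItotal X + sumII X p}"
proof -
  have eq: "LItotal X + sumII X (Suc p) + length (vIIvars X p) = LItotal X + sumII X p"
    using assms by (simp add: sumII_step)
  show ?thesis
    unfolding layer_coords_def coord_simps(1,3) image_add_interval eq using assms by (simp add: startI_Suc)
qed

text \<open>The lists \<open>v_I\<close> are ordered by increasing layer and the lists
  \<open>v_II\<close> by decreasing layer. So the layers are nested around \<open>v^(M)\<close>, and
  descending from M adds one adjacent block on each side.\<close>

lemma upper_coords_eq:
  assumes "1 \<le> j" "j \<le> nlayers X"
  shows "upper_coords X j = {startI X j<..LItotal X + sumII X j}"
  using assms(2,1)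
proof (induction j rule: inc_induct)
  case base
  then show ?case by (simp add: upper_coords_def layer_coords_top)
next
  case (step j)
  have "upper_coords X j = layer_coords X j \<union> upper_coords X (Suc j)"
  proof -
    have "{j..nlayers X} = insert j {Suc j..nlayers X}" using step by auto
    then show ?thesis by (simp add: upper_coords_def)
  qed
  also have "\<dots> = {startI X j<..startI X (Suc j)} \<union> {LItotal X + sumII X (Suc j)<..LItotal X + sumII X j}
      \<union> {startI X (Suc j)<..LItotal X + sumII X (Suc j)}"
    using step by (simp add: layer_coords_lower)
  also have "\<dots> = {startI X j<..LItotal X + sumII X j}"
  proof -
    have "startI X j \<le> startI X (Suc j)" "startI X (Suc j) \<le> startI X (nlayers X)" "sumII X (Suc j) \<le> sumII X j"
      using step by (auto intro: startI_mono simp: sumII_step)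
    then show ?thesis using coord_simps(4)[of X] by auto
  qed
  finally show ?case .
qed

lemma is_colouring_upper:
  assumes "is_colouring X i" "1 \<le> j" "c \<in> upper_coords X j"
  shows "i c \<in> {1..nlayers X + 1}"
proof -
  obtain p where p: "p \<in> {j..nlayers X}" "c \<in> layer_coords X p"
    using assms(3) by (auto simp: upper_coords_def)
  then have "i c \<in> {1..p + 1}" using assms by (auto simp: is_colouring_def)
  then show ?thesis using p by auto
qed

lemma colour_eq_upper:
  assumes "is_colouring X i" "\<And>j. j \<in> {1..nlayers X} \<Longrightarrow> I j = colour_set X i j" "1 \<le> j" "c \<in> upper_coords X j"
  shows "colour X I c = i c"
proof -
  obtain p where "p \<in> {j..nlayers X}" "c \<in> layer_coords X p"
    using assms(4) by (auto simp: upper_coords_def)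
  then show ?thesis using colour_eq[OF assms(1,2), of p c] assms(3) by auto
qed

lemma tilde_eq:
  assumes "is_colouring X i" "\<And>j. j \<in> {1..nlayers X} \<Longrightarrow> I j = colour_set X i j" "1 \<le> j"
  shows "tilde X I j = (\<lambda>c. card {c' \<in> upper_coords X j. i c' \<in> {1..j + 1} \<and> c' \<le> c}) ` I j"
proof -
  have "{c' \<in> upper_coords X j. colour X I c' \<in> {1..j + 1} \<and> c' \<le> c}
     = {c' \<in> upper_coords X j. i c' \<in> {1..j + 1} \<and> c' \<le> c}" for c
    using colour_eq_upper[OF assms] by auto
  then show ?thesis by (simp add: tilde_def)
qed

text \<open>These are the colours of \<open>coloursI\<close>, taken from a colouring instead of
  recovered from the tuple of sets. Coordinates appear as offset plus position, so that two systems
  of variables are compared through their offsets.\<close>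

definition word_I :: "'a vars \<Rightarrow> (nat \<Rightarrow> nat) \<Rightarrow> nat \<Rightarrow> nat list" where
  "word_I X i p = map (\<lambda>s. i (startI X p + s)) [1..<Suc (length (vIvars X p))]"

definition word_II :: "'a vars \<Rightarrow> (nat \<Rightarrow> nat) \<Rightarrow> nat \<Rightarrow> nat list" where
  "word_II X i p = map (\<lambda>s. i (LItotal X + sumII X (Suc p) + s)) [1..<Suc (length (vIIvars X p))]"

definition word_M :: "'a vars \<Rightarrow> (nat \<Rightarrow> nat) \<Rightarrow> nat list" where
  "word_M X i = map (\<lambda>s. i (startI X (nlayers X) + s)) [1..<Suc (length (vMvars X))]"

lemma length_words [simp]:
  "length (word_I X i p) = length (vIvars X p)"
  "length (word_II X i p) = length (vIIvars X p)"
  "length (word_M X i) = length (vMvars X)"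
  by (simp_all add: word_I_def word_II_def word_M_def del: upt_Suc)

lemma total_cong:
  assumes "\<And>j. j \<in> {1..p} \<Longrightarrow> uvars X j = uvars Y j \<and> vIvars X j = vIvars Y j \<and> vIIvars X j = vIIvars Y j
      \<and> CI j = CI' j \<and> CII j = CII' j"
  shows "total n q X CI CII p N us vs ts = total n q Y CI' CII' p N us vs ts"
proof -
  have "below n q X CI CII p us ks = below n q Y CI' CII' p us ks" for ks
    by (rule below_cong) (rule assms)
  then show ?thesis by (simp only: total_def)
qed

lemma word_M_range:
  assumes "is_colouring X i" "nlayers X \<ge> 1"
  shows "set (word_M X i) \<subseteq> {1..nlayers X + 1}"
proof -
  have "i (startI X (nlayers X) + s) \<in> {1..nlayers X + 1}" if "s \<in> {1..length (vMvars X)}" for s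
    by (rule is_colouring_upper[OF assms])
       (use that assms in \<open>auto simp: upper_coords_eq coord_simps(4)\<close>)
  then show ?thesis by (auto simp: word_M_def simp del: upt_Suc)
qed

lemma psi_eq_total_colouring:
  assumes M: "nlayers X \<ge> 1" and i: "is_colouring X i"
    and I: "\<And>j. j \<in> {1..nlayers X} \<Longrightarrow> I j = colour_set X i j"
  shows "psi q X I = total (nlayers X + 1) q X (word_I X i) (word_II X i) (nlayers X - 1) (nlayers X + 1)
     (uvars X (nlayers X)) (vMvars X) (word_M X i)"
proof -
  have col: "colour X I c = i c \<and> i c \<in> {1..nlayers X + 1}" if "p \<in> {1..nlayers X}" "c \<in> layer_coords X p" for p c
  proof
    show "colour X I c = i c" by (rule colour_eq[OF i I that])
    have "i c \<in> {1..p + 1}" using i that by (simp only: is_colouring_def)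
    then show "i c \<in> {1..nlayers X + 1}" using that by auto
  qed
  have 1: "coloursI X I p = word_I X i p" "set (word_I X i p) \<subseteq> {1..nlayers X + 1}" if p: "p \<in> {1..<nlayers X}" for p
  proof -
    have "coordI X p s \<in> layer_coords X p" if "s \<in> {1..length (vIvars X p)}" for s
      using that p by (auto simp: layer_coords_def)
    then have "colour X I (startI X p + s) = i (startI X p + s) \<and> i (startI X p + s) \<in> {1..nlayers X + 1}"
      if "s \<in> {1..length (vIvars X p)}" for s
      using that p col[of p] by (auto simp: coord_simps)
    then show "coloursI X I p = word_I X i p" "set (word_I X i p) \<subseteq> {1..nlayers X + 1}"
      unfolding coloursI_def word_I_def coord_simps by (auto simp del: upt_Suc)
  qed
  have 2: "coloursII X I p = word_II X i p" "set (word_II X i p) \<subseteq> {1..nlayers X + 1}" if p: "p \<in> {1..<nlayers X}" for p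
  proof -
    have "coordII X p s \<in> layer_coords X p" if "s \<in> {1..length (vIIvars X p)}" for s
      using that p by (auto simp: layer_coords_def)
    then have "colour X I (LItotal X + sumII X (Suc p) + s) = i (LItotal X + sumII X (Suc p) + s)
       \<and> i (LItotal X + sumII X (Suc p) + s) \<in> {1..nlayers X + 1}"
      if "s \<in> {1..length (vIIvars X p)}" for s
      using that p col[of p] unfolding coord_simps(3) by auto
    then show "coloursII X I p = word_II X i p" "set (word_II X i p) \<subseteq> {1..nlayers X + 1}"
      unfolding coloursII_def word_II_def coord_simps(3) by (auto simp del: upt_Suc)
  qed
  have 3: "coloursM X I = word_M X i"
  proof -
    have "coordM X s \<in> layer_coords X (nlayers X)" if "s \<in> {1..length (vMvars X)}" for s
      using that by (auto simp: layer_coords_def)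
    then have "colour X I (startI X (nlayers X) + s) = i (startI X (nlayers X) + s)" if "s \<in> {1..length (vMvars X)}" for s
      using that M col[of "nlayers X"] by (auto simp: coord_simps)
    then show ?thesis
      unfolding coloursM_def word_M_def coord_simps by (auto simp del: upt_Suc)
  qed
  have "psi q X I = total (nlayers X + 1) q X (coloursI X I) (coloursII X I) (nlayers X - 1) (nlayers X + 1)
     (uvars X (nlayers X)) (vMvars X) (word_M X i)"
    unfolding 3[symmetric]
  proof (rule psi_eq_total[OF M])
    show "set (coloursI X I p) \<union> set (coloursII X I p) \<subseteq> {1..nlayers X + 1}" if "p \<in> {1..<nlayers X}" for p
      using 1[OF that] 2[OF that] by simp
    show "set (coloursM X I) \<subseteq> {1..nlayers X + 1}"
      unfolding 3 by (rule word_M_range[OF i M])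
  qed
  also have "\<dots> = total (nlayers X + 1) q X (word_I X i) (word_II X i) (nlayers X - 1) (nlayers X + 1)
     (uvars X (nlayers X)) (vMvars X) (word_M X i)"
    by (rule total_cong) (use 1 2 in auto)
  finally show ?thesis .
qed

lemma word_M_snoc:
  assumes "vMvars X \<noteq> []"
  shows "word_M X i = map (\<lambda>s. i (startI X (nlayers X) + s)) [1..<length (vMvars X)] @ [i (LItotal X)]"
  using assms by (cases "length (vMvars X)") (auto simp: word_M_def coord_simps(4))

text \<open>It leads from the coordinates after a deletion to those before it and jumps over the
  \<open>d\<close> coordinates following \<open>A\<close>. Pulling a colouring back along it gives
  the colouring of the smaller system. Case B has \<open>A = LI - 1\<close> and
  \<open>d = 1\<close>; the initial condition has \<open>A = startI X M\<close> and
  \<open>d = length vM - 1\<close>.\<close>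

definition insert_gap :: "nat \<Rightarrow> nat \<Rightarrow> nat \<Rightarrow> nat" where
  "insert_gap A d c = (if c \<le> A then c else c + d)"

lemma insert_gap_le_iff [simp]: "insert_gap A d c \<le> insert_gap A d c' \<longleftrightarrow> c \<le> c'"
  by (auto simp: insert_gap_def)

lemma inj_insert_gap: "inj_on (insert_gap A d) S"
  by (auto simp: inj_on_def insert_gap_def split: if_splits)

lemma filter_interval_insert_gap:
  assumes "lo \<le> A" "A + d \<le> hi" "\<And>c. c \<in> {A<..A + d} \<Longrightarrow> \<not> P c"
  shows "{c \<in> {lo<..hi}. P c} = insert_gap A d ` {c \<in> {lo<..hi - d}. P (insert_gap A d c)}"
proof
  show "{c \<in> {lo<..hi}. P c} \<subseteq> insert_gap A d ` {c \<in> {lo<..hi - d}. P (insert_gap A d c)}"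
  proof
    fix c assume c: "c \<in> {c \<in> {lo<..hi}. P c}"
    show "c \<in> insert_gap A d ` {c \<in> {lo<..hi - d}. P (insert_gap A d c)}"
    proof (cases "c \<le> A")
      case True
      then show ?thesis using c assms by (intro image_eqI[of _ _ c]) (auto simp: insert_gap_def)
    next
      case False
      with c assms(3)[of c] have "c > A + d" by force
      then show ?thesis using c assms by (intro image_eqI[of _ _ "c - d"]) (auto simp: insert_gap_def)
    qed
  qed
qed (use assms in \<open>auto simp: insert_gap_def\<close>)

text \<open>A coordinate whose colour exceeds \<open>j\<close> does not lie in \<open>I^(j)\<close> and can be deleted.\<close>

lemma
  assumes j: "1 \<le> j" "j \<le> nlayers X" "j \<le> nlayers Y"
    and XY: "startI Y j = startI X j" "LItotal Y + sumII Y j = LItotal X + sumII X j - d"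
    and A: "startI X j \<le> A" "A + d \<le> LItotal X + sumII X j"
    and gap: "\<And>c. c \<in> {A<..A + d} \<Longrightarrow> i c > j"
  shows colour_set_insert_gap: "colour_set X i j = insert_gap A d ` colour_set Y (i \<circ> insert_gap A d) j"
    and card_colour_set_insert_gap: "card (colour_set Y (i \<circ> insert_gap A d) j) = card (colour_set X i j)"
proof -
  have "{c \<in> {startI X j<..LItotal X + sumII X j}. i c \<in> {1..j}}
     = insert_gap A d ` {c \<in> {startI X j<..LItotal X + sumII X j - d}. i (insert_gap A d c) \<in> {1..j}}"
    by (rule filter_interval_insert_gap[OF A]) (use gap in force)
  then show *: "colour_set X i j = insert_gap A d ` colour_set Y (i \<circ> insert_gap A d) j"
    unfolding colour_set_def upper_coords_eq[OF j(1,2)] upper_coords_eq[OF j(1,3)] XY by simp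
  show "card (colour_set Y (i \<circ> insert_gap A d) j) = card (colour_set X i j)"
    unfolding * by (simp add: card_image inj_insert_gap)
qed

text \<open>Ranks are taken among the coordinates of colour at most \<open>j + 1\<close>. A deletion
  preserves them if the deleted colours exceed \<open>j + 1\<close>, a stronger demand than for the
  sets themselves, because \<open>insert_gap\<close> preserves the order.\<close>

lemma tilde_insert_gap:
  assumes j: "1 \<le> j" "j \<le> nlayers X" "j \<le> nlayers Y"
    and XY: "startI Y j = startI X j" "LItotal Y + sumII Y j = LItotal X + sumII X j - d"
    and A: "startI X j \<le> A" "A + d \<le> LItotal X + sumII X j"
    and gap: "\<And>c. c \<in> {A<..A + d} \<Longrightarrow> i c > j + 1"
    and i: "is_colouring X i" and I: "\<And>j. j \<in> {1..nlayers X} \<Longrightarrow> I j = colour_set X i j"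
  shows "tilde X I j = (\<lambda>c. card {c' \<in> upper_coords Y j. i (insert_gap A d c') \<in> {1..j + 1} \<and> c' \<le> c}) `
     colour_set Y (i \<circ> insert_gap A d) j"
proof -
  have "card {c' \<in> upper_coords X j. i c' \<in> {1..j + 1} \<and> c' \<le> insert_gap A d c}
      = card {c' \<in> upper_coords Y j. i (insert_gap A d c') \<in> {1..j + 1} \<and> c' \<le> c}" for c
  proof -
    have "{c' \<in> {startI X j<..LItotal X + sumII X j}. i c' \<in> {1..j + 1} \<and> c' \<le> insert_gap A d c}
      = insert_gap A d ` {c' \<in> {startI X j<..LItotal X + sumII X j - d}.
           i (insert_gap A d c') \<in> {1..j + 1} \<and> insert_gap A d c' \<le> insert_gap A d c}"
      by (rule filter_interval_insert_gap[OF A]) (use gap in force)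
    then show ?thesis
      unfolding upper_coords_eq[OF j(1,2)] upper_coords_eq[OF j(1,3)] XY by (simp add: card_image inj_insert_gap)
  qed
  moreover have "I j = insert_gap A d ` colour_set Y (i \<circ> insert_gap A d) j"
    using I[of j] j colour_set_insert_gap[OF j XY A, of i] gap by force
  moreover have "tilde X I j = (\<lambda>c. card {c' \<in> upper_coords X j. i c' \<in> {1..j + 1} \<and> c' \<le> c}) ` I j"
    by (rule tilde_eq[OF i]) (use I j in auto)
  ultimately show ?thesis
    by (simp only: image_image)
qed

section \<open>The five properties\<close>

text \<open>Admissibility only asserts that some colouring exists. Fixing one lets boundary words,
  sets and ranks be computed from \<open>i\<close> rather than from the colour recovered out of
  \<open>I\<close>.\<close>

locale coloured =
  fixes X :: "'a::field_char_0 vars" and I :: "nat \<Rightarrow> nat set" and i :: "nat \<Rightarrow> nat"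
  assumes layers: "nlayers X \<ge> 1"
    and colouring: "is_colouring X i"
    and sets: "\<And>j. j \<in> {1..nlayers X} \<Longrightarrow> I j = colour_set X i j"
    and cards: "\<And>j. j \<in> {1..nlayers X} \<Longrightarrow> card (I j) = length (uvars X j)"
    and top_nonempty: "vMvars X \<noteq> []"
begin

abbreviation "M \<equiv> nlayers X"
abbreviation "uM \<equiv> uvars X M"
abbreviation "vM \<equiv> vMvars X"
abbreviation "LI \<equiv> LItotal X"

definition "word_rest = map (\<lambda>s. i (startI X M + s)) [1..<length vM]"

lemma word_M_eq: "word_M X i = word_rest @ [i LI]"
  unfolding word_rest_def by (rule word_M_snoc[OF top_nonempty])

lemma length_word_rest [simp]: "length word_rest = length vM - 1"
  by (simp add: word_rest_def)

lemma word_rest_range: "set word_rest \<subseteq> {1..M + 1}" and colour_LI_range: "i LI \<in> {1..M + 1}"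
  using word_M_range[OF colouring layers] unfolding word_M_eq by auto

lemma LI_eq: "LI = startI X M + length vM"
  by (simp add: coord_simps)

lemma vM_split: "vM = butlast vM @ [last vM]"
  using top_nonempty by simp

lemma length_vM: "length vM \<ge> 1"
  using top_nonempty by (cases vM) auto

lemma LI_layer: "LI \<in> layer_coords X M"
  using top_nonempty unfolding layer_coords_top LI_eq by simp

lemma colour_LI: "colour X I LI = i LI"
  by (rule colour_eq[OF colouring sets]) (use LI_layer layers in auto)

lemma layer_coords_same_shape:
  assumes "nlayers Y = nlayers X" "\<And>p. length (vIvars Y p) = length (vIvars X p)"
    "\<And>p. length (vIIvars Y p) = length (vIIvars X p)" "length (vMvars Y) = length vM"
  shows "layer_coords Y = layer_coords X" "word_I Y i = word_I X i" "word_II Y i = word_II X i" "word_M Y i = word_M X i"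
proof -
  have s: "startI Y = startI X" "sumII Y = sumII X" "LItotal Y = LItotal X"
    using assms by (simp_all add: fun_eq_iff startI_def sumII_def LItotal_def)
  show "layer_coords Y = layer_coords X"
    unfolding layer_coords_def fun_eq_iff coord_simps s assms by simp
  show "word_I Y i = word_I X i" "word_II Y i = word_II X i" "word_M Y i = word_M X i"
    unfolding word_I_def word_II_def word_M_def fun_eq_iff s assms by simp_all
qed

text \<open>Coordinates depend only on the lengths of the lists. Replacing the last column variable
  or permuting \<open>u^(M)\<close> therefore changes neither the colouring nor any boundary
  word.\<close>

lemma psi_same_shape:
  assumes "nlayers Y = nlayers X" "vIvars Y = vIvars X" "vIIvars Y = vIIvars X" "length (vMvars Y) = length vM"
    and "\<And>p. p < M \<Longrightarrow> uvars Y p = uvars X p"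
  shows "psi q Y I = total (M + 1) q X (word_I X i) (word_II X i) (M - 1) (M + 1) (uvars Y M) (vMvars Y) (word_M X i)"
proof -
  note shape = layer_coords_same_shape[OF assms(1) _ _ assms(4), unfolded assms(2,3), OF refl refl]
  have "is_colouring Y i"
    using colouring unfolding is_colouring_def shape assms(1) .
  moreover have "colour_set Y i j = colour_set X i j" for j
    unfolding colour_set_def upper_coords_def shape assms(1) ..
  ultimately have "psi q Y I = total (M + 1) q Y (word_I X i) (word_II X i) (M - 1) (M + 1) (uvars Y M) (vMvars Y) (word_M X i)"
    using psi_eq_total_colouring[of Y i I q] layers sets shape assms(1) by simp
  also have "\<dots> = total (M + 1) q X (word_I X i) (word_II X i) (M - 1) (M + 1) (uvars Y M) (vMvars Y) (word_M X i)"
    by (rule total_cong) (use assms in auto)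
  finally show ?thesis .
qed

lemma psi_update_last:
  "psi q (X\<lparr>vMvars := vM[length vM - 1 := x]\<rparr>) I
     = total (M + 1) q X (word_I X i) (word_II X i) (M - 1) (M + 1) uM (butlast vM @ [x]) (word_rest @ [i LI])"
proof -
  have "vM[length vM - 1 := x] = butlast vM @ [x]"
    by (subst (1) vM_split) (simp add: list_update_append)
  then show ?thesis
    using psi_same_shape[of "X\<lparr>vMvars := vM[length vM - 1 := x]\<rparr>" q] length_vM by (simp add: word_M_eq)
qed

lemma psi_eq:
  "psi q X I = total (M + 1) q X (word_I X i) (word_II X i) (M - 1) (M + 1) uM (butlast vM @ [last vM]) (word_rest @ [i LI])"
  using psi_same_shape[of X q] word_M_eq vM_split by simp

lemma psi_polynomial:
  assumes "i LI \<noteq> M + 1"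
  shows "\<exists>P. degree P \<le> length uM - 1 \<and> (\<forall>x. psi q (X\<lparr>vMvars := vM[length vM - 1 := x]\<rparr>) I = poly P x)"
proof -
  have "i LI \<in> {1..M + 1}" "i LI < M + 1"
    using colour_LI_range assms by auto
  then show ?thesis
    unfolding psi_update_last
    using poly_le_total[of "M + 1" "M + 1" "i LI" word_rest "butlast vM" uM q X "word_I X i" "word_II X i" "M - 1"]
    by (simp add: poly_le_def)
qed

lemma psi_symmetric:
  assumes "\<pi> permutes {..<length uM}"
  shows "psi q (X\<lparr>uvars := (uvars X)(M := permute_list \<pi> uM)\<rparr>) I = psi q X I"
proof -
  let ?f = "\<lambda>us. total (M + 1) q X (word_I X i) (word_II X i) (M - 1) (M + 1) us vM (word_M X i)"
  have "?f (permute_list \<pi> uM) = ?f uM"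
  \<comment> \<open>Only the multiset of the permuted list matters, which reduces an arbitrary
    permutation to exchanges of neighbours.\<close>
  proof (rule mset_invariant_if_adjacent_swap)
    show "mset (permute_list \<pi> uM) = mset uM" using assms by simp
    show "?f (A @ x # y # B) = ?f (A @ y # x # B)" for A x y B
      by (rule total_adjacent_swap) (use layers word_M_range[OF colouring layers] in auto)
  qed
  then show ?thesis
    using psi_same_shape[of X q] psi_same_shape[of "X\<lparr>uvars := (uvars X)(M := permute_list \<pi> uM)\<rparr>" q] by simp
qed

lemma prod_list_eq_prod: "prod_list (map f xs) = (\<Prod>j<length xs. f (xs ! j))" for f :: "'b \<Rightarrow> 'c::comm_monoid_mult"
  by (simp add: prod.list_conv_set_nth lessThan_atLeast0)

lemma top_edge_coords:
  assumes "p \<in> {1..<M}" "s \<in> {1..length (vIvars X p)}"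
  shows "startI X p + s \<le> startI X M"
  using startI_mono[of "Suc p" M X] startI_Suc[of p X] assms by simp

end

lemma psi_eq_total_insert_gap:
  assumes Y: "nlayers Y \<ge> 1" "is_colouring Y (i \<circ> insert_gap A d)" "\<And>j. j \<in> {1..nlayers Y} \<Longrightarrow> J j = colour_set Y (i \<circ> insert_gap A d) j"
    and CI: "\<And>p. p \<in> {1..<nlayers Y} \<Longrightarrow> word_I Y (i \<circ> insert_gap A d) p = CI p"
    and CII: "\<And>p. p \<in> {1..<nlayers Y} \<Longrightarrow> word_II Y (i \<circ> insert_gap A d) p = CII p"
    and CM: "word_M Y (i \<circ> insert_gap A d) = CM"
    and X: "\<And>p. p \<in> {1..<nlayers Y} \<Longrightarrow> uvars Y p = uvars X p \<and> vIvars Y p = vIvars X p \<and> vIIvars Y p = vIIvars X p"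
  shows "psi q Y J = total (nlayers Y + 1) q X CI CII (nlayers Y - 1) (nlayers Y + 1) (uvars Y (nlayers Y)) (vMvars Y) CM"
proof -
  have "psi q Y J = total (nlayers Y + 1) q Y (word_I Y (i \<circ> insert_gap A d)) (word_II Y (i \<circ> insert_gap A d)) (nlayers Y - 1) (nlayers Y + 1)
     (uvars Y (nlayers Y)) (vMvars Y) CM"
    using psi_eq_total_colouring[OF Y] CM by simp
  also have "\<dots> = total (nlayers Y + 1) q X CI CII (nlayers Y - 1) (nlayers Y + 1) (uvars Y (nlayers Y)) (vMvars Y) CM"
    by (rule total_cong) (use CI CII X in auto)
  finally show ?thesis .
qed

context coloured begin

text \<open>The deleted coordinate \<open>LI\<close> has colour \<open>M + 1\<close> and lies in
  none of the sets; later coordinates move down by one. On the side of the weights, the last column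
  is frozen.\<close>

lemma case_B:
  fixes q :: 'a
  assumes top: "i LI = M + 1"
  defines "Y \<equiv> X\<lparr>vMvars := butlast vM\<rparr>"
    and "J \<equiv> (\<lambda>i. if i = M then I M else {j \<in> I i. j \<le> LI} \<union> {j - 1 | j. j \<in> I i \<and> j > LI})"
  shows "admissible Y J" "\<forall>i\<in>{1..M - 1}. tilde Y J i = tilde X I i"
    "psi q X I = (\<Prod>j<length uM. uM ! j - q * last vM) * psi q Y J"
proof -
  let ?A = "LI - 1" and ?k = "i \<circ> insert_gap (LI - 1) 1"
  have LIpos: "startI X M < LI" using top_nonempty by (simp add: LI_eq)
  have Y: "nlayers Y = M" "uvars Y = uvars X" "vIvars Y = vIvars X" "vIIvars Y = vIIvars X" "vMvars Y = butlast vM"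
    by (simp_all add: Y_def)
  have start: "startI Y = startI X" "sumII Y = sumII X" "LItotal Y = LI - 1"
    using length_vM by (simp_all add: fun_eq_iff startI_def sumII_def LItotal_def Y)
  have gap: "c \<in> {?A<..?A + 1} \<Longrightarrow> i c > M" for c
    using top LIpos by (cases "c = LI") auto
  have bounds: "startI X j \<le> ?A" "?A + 1 \<le> LI + sumII X j" if "j \<in> {1..M}" for j
    using that LIpos startI_mono[of j M X] by auto
  have cs: "colour_set X i j = insert_gap ?A 1 ` colour_set Y ?k j" "card (colour_set Y ?k j) = card (colour_set X i j)"
    if j: "j \<in> {1..M}" for j
  proof -
    have 1: "1 \<le> j" "j \<le> M" "j \<le> nlayers Y" "startI Y j = startI X j"
      "LItotal Y + sumII Y j = LI + sumII X j - 1"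
      using j LIpos by (auto simp: Y start)
    show "colour_set X i j = insert_gap ?A 1 ` colour_set Y ?k j"
      by (rule colour_set_insert_gap[OF 1 bounds[OF j]]) (use gap j in force)
    show "card (colour_set Y ?k j) = card (colour_set X i j)"
      by (rule card_colour_set_insert_gap[OF 1 bounds[OF j]]) (use gap j in force)
  qed
  have J: "J j = colour_set Y ?k j" if j: "j \<in> {1..M}" for j
  proof (cases "j = M")
    case True
    \<comment> \<open>After the deletion all coordinates of layer \<open>M\<close> lie before the
      gap, so the top set is not renumbered.\<close>
    have "insert_gap ?A 1 c = c" if "c \<in> colour_set Y ?k M" for c
      using that layers by (auto simp: colour_set_def upper_coords_eq Y(1) start insert_gap_def)
    then show ?thesis
      using cs(1)[OF j] sets[OF j] True by (simp add: J_def)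
  next
    case False
    \<comment> \<open>The image omits \<open>LI\<close>, so the bound \<open>\<le> LI\<close> in the
      statement and the bound \<open>\<le> LI - 1\<close> of the gap select the same
      elements.\<close>
    have "J j = {x \<in> insert_gap ?A 1 ` colour_set Y ?k j. x \<le> LI} \<union> {x - 1 | x. x \<in> insert_gap ?A 1 ` colour_set Y ?k j \<and> x > LI}"
      using False sets[OF j] cs(1)[OF j] by (simp add: J_def)
    also have "\<dots> = colour_set Y ?k j"
    proof (rule set_eqI, rule iffI)
      fix c assume c: "c \<in> colour_set Y ?k j"
      show "c \<in> {x \<in> insert_gap ?A 1 ` colour_set Y ?k j. x \<le> LI} \<union> {x - 1 | x. x \<in> insert_gap ?A 1 ` colour_set Y ?k j \<and> x > LI}"
      proof (cases "c \<le> ?A")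
        case True
        then have "insert_gap ?A 1 c = c" by (simp add: insert_gap_def)
        then show ?thesis using c True LIpos by (intro UnI1) (auto intro!: image_eqI[of _ _ c])
      next
        case False
        then have "insert_gap ?A 1 c = c + 1" "c = c + 1 - 1" "c + 1 > LI"
          by (auto simp: insert_gap_def)
        then show ?thesis using c by (intro UnI2 CollectI exI[of _ "c + 1"]) (auto intro!: image_eqI[of _ _ c])
      qed
    qed (use LIpos in \<open>auto simp: insert_gap_def split: if_splits\<close>)
    finally show ?thesis .
  qed
  have col: "is_colouring Y ?k"
    unfolding is_colouring_def
  proof (intro ballI)
    fix p c assume p: "p \<in> {1..nlayers Y}" and c: "c \<in> layer_coords Y p"
    have "insert_gap ?A 1 c \<in> layer_coords X p"
    proof (cases "p = M")
      case True
      then show ?thesis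
        using c layer_coords_top[of X] layer_coords_top[of Y] by (auto simp: Y start insert_gap_def)
    next
      case False
      then have p': "p \<in> {1..<nlayers X}" "p \<in> {1..<nlayers Y}" using p Y by auto
      have "startI X (Suc p) \<le> startI X M" by (rule startI_mono) (use p' in auto)
      then show ?thesis
        using c LIpos unfolding layer_coords_lower[OF p'(1)] layer_coords_lower[OF p'(2)] start
        by (auto simp: insert_gap_def)
    qed
    then show "?k c \<in> {1..p + 1}"
      using colouring p Y unfolding is_colouring_def by (metis comp_apply)
  qed
  show "admissible Y J"
    unfolding admissible_def
    using col J cs(2) sets cards by (intro exI[of _ ?k]) (auto simp: Y)
  show "\<forall>j\<in>{1..M - 1}. tilde Y J j = tilde X I j"
  proof
    fix j assume "j \<in> {1..M - 1}"
    \<comment> \<open>The bound \<open>j + 1 \<le> M\<close> makes the deleted colour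
      \<open>M + 1\<close> exceed \<open>j + 1\<close>, as the comparison of ranks requires.\<close>
    then have j: "j \<in> {1..M}" "j + 1 \<le> M" by auto
    have 1: "1 \<le> j" "j \<le> M" "j \<le> nlayers Y" "startI Y j = startI X j"
      "LItotal Y + sumII Y j = LI + sumII X j - 1"
      using j LIpos by (auto simp: Y start)
    have "tilde X I j = (\<lambda>c. card {c' \<in> upper_coords Y j. i (insert_gap ?A 1 c') \<in> {1..j + 1} \<and> c' \<le> c}) ` colour_set Y ?k j"
      by (rule tilde_insert_gap[OF 1 bounds[OF j(1)] _ colouring sets]) (use gap j in force)+
    moreover have "tilde Y J j = (\<lambda>c. card {c' \<in> upper_coords Y j. ?k c' \<in> {1..j + 1} \<and> c' \<le> c}) ` J j"
      by (rule tilde_eq[OF col]) (use J j Y in auto)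
    ultimately show "tilde Y J j = tilde X I j"
      using J[OF j(1)] by simp
  qed
  have wI: "word_I Y ?k p = word_I X i p" if "p \<in> {1..<nlayers Y}" for p
    unfolding word_I_def start Y using top_edge_coords[of p] that LIpos Y
    by (intro map_cong refl) (fastforce simp: insert_gap_def simp del: upt_Suc)
  have wII: "word_II Y ?k p = word_II X i p" if "p \<in> {1..<nlayers Y}" for p
    unfolding word_II_def start Y using LIpos
    by (intro map_cong refl) (auto simp: insert_gap_def simp del: upt_Suc)
  have wM: "word_M Y ?k = word_rest"
    unfolding word_M_def word_rest_def start Y using top_nonempty
    by (auto simp: insert_gap_def LI_eq simp del: upt_Suc)
  have "psi q Y J = total (M + 1) q X (word_I X i) (word_II X i) (M - 1) (M + 1) uM (butlast vM) word_rest"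
    using psi_eq_total_insert_gap[of Y i ?A 1 J "word_I X i" "word_II X i" word_rest X q] layers col J wI wII wM
    by (simp add: Y)
  then show "psi q X I = (\<Prod>j<length uM. uM ! j - q * last vM) * psi q Y J"
    unfolding psi_eq top using total_snoc_same[of "M + 1" "M + 1" word_rest "butlast vM" q X "word_I X i" "word_II X i" "M - 1" uM "last vM"]
    by (simp add: prod_list_eq_prod)
qed

text \<open>\<open>v^(M)\<close> loses its last entry and \<open>v_II^(M-1)\<close> gains a first
  one, so all coordinates keep their numbers and \<open>i\<close> itself is a colouring of
  \<open>Y\<close>. The coordinate \<open>LI\<close> may join layer \<open>M - 1\<close> because its
  colour is at most \<open>M\<close>.\<close>

lemma case_A:
  fixes q :: 'a
  assumes q: "q \<noteq> 0" and M2: "M \<ge> 2" and not_top: "i LI \<noteq> M + 1"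
  defines "Y \<equiv> X\<lparr>uvars := (uvars X)(M := butlast uM), vIIvars := (vIIvars X)(M - 1 := last uM # vIIvars X (M - 1)),
                vMvars := butlast vM\<rparr>"
    and "J \<equiv> (\<lambda>i. if i = M then I M - {LI} else I i)"
  shows "admissible Y J" "\<forall>i\<in>{1..M - 1}. tilde Y J i = tilde X I i"
    "psi q (X\<lparr>vMvars := vM[length vM - 1 := inverse q * last uM]\<rparr>) I
       = (1 - q) * last uM * (\<Prod>j<length vM - 1. last uM - vM ! j)
           * (\<Prod>j<length uM - 1. q * uM ! j - last uM) * psi q Y J"
proof -
  obtain m where m: "M = Suc m" "m \<ge> 1" using M2 by (cases M) auto
  have LIpos: "startI X M < LI" using top_nonempty by (simp add: LI_eq)
  have colLI: "i LI \<in> {1..M}" using colour_LI_range not_top by auto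
  have Y: "nlayers Y = M" "uvars Y M = butlast uM" "\<And>p. p \<noteq> M \<Longrightarrow> uvars Y p = uvars X p"
    "vIvars Y = vIvars X" "vIIvars Y m = last uM # vIIvars X m" "\<And>p. p \<noteq> m \<Longrightarrow> vIIvars Y p = vIIvars X p"
    "vMvars Y = butlast vM"
    by (simp_all add: Y_def m)
  have start: "startI Y = startI X" "LItotal Y = LI - 1"
    using length_vM by (simp_all add: fun_eq_iff startI_def LItotal_def Y)
  \<comment> \<open>The extra entry compensates for the smaller \<open>LItotal\<close>: for the
    layers below \<open>M\<close> the sum of \<open>LItotal\<close> and \<open>sumII\<close> does
    not change.\<close>
  have sumII: "sumII Y p = sumII X p + 1" if "p \<le> m" for p
  proof -
    have "(\<Sum>j=p..<m. length (vIIvars Y j)) = (\<Sum>j=p..<m. length (vIIvars X j))"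
      by (rule sum.cong) (auto simp: Y)
    then show ?thesis using that by (simp add: sumII_def Y(1) m(1) Y(5))
  qed
  have sumII_M: "sumII Y M = 0" using sumII_top[of Y] Y by simp
  have upper: "upper_coords Y j = upper_coords X j" if "j \<in> {1..m}" for j
    using that sumII[of j] LIpos by (simp add: upper_coords_eq Y(1) start m)
  have upper_M: "upper_coords Y M = upper_coords X M - {LI}"
    using layers sumII_M sumII_top[of X] by (auto simp: upper_coords_eq Y(1) start)
  have LI_upper: "LI \<in> upper_coords X M"
    using layers LIpos by (simp add: upper_coords_eq)
  have J: "J j = colour_set Y i j" if j: "j \<in> {1..M}" for j
  proof (cases "j = M")
    case True
    then show ?thesis using sets[OF j] by (auto simp: J_def colour_set_def upper_M)
  next
    case False
    then show ?thesis using sets[OF j] upper[of j] j m by (simp add: J_def colour_set_def)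
  qed
  have cardJ: "card (J j) = length (uvars Y j)" if j: "j \<in> {1..M}" for j
  proof (cases "j = M")
    case True
    have "LI \<in> I M" using sets[OF j] True LI_upper colLI by (simp add: colour_set_def)
    then show ?thesis using True cards[OF j] by (simp add: J_def Y)
  qed (use cards[OF j] in \<open>simp add: J_def Y\<close>)
  have col: "is_colouring Y i"
    unfolding is_colouring_def
  proof (intro ballI)
    fix p c assume p: "p \<in> {1..nlayers Y}" and c: "c \<in> layer_coords Y p"
    have "c \<in> layer_coords X p \<or> p = m \<and> c = LI"
    proof (cases "p = M")
      case True
      then show ?thesis
        using c layer_coords_top[of X] layer_coords_top[of Y] by (auto simp: Y start)
    next
      case False
      then have p': "p \<in> {1..<nlayers X}" "p \<in> {1..<nlayers Y}" using p Y by auto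
      have "sumII Y (Suc p) = sumII X (Suc p) + 1 \<or> p = m \<and> sumII Y (Suc p) = 0"
        using sumII[of "Suc p"] sumII_M p' m by (cases "p = m") auto
      then show ?thesis
        using c LIpos sumII[of p] p' m sumII_top[of X]
        unfolding layer_coords_lower[OF p'(1)] layer_coords_lower[OF p'(2)] start
        by auto
    qed
    then show "i c \<in> {1..p + 1}"
      using colouring p Y colLI m unfolding is_colouring_def by auto
  qed
  show "admissible Y J"
    unfolding admissible_def using col J cardJ by (intro exI[of _ i]) (auto simp: Y)
  show "\<forall>j\<in>{1..M - 1}. tilde Y J j = tilde X I j"
  proof
    fix j assume j: "j \<in> {1..M - 1}"
    have "tilde X I j = (\<lambda>c. card {c' \<in> upper_coords X j. i c' \<in> {1..j + 1} \<and> c' \<le> c}) ` I j"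
      by (rule tilde_eq[OF colouring sets]) (use j in auto)
    moreover have "tilde Y J j = (\<lambda>c. card {c' \<in> upper_coords Y j. i c' \<in> {1..j + 1} \<and> c' \<le> c}) ` J j"
      by (rule tilde_eq[OF col]) (use J j Y in auto)
    ultimately show "tilde Y J j = tilde X I j"
      using upper[of j] j m by (simp add: J_def)
  qed
  \<comment> \<open>The set \<open>I M\<close> contains \<open>LI\<close>, so there is a last row to
    remove.\<close>
  have "uM \<noteq> []"
  proof -
    have "LI \<in> I M" using sets[of M] layers LI_upper colLI by (simp add: colour_set_def)
    moreover have "finite (I M)" using sets[of M] layers by (simp add: colour_set_def upper_coords_eq)
    ultimately show ?thesis using cards[of M] layers by (auto simp: card_eq_0_iff)
  qed
  then have us: "uM = butlast uM @ [last uM]" by simp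
  let ?u = "last uM" and ?us = "butlast uM" and ?vs = "butlast vM" and ?n = "M + 1" and ?a = "i LI"
  have M_diff: "M - 1 = m" using m by simp
  have wI: "word_I Y i = word_I X i"
    by (simp add: fun_eq_iff word_I_def start Y)
  have wII: "word_II Y i p = word_II X i p" if "p \<in> {1..<m}" for p
    using that sumII[of "Suc p"] LIpos Y(6)[of p] by (simp add: word_II_def start)
  \<comment> \<open>The new first entry of \<open>v_II^(M-1)\<close> has the coordinate
    \<open>LItotal Y + 1 = LI\<close>.\<close>
  have wIIm: "word_II Y i m = ?a # word_II X i m"
  proof -
    have "word_II Y i m = map (\<lambda>s. i (LI - 1 + s)) [1..<Suc (1 + length (vIIvars X m))]"
      using sumII_M by (simp add: word_II_def start Y(5) m(1) del: upt_Suc)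
    also have "\<dots> = ?a # word_II X i m"
      unfolding map_upt_add word_II_def using LIpos sumII_top[of X] by (simp add: m(1) del: upt_Suc) simp
    finally show ?thesis .
  qed
  have wM: "word_M Y i = word_rest"
    unfolding word_M_def word_rest_def start Y using top_nonempty by (simp del: upt_Suc)
  \<comment> \<open>Both sides are the same layer \<open>m\<close> with its columns grouped
    differently: \<open>u\<close> closes the block of \<open>u\<close>-columns on the left-hand side
    and opens \<open>v_II\<close> on the right-hand side, and \<open>a\<close> moves along with
    it.\<close>
  have below_eq: "below ?n q X (word_I X i) (word_II X i) m (?us @ [?u]) (ks @ [?a])
      = below ?n q Y (word_I Y i) (word_II Y i) m ?us ks" for ks
  proof -
    obtain m' where m': "m = Suc m'" using m(2) by (cases m) auto
    have "below ?n q X (word_I X i) (word_II X i) m (?us @ [?u]) (ks @ [?a])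
       = total ?n q X (word_I X i) (word_II X i) m' (m' + 2) (uvars X m) (vIvars X m @ ?us @ ?u # vIIvars X m)
           (word_I X i m @ ks @ ?a # word_II X i m)"
      unfolding m' below_Suc_eq_total by simp
    also have "\<dots> = total ?n q Y (word_I Y i) (word_II Y i) m' (m' + 2) (uvars X m) (vIvars X m @ ?us @ ?u # vIIvars X m)
           (word_I X i m @ ks @ ?a # word_II X i m)"
      by (rule total_cong) (use Y wI wII m m' in auto)
    also have "\<dots> = below ?n q Y (word_I Y i) (word_II Y i) m ?us ks"
      unfolding m' below_Suc_eq_total using Y(3)[of m] Y(4,5) wI wIIm m by (simp add: m')
    finally show ?thesis .
  qed
  have "psi q Y J = total ?n q Y (word_I Y i) (word_II Y i) m ?n ?us ?vs word_rest"
    using psi_eq_total_colouring[of Y i J q, unfolded Y(1) Y(2) Y(7) wM, OF layers col J] by (simp only: M_diff)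
  moreover have "psi q (X\<lparr>vMvars := vM[length vM - 1 := inverse q * ?u]\<rparr>) I
     = prod_list (map (\<lambda>x. q * (x - inverse q * ?u)) ?us) * ((1 - q) * ?u) * prod_list (map (\<lambda>v. ?u - v) ?vs) *
       total ?n q Y (word_I Y i) (word_II Y i) m ?n ?us ?vs word_rest"
  proof -
    have "?n \<in> {1..?n}" "?a \<in> {1..?n}" "?a < ?n" "length word_rest = length ?vs" "set word_rest \<subseteq> {1..?n}"
      "?u = q * (inverse q * ?u)"
      using colLI q word_rest_range by auto
    from total_snoc_special[OF this, of X "word_I X i" "word_II X i" m ?us]
    have "total ?n q X (word_I X i) (word_II X i) m ?n uM (?vs @ [inverse q * ?u]) (word_rest @ [?a])
       = prod_list (map (\<lambda>x. q * (x - inverse q * ?u)) ?us) * ((1 - q) * ?u) * prod_list (map (\<lambda>v. ?u - v) ?vs) *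
         total ?n q Y (word_I Y i) (word_II Y i) m ?n ?us ?vs word_rest"
      unfolding below_eq total_def[of ?n q Y] unfolding us[symmetric] .
    then show ?thesis
      unfolding psi_update_last M_diff .
  qed
  \<comment> \<open>The prefactor \<open>q\<close> of a straight vertex clears the denominator of
    the special value.\<close>
  moreover have "prod_list (map (\<lambda>x. q * (x - inverse q * ?u)) ?us) = (\<Prod>j<length uM - 1. q * uM ! j - ?u)"
    using q by (simp add: prod_list_eq_prod nth_butlast right_diff_distrib mult.assoc[symmetric])
  moreover have "prod_list (map (\<lambda>v. ?u - v) ?vs) = (\<Prod>j<length vM - 1. ?u - vM ! j)"
    by (simp add: prod_list_eq_prod nth_butlast)
  ultimately show "psi q (X\<lparr>vMvars := vM[length vM - 1 := inverse q * last uM]\<rparr>) I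
       = (1 - q) * last uM * (\<Prod>j<length vM - 1. last uM - vM ! j)
           * (\<Prod>j<length uM - 1. q * uM ! j - last uM) * psi q Y J"
    by (simp only: mult_ac)
qed

text \<open>With one row, \<open>I^(M)\<close> is just \<open>{LI}\<close>: the other coordinates of
  layer \<open>M\<close> have colour \<open>M + 1\<close> and are deleted. \<open>LI\<close> remains
  between the coordinates of \<open>v_I^(M-1)\<close> and \<open>v_II^(M-1)\<close>, exactly where
  the new top list carries \<open>u\<close>.\<close>

lemma initial_condition:
  fixes q :: 'a
  assumes M2: "M \<ge> 2" and single: "length uM = 1" and not_top: "i LI \<noteq> M + 1"
  defines "Y \<equiv> X\<lparr>nlayers := M - 1, vMvars := vIvars X (M - 1) @ [hd uM] @ vIIvars X (M - 1)\<rparr>"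
    and "J \<equiv> (\<lambda>i. {j \<in> I i. j < LI} \<union> {j - length vM + 1 | j. j \<in> I i \<and> j \<ge> LI})"
  shows "admissible Y J" "\<forall>i\<in>{1..M - 2}. tilde Y J i = tilde X I i"
    "(\<lambda>c. c - (\<Sum>p=1..M - 2. length (vIvars X p))) ` J (M - 1) = tilde X I (M - 1)"
    "psi q X I = (1 - q) * hd uM * (\<Prod>j<length vM - 1. hd uM - vM ! j) * psi q Y J"
proof -
  obtain m where m: "M = Suc m" "m \<ge> 1" using M2 by (cases M) auto
  then obtain m' where m': "m = Suc m'" by (cases m) auto
  obtain u where u: "uM = [u]" using single by (auto simp: length_Suc_conv)
  have hd_u: "hd uM = u" by (simp add: u)
  let ?A = "startI X M" and ?d = "length vM - 1"
  let ?k = "i \<circ> insert_gap ?A ?d" and ?a = "i LI"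
  have LI: "LI = ?A + ?d + 1" using length_vM by (simp add: LI_eq)
  have colLI: "i LI \<in> {1..M}" using colour_LI_range not_top by auto
  have Y: "nlayers Y = m" "uvars Y = uvars X" "vIvars Y = vIvars X" "vIIvars Y = vIIvars X"
    "vMvars Y = vIvars X m @ [u] @ vIIvars X m"
    unfolding Y_def hd_u using m by simp_all
  have start: "startI Y = startI X" "LItotal Y = ?A + 1 + length (vIIvars X m)"
    using startI_Suc[of m X] m by (simp_all add: fun_eq_iff coord_simps(4) startI_def Y)
  have sumII: "sumII X p = sumII Y p + length (vIIvars X m)" if "p \<le> m" for p
    using that by (simp add: sumII_def Y m)
  \<comment> \<open>A second coordinate of layer \<open>M\<close> with colour at most
    \<open>M\<close> would give \<open>I M\<close> two elements, against the single row.\<close>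
  have gap: "i c = M + 1" if c: "c \<in> {?A<..?A + ?d}" for c
  proof (rule ccontr)
    assume "i c \<noteq> M + 1"
    have up: "c \<in> upper_coords X M" "LI \<in> upper_coords X M"
      using c LI layers by (auto simp: upper_coords_eq)
    then have "i c \<in> {1..M}"
      using is_colouring_upper[OF colouring layers up(1)] \<open>i c \<noteq> M + 1\<close> by auto
    then have "{c, LI} \<subseteq> I M"
      using sets[of M] layers up colLI by (auto simp: colour_set_def)
    moreover have "finite (I M)" using sets[of M] layers by (simp add: colour_set_def upper_coords_eq)
    ultimately have "card {c, LI} \<le> 1"
      using cards[of M] layers single card_mono by fastforce
    then show False using c LI by auto
  qed
  have bounds: "startI X j \<le> ?A" "?A + ?d \<le> LI + sumII X j" if "j \<in> {1..m}" for j
    using that LI startI_mono[of j M X] m by auto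
  have shift: "1 \<le> j" "j \<le> M" "j \<le> nlayers Y" "startI Y j = startI X j"
      "LItotal Y + sumII Y j = LI + sumII X j - ?d" if "j \<in> {1..m}" for j
    using that LI sumII[of j] m by (auto simp: Y start)
  have cs: "colour_set X i j = insert_gap ?A ?d ` colour_set Y ?k j" "card (colour_set Y ?k j) = card (colour_set X i j)"
    if j: "j \<in> {1..m}" for j
  proof -
    have g: "i c > j" if "c \<in> {?A<..?A + ?d}" for c
      using gap[OF that] j m by auto
    show "colour_set X i j = insert_gap ?A ?d ` colour_set Y ?k j"
      by (rule colour_set_insert_gap[OF shift[OF j] bounds[OF j] g])
    show "card (colour_set Y ?k j) = card (colour_set X i j)"
      by (rule card_colour_set_insert_gap[OF shift[OF j] bounds[OF j] g])
  qed
  have J: "J j = colour_set Y ?k j" if j: "j \<in> {1..m}" for j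
  proof -
    have "J j = {x \<in> insert_gap ?A ?d ` colour_set Y ?k j. x < LI}
        \<union> {x - length vM + 1 | x. x \<in> insert_gap ?A ?d ` colour_set Y ?k j \<and> x \<ge> LI}"
      using sets[of j] cs(1)[OF j] j m by (simp add: J_def)
    also have "\<dots> = colour_set Y ?k j"
    proof (rule set_eqI, rule iffI)
      fix c assume c: "c \<in> colour_set Y ?k j"
      show "c \<in> {x \<in> insert_gap ?A ?d ` colour_set Y ?k j. x < LI}
        \<union> {x - length vM + 1 | x. x \<in> insert_gap ?A ?d ` colour_set Y ?k j \<and> x \<ge> LI}"
      proof (cases "c \<le> ?A")
        case True
        then have "insert_gap ?A ?d c = c" by (simp add: insert_gap_def)
        then show ?thesis using c True LI by (intro UnI1) (auto intro!: image_eqI[of _ _ c])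
      next
        case False
        then have "insert_gap ?A ?d c = c + ?d" "c + ?d - length vM + 1 = c" "c + ?d \<ge> LI"
          using LI length_vM by (auto simp: insert_gap_def)
        then show ?thesis using c by (intro UnI2 CollectI exI[of _ "c + ?d"]) (auto intro!: image_eqI[of _ _ c])
      qed
    qed (use LI length_vM in \<open>auto simp: insert_gap_def split: if_splits\<close>)
    finally show ?thesis .
  qed
  have col: "is_colouring Y ?k"
    unfolding is_colouring_def
  proof (intro ballI)
    fix p c assume p: "p \<in> {1..nlayers Y}" and c: "c \<in> layer_coords Y p"
    \<comment> \<open>Only the coordinate of \<open>u\<close> leaves its layer: it is sent to
      \<open>LI\<close>, whose colour is at most \<open>M = m + 1\<close> and hence still allowed in
      layer \<open>m\<close>.\<close>
    have "insert_gap ?A ?d c \<in> layer_coords X p \<or> p = m \<and> insert_gap ?A ?d c = LI"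
    proof (cases "p = m")
      case True
      have pX: "m \<in> {1..<nlayers X}" using m by auto
      have "c \<in> {startI X m<..?A + 1 + length (vIIvars X m)}"
        using c layer_coords_top[of Y] True by (simp add: Y start)
      moreover have "sumII X m = length (vIIvars X m)" "sumII X (Suc m) = 0"
        using sumII_top[of X] sumII[of m] sumII_top[of Y] by (simp_all add: m(1) Y)
      ultimately show ?thesis
        using LI unfolding True layer_coords_lower[OF pX] by (auto simp: insert_gap_def m(1))
    next
      case False
      then have p': "p \<in> {1..<nlayers X}" "p \<in> {1..<nlayers Y}" using p Y m by auto
      have "startI X (Suc p) \<le> ?A" by (rule startI_mono) (use p' in auto)
      then show ?thesis
        using c LI sumII[of p] sumII[of "Suc p"] p' Y m unfolding layer_coords_lower[OF p'(1)] layer_coords_lower[OF p'(2)] start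
        by (auto simp: insert_gap_def)
    qed
    then show "?k c \<in> {1..p + 1}"
      using colouring p Y colLI m unfolding is_colouring_def by auto
  qed
  show "admissible Y J"
    unfolding admissible_def
    using col J cs(2) sets cards m by (intro exI[of _ ?k]) (auto simp: Y)
  have tilde_X: "tilde X I j = (\<lambda>c. card {c' \<in> upper_coords Y j. i (insert_gap ?A ?d c') \<in> {1..j + 1} \<and> c' \<le> c}) ` J j"
    if j: "j \<in> {1..m}" for j
  proof -
    have g: "i c > j + 1" if "c \<in> {?A<..?A + ?d}" for c
      using gap[OF that] j m by auto
    show ?thesis
      unfolding J[OF j] by (rule tilde_insert_gap[OF shift[OF j] bounds[OF j] g colouring sets])
  qed
  show "\<forall>j\<in>{1..M - 2}. tilde Y J j = tilde X I j"
  proof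
    fix j assume "j \<in> {1..M - 2}"
    then have j: "j \<in> {1..m}" using m by auto
    have "tilde Y J j = (\<lambda>c. card {c' \<in> upper_coords Y j. ?k c' \<in> {1..j + 1} \<and> c' \<le> c}) ` J j"
      by (rule tilde_eq[OF col]) (use J j Y in auto)
    then show "tilde Y J j = tilde X I j"
      using tilde_X[OF j] by simp
  qed
  show "(\<lambda>c. c - (\<Sum>p=1..M - 2. length (vIvars X p))) ` J (M - 1) = tilde X I (M - 1)"
  proof -
    have mm: "m \<in> {1..m}" using m by simp
    \<comment> \<open>In the top layer of \<open>Y\<close> every colour is at most
      \<open>m + 1\<close>, so the rank counts all coordinates of that layer and amounts to
      subtracting the offset.\<close>
    have "card {c' \<in> upper_coords Y m. i (insert_gap ?A ?d c') \<in> {1..m + 1} \<and> c' \<le> c} = c - startI X m"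
      if c: "c \<in> J m" for c
    proof -
      have c': "c \<in> upper_coords Y m" using c J[OF mm] by (simp add: colour_set_def)
      have "i (insert_gap ?A ?d c') \<in> {1..m + 1}" if "c' \<in> upper_coords Y m" for c'
        using is_colouring_upper[OF col _ that] m Y by simp
      then have "{c' \<in> upper_coords Y m. i (insert_gap ?A ?d c') \<in> {1..m + 1} \<and> c' \<le> c} = {startI X m<..c}"
        using c' m Y(1) by (auto simp: upper_coords_eq start)
      then show ?thesis by simp
    qed
    moreover have "(\<Sum>p=1..M - 2. length (vIvars X p)) = startI X m"
      by (simp add: startI_def m m' atLeastLessThanSuc_atLeastAtMost)
    ultimately show ?thesis
      using tilde_X[OF mm] by (simp add: m(1))
  qed
  have wI: "word_I Y ?k p = word_I X i p" if "p \<in> {1..<nlayers Y}" for p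
    unfolding word_I_def start Y using top_edge_coords[of p] that m Y
    by (intro map_cong refl) (fastforce simp: insert_gap_def simp del: upt_Suc)
  have wII: "word_II Y ?k p = word_II X i p" if "p \<in> {1..<nlayers Y}" for p
    unfolding word_II_def start Y using LI sumII[of "Suc p"] that Y
    by (intro map_cong refl) (auto simp: insert_gap_def add_ac simp del: upt_Suc)
  have wM: "word_M Y ?k = word_I X i m @ [?a] @ word_II X i m"
  proof -
    have "word_M Y ?k = map (\<lambda>s. ?k (startI X m + s)) [1..<Suc (length (vIvars X m) + (1 + length (vIIvars X m)))]"
      unfolding word_M_def start Y by (simp del: upt_Suc)
    also have "\<dots> = word_I X i m @ [?a] @ word_II X i m"
    proof -
      have A: "?A = startI X m + length (vIvars X m)" using startI_Suc[of m X] m by simp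
      have "map (\<lambda>s. ?k (startI X m + s)) [1..<Suc (length (vIvars X m))] = word_I X i m"
        unfolding word_I_def by (intro map_cong refl) (auto simp: insert_gap_def A simp del: upt_Suc)
      moreover have "map (\<lambda>s. ?k (startI X m + (length (vIvars X m) + s))) [1..<Suc 1] = [?a]"
        using LI A by (simp add: insert_gap_def)
      moreover have "map (\<lambda>s. ?k (startI X m + (length (vIvars X m) + (1 + s)))) [1..<Suc (length (vIIvars X m))] = word_II X i m"
        unfolding word_II_def using LI A sumII_top[of X]
        by (intro map_cong refl) (auto simp: insert_gap_def m(1) add_ac simp del: upt_Suc)
      ultimately show ?thesis
        unfolding map_upt_add by (simp del: upt_Suc)
    qed
    finally show ?thesis .
  qed
  have "psi q Y J = total M q X (word_I X i) (word_II X i) m' M (uvars X m) (vIvars X m @ [u] @ vIIvars X m)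
      (word_I X i m @ [?a] @ word_II X i m)"
    using psi_eq_total_insert_gap[of Y i ?A ?d J "word_I X i" "word_II X i" "word_I X i m @ [?a] @ word_II X i m" X q] col J wI wII wM m
    by (simp add: Y m')
  also have "\<dots> = below M q X (word_I X i) (word_II X i) m [u] [?a]"
    unfolding m' below_Suc_eq_total by (simp add: m m')
  \<comment> \<open>Here the number of colours changes: the smaller function is built with
    \<open>M\<close> colours, the lower layers of \<open>X\<close> with
    \<open>M + 1\<close>.\<close>
  also have "\<dots> = below (M + 1) q X (word_I X i) (word_II X i) m [u] [?a]"
    using below_restrict[of M "M + 1" m q X "word_I X i" "word_II X i" "[u]" "[?a]"] m by simp
  finally have Ypsi: "psi q Y J = below (M + 1) q X (word_I X i) (word_II X i) m [u] [?a]" .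
  \<comment> \<open>By \<open>gap\<close> all columns of layer \<open>M\<close> but the last have
    top colour \<open>M + 1\<close>, the form that \<open>total_single_row\<close> expects.\<close>
  have rest: "word_rest = replicate (length (butlast vM)) (M + 1)"
  proof (rule nth_equalityI)
    fix s assume "s < length word_rest"
    then show "word_rest ! s = replicate (length (butlast vM)) (M + 1) ! s"
      using gap[of "?A + (1 + s)"] by (simp add: word_rest_def)
  qed simp
  have "psi q X I = (1 - q) * u * prod_list (map (\<lambda>v. u - v) (butlast vM)) * psi q Y J"
    unfolding psi_eq rest Ypsi u
    using total_single_row[of "M + 1" "M + 1" ?a q X "word_I X i" "word_II X i" m u "butlast vM" "last vM"] colLI m by simp
  then show "psi q X I = (1 - q) * hd uM * (\<Prod>j<length vM - 1. hd uM - vM ! j) * psi q Y J"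
    by (simp add: prod_list_eq_prod nth_butlast u)
qed

end

theorem proposition2p7:
  fixes q :: "'a::field_char_0" and X :: "'a vars" and I :: "nat \<Rightarrow> nat set"
  assumes "q \<noteq> 0"
    and "nlayers X \<ge> 1"
    and "length (vMvars X) \<ge> 1"
    and "admissible X I"
  shows
    "let M = nlayers X; uM = uvars X M; k = length uM; vM = vMvars X; L = length vM; LI = LItotal X
     in
       (colour X I LI \<noteq> M + 1 \<longrightarrow>
          (\<exists>P. degree P \<le> k - 1 \<and> (\<forall>x. psi q (X\<lparr>vMvars := vM[L - 1 := x]\<rparr>) I = poly P x)))
     \<and> (\<forall>\<pi>. \<pi> permutes {..<k} \<longrightarrow>
          psi q (X\<lparr>uvars := (uvars X)(M := permute_list \<pi> uM)\<rparr>) I = psi q X I)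
     \<and> (M \<ge> 2 \<and> colour X I LI \<noteq> M + 1 \<longrightarrow>
          (let Y = X\<lparr>uvars := (uvars X)(M := butlast uM),
                     vIIvars := (vIIvars X)(M - 1 := last uM # vIIvars X (M - 1)),
                     vMvars := butlast vM\<rparr>;
               J = (\<lambda>i. if i = M then I M - {LI} else I i)
           in admissible Y J
            \<and> (\<forall>i\<in>{1..M - 1}. tilde Y J i = tilde X I i)
            \<and> psi q (X\<lparr>vMvars := vM[L - 1 := inverse q * last uM]\<rparr>) I
              = (1 - q) * last uM * (\<Prod>j<L - 1. last uM - vM ! j)
                * (\<Prod>j<k - 1. q * uM ! j - last uM) * psi q Y J))
     \<and> (colour X I LI = M + 1 \<longrightarrow>
          (let Y = X\<lparr>vMvars := butlast vM\<rparr>;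
               J = (\<lambda>i. if i = M then I M
                        else {j \<in> I i. j \<le> LI} \<union> {j - 1 | j. j \<in> I i \<and> j > LI})
           in admissible Y J
            \<and> (\<forall>i\<in>{1..M - 1}. tilde Y J i = tilde X I i)
            \<and> psi q X I = (\<Prod>j<k. uM ! j - q * last vM) * psi q Y J))
     \<and> (M \<ge> 2 \<and> k = 1 \<and> colour X I LI \<noteq> M + 1 \<longrightarrow>
          (let Y = X\<lparr>nlayers := M - 1,
                     vMvars := vIvars X (M - 1) @ [hd uM] @ vIIvars X (M - 1)\<rparr>;
               J = (\<lambda>i. {j \<in> I i. j < LI} \<union> {j - L + 1 | j. j \<in> I i \<and> j \<ge> LI})
           in admissible Y J
            \<and> (\<forall>i\<in>{1..M - 2}. tilde Y J i = tilde X I i)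
            \<and> (\<lambda>c. c - (\<Sum>p=1..M - 2. length (vIvars X p))) ` J (M - 1) = tilde X I (M - 1)
            \<and> psi q X I
              = (1 - q) * hd uM * (\<Prod>j<L - 1. hd uM - vM ! j) * psi q Y J))"
proof -
  obtain i where i: "is_colouring X i"
    "\<And>j. j \<in> {1..nlayers X} \<Longrightarrow> I j = colour_set X i j \<and> card (I j) = length (uvars X j)"
    using assms(4) unfolding admissible_def by blast
  interpret coloured X I i
  proof
    show "I j = colour_set X i j" "card (I j) = length (uvars X j)" if "j \<in> {1..nlayers X}" for j
      using i(2)[OF that] by blast+
  qed (use assms i in auto)
  show ?thesis
    \<comment> \<open>The statement speaks of the colour recovered from \<open>I\<close>; here it is
      replaced by the value of the chosen colouring.\<close>
    unfolding Let_def colour_LI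
  proof (intro conjI impI allI)
    assume "i LI \<noteq> M + 1"
    then show "\<exists>P. degree P \<le> length uM - 1 \<and> (\<forall>x. psi q (X\<lparr>vMvars := vM[length vM - 1 := x]\<rparr>) I = poly P x)"
      by (rule psi_polynomial)
  next
    fix \<pi> assume "\<pi> permutes {..<length uM}"
    then show "psi q (X\<lparr>uvars := (uvars X)(M := permute_list \<pi> uM)\<rparr>) I = psi q X I"
      by (rule psi_symmetric)
  qed ((elim conjE)?; (rule case_A[OF assms(1)] | rule case_B | rule initial_condition); assumption)+
qed

end
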